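(* Let $\Xi$ be a finite subset of $\mathbb{Z}_{\ge0}$ and let $\phi=\oplus_{i\in\Xi}(Q_i\odot Y^i)\in\mathcal{A}[Y]$, where $\mathcal{A}=\mathcal{P}_\omega$, be in product form. If $\phi$ is degenerate, then the tuple $(Q_i\,|\,i\in\Xi)$ is a root of the polyhedralised discriminant $\tilde{\Delta}_{\Xi}$. Conversely, if the tuple $(Q_i\,|\,i\in\Xi)$ is a root of $\tilde{\Delta}_{\Xi}$, then $\phi$ is weakly degenerate.
   Context: Fix $n\ge 1$ and $\omega\in(\mathbb{R}^n)^\star$ whose coordinates are linearly independent over $\mathbb{Q}$. A nonempty polyhedron $P\subset\mathbb{R}^n$ is $\omega$-positive if $\min_{x\in P}\omega(x)$ exists. $\mathcal{A}=\mathcal{P}_\omega$ is the semiring of all $\omega$-positive rational polyhedra together with an extra element $0_{\mathcal{A}}$, with addition $\oplus$ = (closed) convex hull of the union, multiplication $\odot$ = Minkowski sum, $P\oplus 0_{\mathcal{A}}=P$, $P\odot 0_{\mathcal{A}}=0_{\mathcal{A}}$; the multiplicative identity is the polyhedron $\{0\}$. Polynomials $\phi=\oplus_{\alpha\in\mathcal{S}}(Q_\alpha\odot Y^\alpha)\in\mathcal{A}[Y_1,\dots,Y_h]$ ($\mathcal{S}\subset(\mathbb{Z}_{\ge0})^h$ finite nonempty, $Q_\alpha\neq0_{\mathcal{A}}$, $Y^\alpha=Y_1^{\alpha_1}\odot\cdots\odot Y_h^{\alpha_h}$) form a semiring under the usual operations. The evaluation at $P=(P_1,\dots,P_h)$ is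 $\phi(P)=\oplus_\alpha(Q_\alpha\odot P_1^{\odot\alpha_1}\odot\cdots\odot P_h^{\odot\alpha_h})$, with $P_j^{\odot k}$ the $k$-fold Minkowski sum and $P_j^{\odot0}=\{0\}$. A tuple $P$ of polyhedra in $\mathcal{P}_\omega\setminus\{0_{\mathcal{A}}\}$ is a root of $\phi$ if every vertex of $\phi(P)$ is a vertex of at least two distinct summands. Univariate polynomials $\phi_1,\phi_2\in\mathcal{A}[Y]$ represent the same function if $\phi_1(P)=\phi_2(P)$ for all $P\in\mathcal{A}$. A root $P_0$ of $\phi\in\mathcal{A}[Y]$ has multiplicity $m-1$ if $m$ is the maximum integer for which there is $\tilde\phi\in\mathcal{A}[Y]$ representing the same function as $\phi$ such that every vertex of $\tilde\phi(P_0)$ is shared by at least $m$ summands of $\tilde\phi(P_0)$. The support of a polyhedron $P$ is the union of the inner normal cones of its vertices, i.e. the set of $\ell\in(\mathbb{R}^n)^\star$ bounded below on $P$. The polynomial $\phi=\oplus_i(Q_i\odot Y^i)$ is weakly degenerate if it has a root $P_0$ of multiplicity at least two; it is degenerate if it has such a root $P_0$ whose support in addition equals the support of $\odot_iQ_i$. A polynomial $\phi\in\mathcal{A}[Y]$ of degree $d$ is in product form if there are polyhedra $Q,P_1,\dots,P_d\in\mathcal{A}$ with $\phi=Q\odot(\odot_{i=1}^d(Y\oplus P_i))$ as an identity in the semiring $\mathcal{A}[Y]$. $X$-discriminant: for a finite $\Xi\subset\mathbb{Z}_{\ge0}$ with maximum $d$, let $X$ be the image of $\mathbb{P}^1_{\mathbb{C}}\to\mathbb{P}^{|\Xi|-1}_{\mathbb{C}}$,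 $[x:y]\mapsto[x^iy^{d-i}\,|\,i\in\Xi]$. The $X$-discriminant associated with $\Xi$ is the defining equation $\Delta=\sum_\alpha c_\alpha Y^\alpha\in\mathbb{C}[Y_i\,|\,i\in\Xi]$ of the dual variety $X^\vee$, an irreducible hypersurface (with $\Delta=1$ if $X^\vee$ is not a hypersurface). The polyhedralised discriminant is $\tilde\Delta_\Xi=\oplus_{\alpha:\,c_\alpha\neq0}(\{0\}\odot Y^\alpha)\in\mathcal{A}[Y_i\,|\,i\in\Xi]$. *)

theory Defs
  imports
    "HOL-Analysis.Analysis"
    "HOL-Library.Poly_Mapping"
    "HOL-Library.Set_Algebras"
    "HOL-Library.Function_Algebras"
    "HOL-Algebra.UnivPoly"
begin

section \<open>The semiring of rational polyhedra that are positive with respect to a linear form\<close>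

text \<open>
  Linear forms on \<open>real ^ 'n\<close> are represented by vectors via the inner product. A rational
  polyhedron is cut out by finitely many linear inequalities with rational coefficients and
  rational constant terms.
\<close>

definition rational_polyhedron :: "(real ^ 'n) set \<Rightarrow> bool" where
  "rational_polyhedron P \<longleftrightarrow>
     (\<exists>F. finite F \<and> P = \<Inter> F \<and>
        (\<forall>H \<in> F. \<exists>a b. a \<noteq> 0 \<and> (\<forall>i. a $ i \<in> \<rat>) \<and> b \<in> \<rat> \<and> H = {x. a \<bullet> x \<le> b}))"

definition positive_for :: "real ^ 'n \<Rightarrow> (real ^ 'n) set \<Rightarrow> bool" where
  "positive_for \<omega> P \<longleftrightarrow> (\<exists>x \<in> P. \<forall>y \<in> P. \<omega> \<bullet> x \<le> \<omega> \<bullet> y)"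

definition rationally_independent :: "real ^ 'n \<Rightarrow> bool" where
  "rationally_independent \<omega> \<longleftrightarrow>
     (\<forall>q :: 'n \<Rightarrow> rat. (\<Sum>i\<in>UNIV. of_rat (q i) * \<omega> $ i) = 0 \<longrightarrow> (\<forall>i. q i = 0))"

text \<open>
  The extra element \<open>0\<close> of the semiring is represented by the empty set, which is not a positive
  polyhedron; the formulas below for addition and multiplication then also yield
  \<open>P \<oplus> 0 = P\<close> and \<open>P \<otimes> 0 = 0\<close>. The sum \<open>P + Q\<close> of two sets is the Minkowski sum.
\<close>

definition polyhedra_semiring :: "real ^ 'n \<Rightarrow> (real ^ 'n) set ring" where
  "polyhedra_semiring \<omega> =
     \<lparr>carrier = insert {} {P. rational_polyhedron P \<and> P \<noteq> {} \<and> positive_for \<omega> P},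
      mult = (\<lambda>P Q. P + Q),
      one = {0},
      zero = {},
      add = (\<lambda>P Q. closure (convex hull (P \<union> Q)))\<rparr>"

definition polyhedron_support :: "(real ^ 'n) set \<Rightarrow> (real ^ 'n) set" where
  "polyhedron_support P =
     (\<Union>v \<in> {v. v extreme_point_of P}. {l. \<forall>x \<in> P. l \<bullet> v \<le> l \<bullet> x})"


section \<open>Roots of polynomials over the semiring\<close>

text \<open>
  Summands are counted by their index: two summands with different indices are distinct even if
  they are equal as sets.
\<close>

definition vertices_shared ::
    "(real ^ 'n) set ring \<Rightarrow> nat \<Rightarrow> 'i set \<Rightarrow> ('i \<Rightarrow> (real ^ 'n) set) \<Rightarrow> bool" where
  "vertices_shared A m S T \<longleftrightarrow>
     (\<forall>v. v extreme_point_of (\<Oplus>\<^bsub>A\<^esub>i\<in>S. T i) \<longrightarrow> m \<le> card {i \<in> S. v extreme_point_of T i})"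

text \<open>Univariate polynomials are elements of \<^term>\<open>UP A\<close>.\<close>

definition usupp :: "('a, 'b) ring_scheme \<Rightarrow> (nat \<Rightarrow> 'a) \<Rightarrow> nat set" where
  "usupp A \<phi> = {i. coeff (UP A) \<phi> i \<noteq> \<zero>\<^bsub>A\<^esub>}"

definition usummand :: "('a, 'b) ring_scheme \<Rightarrow> (nat \<Rightarrow> 'a) \<Rightarrow> 'a \<Rightarrow> nat \<Rightarrow> 'a" where
  "usummand A \<phi> P i = coeff (UP A) \<phi> i \<otimes>\<^bsub>A\<^esub> P [^]\<^bsub>A\<^esub> i"

definition ueval :: "('a, 'b) ring_scheme \<Rightarrow> (nat \<Rightarrow> 'a) \<Rightarrow> 'a \<Rightarrow> 'a" where
  "ueval A \<phi> P = (\<Oplus>\<^bsub>A\<^esub>i\<in>usupp A \<phi>. usummand A \<phi> P i)"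

definition same_function :: "('a, 'b) ring_scheme \<Rightarrow> (nat \<Rightarrow> 'a) \<Rightarrow> (nat \<Rightarrow> 'a) \<Rightarrow> bool" where
  "same_function A \<phi> \<psi> \<longleftrightarrow> (\<forall>P \<in> carrier A. ueval A \<phi> P = ueval A \<psi> P)"

definition uroot :: "(real ^ 'n) set ring \<Rightarrow> (nat \<Rightarrow> (real ^ 'n) set) \<Rightarrow> (real ^ 'n) set \<Rightarrow> bool" where
  "uroot A \<phi> P \<longleftrightarrow>
     P \<in> carrier A - {\<zero>\<^bsub>A\<^esub>} \<and> vertices_shared A 2 (usupp A \<phi>) (usummand A \<phi> P)"

definition shared_by_representative ::
    "(real ^ 'n) set ring \<Rightarrow> (nat \<Rightarrow> (real ^ 'n) set) \<Rightarrow> (real ^ 'n) set \<Rightarrow> nat \<Rightarrow> bool" where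
  "shared_by_representative A \<phi> P m \<longleftrightarrow>
     (\<exists>\<psi> \<in> carrier (UP A). same_function A \<psi> \<phi> \<and>
        vertices_shared A m (usupp A \<psi>) (usummand A \<psi> P))"

definition root_multiplicity ::
    "(real ^ 'n) set ring \<Rightarrow> (nat \<Rightarrow> (real ^ 'n) set) \<Rightarrow> (real ^ 'n) set \<Rightarrow> nat \<Rightarrow> bool" where
  "root_multiplicity A \<phi> P k \<longleftrightarrow>
     uroot A \<phi> P \<and>
     (\<exists>m. k = m - 1 \<and> shared_by_representative A \<phi> P m \<and>
          (\<forall>m'. shared_by_representative A \<phi> P m' \<longrightarrow> m' \<le> m))"

definition weakly_degenerate :: "(real ^ 'n) set ring \<Rightarrow> (nat \<Rightarrow> (real ^ 'n) set) \<Rightarrow> bool" where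
  "weakly_degenerate A \<phi> \<longleftrightarrow> (\<exists>P k. root_multiplicity A \<phi> P k \<and> 2 \<le> k)"

definition degenerate :: "(real ^ 'n) set ring \<Rightarrow> (nat \<Rightarrow> (real ^ 'n) set) \<Rightarrow> bool" where
  "degenerate A \<phi> \<longleftrightarrow>
     (\<exists>P k. root_multiplicity A \<phi> P k \<and> 2 \<le> k \<and>
        polyhedron_support P =
        polyhedron_support (\<Otimes>\<^bsub>A\<^esub>i\<in>usupp A \<phi>. coeff (UP A) \<phi> i))"

definition product_form :: "('a, 'b) ring_scheme \<Rightarrow> (nat \<Rightarrow> 'a) \<Rightarrow> bool" where
  "product_form A \<phi> \<longleftrightarrow>
     (\<exists>Q \<in> carrier A. \<exists>P \<in> {1..deg A \<phi>} \<rightarrow> carrier A.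
        \<phi> = monom (UP A) Q 0 \<otimes>\<^bsub>UP A\<^esub>
              (\<Otimes>\<^bsub>UP A\<^esub>i\<in>{1..deg A \<phi>}. monom (UP A) \<one>\<^bsub>A\<^esub> 1 \<oplus>\<^bsub>UP A\<^esub> monom (UP A) (P i) 0))"

text \<open>
  A polynomial in variables indexed by a finite set \<open>I\<close> is given by its coefficient function on
  exponent vectors, which are the finitely supported maps \<open>nat \<Rightarrow>\<^sub>0 nat\<close>.
\<close>

definition msupp :: "('a, 'b) ring_scheme \<Rightarrow> ((nat \<Rightarrow>\<^sub>0 nat) \<Rightarrow> 'a) \<Rightarrow> (nat \<Rightarrow>\<^sub>0 nat) set" where
  "msupp A \<Phi> = {\<alpha>. \<Phi> \<alpha> \<noteq> \<zero>\<^bsub>A\<^esub>}"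

definition msummand ::
    "('a, 'b) ring_scheme \<Rightarrow> nat set \<Rightarrow> ((nat \<Rightarrow>\<^sub>0 nat) \<Rightarrow> 'a) \<Rightarrow> (nat \<Rightarrow> 'a) \<Rightarrow> (nat \<Rightarrow>\<^sub>0 nat) \<Rightarrow> 'a" where
  "msummand A I \<Phi> P \<alpha> = \<Phi> \<alpha> \<otimes>\<^bsub>A\<^esub> (\<Otimes>\<^bsub>A\<^esub>i\<in>I. P i [^]\<^bsub>A\<^esub> Poly_Mapping.lookup \<alpha> i)"

definition mroot ::
    "(real ^ 'n) set ring \<Rightarrow> nat set \<Rightarrow> ((nat \<Rightarrow>\<^sub>0 nat) \<Rightarrow> (real ^ 'n) set) \<Rightarrow>
     (nat \<Rightarrow> (real ^ 'n) set) \<Rightarrow> bool" where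
  "mroot A I \<Phi> P \<longleftrightarrow>
     (\<forall>i \<in> I. P i \<in> carrier A - {\<zero>\<^bsub>A\<^esub>}) \<and>
     vertices_shared A 2 (msupp A \<Phi>) (msummand A I \<Phi> P)"


section \<open>Projective varieties and dual varieties\<close>

type_synonym cmpoly = "(nat \<Rightarrow>\<^sub>0 nat) \<Rightarrow>\<^sub>0 complex"

text \<open>The polynomial ring over the complex numbers in the variables indexed by \<open>I\<close>.\<close>

definition cpolys :: "nat set \<Rightarrow> cmpoly set" where
  "cpolys I = {f. \<forall>\<alpha> \<in> Poly_Mapping.keys f. Poly_Mapping.keys \<alpha> \<subseteq> I}"

definition ceval :: "cmpoly \<Rightarrow> (nat \<Rightarrow> complex) \<Rightarrow> complex" where
  "ceval f v = (\<Sum>\<alpha>\<in>Poly_Mapping.keys f.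
     Poly_Mapping.lookup f \<alpha> * (\<Prod>i\<in>Poly_Mapping.keys \<alpha>. v i ^ Poly_Mapping.lookup \<alpha> i))"

definition homogeneous :: "nat \<Rightarrow> cmpoly \<Rightarrow> bool" where
  "homogeneous k f \<longleftrightarrow>
     (\<forall>\<alpha> \<in> Poly_Mapping.keys f. (\<Sum>i\<in>Poly_Mapping.keys \<alpha>. Poly_Mapping.lookup \<alpha> i) = k)"

text \<open>
  A point of the projective space with coordinates indexed by \<open>I\<close> is represented by its vectors
  of homogeneous coordinates, and a subset of the projective space by the set of all vectors of
  homogeneous coordinates of its points.
\<close>

definition hcoords :: "nat set \<Rightarrow> (nat \<Rightarrow> complex) set" where
  "hcoords I = {v. v \<noteq> (\<lambda>_. 0) \<and> (\<forall>i. i \<notin> I \<longrightarrow> v i = 0)}"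

definition proj_zeros :: "nat set \<Rightarrow> cmpoly set \<Rightarrow> (nat \<Rightarrow> complex) set" where
  "proj_zeros I F = {v \<in> hcoords I. \<forall>f \<in> F. ceval f v = 0}"

definition proj_closed :: "nat set \<Rightarrow> (nat \<Rightarrow> complex) set \<Rightarrow> bool" where
  "proj_closed I Z \<longleftrightarrow> (\<exists>F \<subseteq> {f \<in> cpolys I. \<exists>k. homogeneous k f}. Z = proj_zeros I F)"

definition proj_closure :: "nat set \<Rightarrow> (nat \<Rightarrow> complex) set \<Rightarrow> (nat \<Rightarrow> complex) set" where
  "proj_closure I S = \<Inter> {Z. proj_closed I Z \<and> S \<subseteq> Z}"

definition proj_irreducible :: "nat set \<Rightarrow> (nat \<Rightarrow> complex) set \<Rightarrow> bool" where
  "proj_irreducible I Z \<longleftrightarrow>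
     proj_closed I Z \<and> Z \<noteq> {} \<and>
     (\<forall>Z1 Z2. proj_closed I Z1 \<and> proj_closed I Z2 \<and> Z = Z1 \<union> Z2 \<longrightarrow> Z = Z1 \<or> Z = Z2)"

definition proj_dim :: "nat set \<Rightarrow> (nat \<Rightarrow> complex) set \<Rightarrow> nat" where
  "proj_dim I Z =
     Sup {k. \<exists>C. (\<forall>j\<le>k. proj_irreducible I (C j) \<and> C j \<subseteq> Z) \<and> (\<forall>j<k. C j \<subset> C (Suc j))}"

definition vanishing_ideal :: "nat set \<Rightarrow> (nat \<Rightarrow> complex) set \<Rightarrow> cmpoly set" where
  "vanishing_ideal I Z = {f \<in> cpolys I. \<forall>v \<in> Z. ceval f v = 0}"

text \<open>
  The linear subspace of all \<open>v\<close> that are annihilated by the differentials at \<open>p\<close> of the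
  polynomials vanishing on \<open>Z\<close>. Its projectivisation is the embedded projective tangent space
  of \<open>Z\<close> at \<open>p\<close>, so that it has dimension \<open>proj_dim I Z + 1\<close> at smooth points.
\<close>

definition affine_tangent_space ::
    "nat set \<Rightarrow> (nat \<Rightarrow> complex) set \<Rightarrow> (nat \<Rightarrow> complex) \<Rightarrow> (nat \<Rightarrow> complex) set" where
  "affine_tangent_space I Z p =
     {v. (\<forall>i. i \<notin> I \<longrightarrow> v i = 0) \<and>
         (\<forall>f \<in> vanishing_ideal I Z.
            ((\<lambda>t. ceval f (\<lambda>i. p i + t * v i)) has_field_derivative 0) (at 0))}"

definition smooth_point :: "nat set \<Rightarrow> (nat \<Rightarrow> complex) set \<Rightarrow> (nat \<Rightarrow> complex) \<Rightarrow> bool" where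
  "smooth_point I Z p \<longleftrightarrow>
     p \<in> Z \<and>
     vector_space.dim (\<lambda>(c :: complex) v i. c * v i) (affine_tangent_space I Z p) = proj_dim I Z + 1"

text \<open>
  The closure of the set of hyperplanes that are tangent to \<open>Z\<close> at some smooth point, where
  \<open>c\<close> stands for the hyperplane \<open>{v. (\<Sum>i\<in>I. c i * v i) = 0}\<close>.
\<close>

definition dual_variety :: "nat set \<Rightarrow> (nat \<Rightarrow> complex) set \<Rightarrow> (nat \<Rightarrow> complex) set" where
  "dual_variety I Z =
     proj_closure I {c \<in> hcoords I. \<exists>p. smooth_point I Z p \<and>
                       (\<forall>v \<in> affine_tangent_space I Z p. (\<Sum>i\<in>I. c i * v i) = 0)}"

definition proj_hypersurface :: "nat set \<Rightarrow> (nat \<Rightarrow> complex) set \<Rightarrow> bool" where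
  "proj_hypersurface I Z \<longleftrightarrow>
     Z \<noteq> {} \<and>
     (\<exists>f \<in> cpolys I. \<exists>k>0. f \<noteq> 0 \<and> homogeneous k f \<and> Z = proj_zeros I {f})"


section \<open>Discriminants\<close>

text \<open>
  The monomials in the parametrisation have a common zero if \<open>0 \<notin> \<Xi>\<close>. The closure of the image of
  the remaining points is the image of the unique extension to the whole projective line; if
  \<open>0 \<in> \<Xi>\<close>, then the image is already closed. The factor \<open>c\<close> accounts for the choice of
  homogeneous coordinates.
\<close>

definition monomial_curve :: "nat set \<Rightarrow> (nat \<Rightarrow> complex) set" where
  "monomial_curve \<Xi> =
     proj_closure \<Xi> {v \<in> hcoords \<Xi>. \<exists>c x y. \<forall>i \<in> \<Xi>. v i = c * (x ^ i * y ^ (Max \<Xi> - i))}"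

text \<open>
  The defining equation of a hypersurface is a generator of its vanishing ideal; it is unique up
  to nonzero scalars, hence the use of a relation.
\<close>

definition is_X_discriminant :: "nat set \<Rightarrow> cmpoly \<Rightarrow> bool" where
  "is_X_discriminant \<Xi> \<Delta> \<longleftrightarrow>
     (let Z = dual_variety \<Xi> (monomial_curve \<Xi>) in
      if proj_hypersurface \<Xi> Z
      then \<Delta> \<in> cpolys \<Xi> \<and> vanishing_ideal \<Xi> Z = {f \<in> cpolys \<Xi>. \<Delta> dvd f}
      else \<Delta> = 1)"

definition polyhedralise :: "('a, 'b) ring_scheme \<Rightarrow> cmpoly \<Rightarrow> (nat \<Rightarrow>\<^sub>0 nat) \<Rightarrow> 'a" where
  "polyhedralise A \<Delta> \<alpha> = (if Poly_Mapping.lookup \<Delta> \<alpha> \<noteq> 0 then \<one>\<^bsub>A\<^esub> else \<zero>\<^bsub>A\<^esub>)"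

end

(*
  Let h_P(l) be the minimum of a linear form l on a polyhedron P. The map that sends P to h_P is an
  injective homomorphism from the semiring of polyhedra to the functions with values in the
  semiring (min, +), so that identities in the semiring, and the vertices of a sum, can be studied
  for one form l at a time. The product form of phi says that i -> h_{Q_i}(l) is discretely convex
  on an interval {a..d}, and phi has a multiple root at l if and only if this sequence is not
  strictly convex.

  The X-discriminant is thus the classical discriminant of binary forms of degree d - a, and it
  vanishes exactly on the forms with a multiple root. It remains to see that the weights
  q_i = h_{Q_i}(l) are minimised by at least two monomials of the discriminant if and only if the
  convex sequence q is not strictly convex. If q is strictly convex, then forms with coefficients of
  size t^{q_i} are lacunary and have no multiple root for small t; but if the initial form of the
  discriminant had two terms, then it would have a zero in the torus, which lifts by Hurwitz' theorem
  to a zero of the discriminant of this size. If q is not strictly convex, then there are forms with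
  a double root and coefficients of size t^{q_i}; a unique minimal monomial would dominate there.

  For the converse direction it is enough to find an equality of slopes at the form omega. The root
  is then the sum of a point and a cone that is so large that only one vertex remains.
*)

theory Submission
  imports
    Defs
    "Jordan_Normal_Form.Determinant"
    "HOL-Complex_Analysis.Great_Picard"
    "HOL-Computational_Algebra.Fundamental_Theorem_Algebra"
begin

no_notation Matrix.scalar_prod (infix "\<bullet>" 70)
no_notation Matrix.vec_index (infixl "$" 100)
no_notation fps_nth (infixl "$" 75)

section \<open>Rational cones and polyhedra\<close>

text \<open>Of the discriminant only three facts are available: it lies in the right polynomial
  ring, it is nonzero, and its zeros are the forms with a multiple root. No monomial of it is known
  explicitly, so everything about minimal monomials is derived from the sizes of zeros, with real
  powers \<open>t powr q i\<close> because the weights are real numbers. Even the occurrence of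
  every variable is obtained in this way; it ensures that a form which exposes a vertex of the
  evaluated discriminant is bounded below on every Q_i. The equality of supports then makes this
  form bounded below on the root P as well, and this is where degeneracy enters rather than weak
  degeneracy. Multiplicity refers to all polynomials with the same function. They may have
  additional summands, but those that share a vertex minimal for l have indices between two indices
  that are minimal for phi itself. Rational independence makes \<omega> injective on rational
  points, so that its minimum is attained at one vertex only. At \<omega> all values are finite,
  which is why the converse can be argued there.\<close>

definition rational_vector :: "'a::euclidean_space \<Rightarrow> bool" where
  "rational_vector x \<longleftrightarrow> (\<forall>b\<in>Basis. x \<bullet> b \<in> \<rat>)"

lemma rational_vector_0 [simp]: "rational_vector 0"
  by (simp add: rational_vector_def)

lemma rational_vector_add: "rational_vector x \<Longrightarrow> rational_vector y \<Longrightarrow> rational_vector (x + y)"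
  by (simp add: rational_vector_def inner_add_left)

lemma rational_vector_diff: "rational_vector x \<Longrightarrow> rational_vector y \<Longrightarrow> rational_vector (x - y)"
  by (simp add: rational_vector_def inner_diff_left)

lemma rational_vector_minus: "rational_vector x \<Longrightarrow> rational_vector (- x)"
  by (simp add: rational_vector_def)

lemma rational_vector_scaleR: "r \<in> \<rat> \<Longrightarrow> rational_vector x \<Longrightarrow> rational_vector (r *\<^sub>R x)"
  by (simp add: rational_vector_def)

lemma rational_vector_Basis: "b \<in> Basis \<Longrightarrow> rational_vector b"
  by (auto simp: rational_vector_def inner_Basis)

lemma rational_vector_inner: "rational_vector x \<Longrightarrow> rational_vector y \<Longrightarrow> x \<bullet> y \<in> \<rat>"
  by (subst euclidean_inner) (auto simp: rational_vector_def intro!: Rats_sum)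

lemma rational_vector_Pair: "rational_vector (x, y) \<longleftrightarrow> rational_vector x \<and> rational_vector y"
  unfolding rational_vector_def Basis_prod_def by (simp add: ball_Un image_iff Ball_def) blast

lemma rational_vector_real: "rational_vector (r::real) \<longleftrightarrow> r \<in> \<rat>"
  by (simp add: rational_vector_def)

lemma rational_vector_cart: "rational_vector (x :: real ^ 'n) \<longleftrightarrow> (\<forall>i. x $ i \<in> \<rat>)"
  by (auto simp: rational_vector_def Basis_vec_def inner_axis)

section \<open>Finitely generated cones\<close>

definition gen_cone :: "'a::real_vector set \<Rightarrow> 'a set" where
  "gen_cone B = {x. \<exists>w. (\<forall>b\<in>B. 0 \<le> w b) \<and> x = (\<Sum>b\<in>B. w b *\<^sub>R b)}"

lemma gen_cone_empty [simp]: "gen_cone {} = {0}"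
  by (auto simp: gen_cone_def)

lemma gen_cone_0: "0 \<in> gen_cone B"
  unfolding gen_cone_def by (intro CollectI exI[of _ "\<lambda>_. 0"]) simp

lemma gen_cone_insert:
  assumes "finite B" "c \<notin> B"
  shows "gen_cone (insert c B) = {x. \<exists>t\<ge>0. x - t *\<^sub>R c \<in> gen_cone B}"
proof (intro equalityI subsetI)
  fix x assume "x \<in> gen_cone (insert c B)"
  then obtain w where "\<forall>b\<in>insert c B. 0 \<le> w b" "x = (\<Sum>b\<in>insert c B. w b *\<^sub>R b)"
    by (auto simp: gen_cone_def)
  then show "x \<in> {x. \<exists>t\<ge>0. x - t *\<^sub>R c \<in> gen_cone B}"
    using assms by (auto simp: gen_cone_def intro!: exI[of _ "w c"] exI[of _ w])
next
  fix x assume "x \<in> {x. \<exists>t\<ge>0. x - t *\<^sub>R c \<in> gen_cone B}"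
  then obtain t w where "t \<ge> 0" "\<forall>b\<in>B. 0 \<le> w b" "x - t *\<^sub>R c = (\<Sum>b\<in>B. w b *\<^sub>R b)"
    by (auto simp: gen_cone_def)
  moreover have "(\<Sum>b\<in>B. (w(c := t)) b *\<^sub>R b) = (\<Sum>b\<in>B. w b *\<^sub>R b)"
    using assms by (intro sum.cong) auto
  ultimately show "x \<in> gen_cone (insert c B)"
    using assms unfolding gen_cone_def
    by (intro CollectI exI[of _ "w(c := t)"]) (auto simp: algebra_simps)
qed

lemma gen_cone_add: "x \<in> gen_cone B \<Longrightarrow> y \<in> gen_cone B \<Longrightarrow> x + y \<in> gen_cone B"
  unfolding gen_cone_def
proof clarify
  fix w w' :: "'a \<Rightarrow> real" assume "\<forall>b\<in>B. 0 \<le> w b" "\<forall>b\<in>B. 0 \<le> w' b"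
  then show "\<exists>w''. (\<forall>b\<in>B. 0 \<le> w'' b) \<and>
    (\<Sum>b\<in>B. w b *\<^sub>R b) + (\<Sum>b\<in>B. w' b *\<^sub>R b) = (\<Sum>b\<in>B. w'' b *\<^sub>R b)"
    by (intro exI[of _ "\<lambda>b. w b + w' b"]) (auto simp: scaleR_add_left sum.distrib)
qed

lemma gen_cone_scaleR: "r \<ge> 0 \<Longrightarrow> x \<in> gen_cone B \<Longrightarrow> r *\<^sub>R x \<in> gen_cone B"
  unfolding gen_cone_def
proof clarify
  fix w :: "'a \<Rightarrow> real" assume "\<forall>b\<in>B. 0 \<le> w b" "r \<ge> 0"
  then show "\<exists>w''. (\<forall>b\<in>B. 0 \<le> w'' b) \<and> r *\<^sub>R (\<Sum>b\<in>B. w b *\<^sub>R b) = (\<Sum>b\<in>B. w'' b *\<^sub>R b)"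
    by (intro exI[of _ "\<lambda>b. r * w b"]) (auto simp: scaleR_sum_right)
qed

lemma gen_cone_generator:
  assumes "finite B" "b \<in> B"
  shows "b \<in> gen_cone B"
  unfolding gen_cone_def
proof (intro CollectI exI[of _ "\<lambda>x. of_bool (x = b)"] conjI)
  have "(\<Sum>x\<in>B. of_bool (x = b) *\<^sub>R x) = (\<Sum>x\<in>B. if b = x then x else 0)"
    by (rule sum.cong) auto
  then show "b = (\<Sum>x\<in>B. of_bool (x = b) *\<^sub>R x)"
    using assms by simp
qed auto

lemma gen_cone_sum:
  assumes "\<And>i. i \<in> I \<Longrightarrow> 0 \<le> w i" "\<And>i. i \<in> I \<Longrightarrow> f i \<in> gen_cone B"
  shows "(\<Sum>i\<in>I. w i *\<^sub>R f i) \<in> gen_cone B"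
  using assms
  by (induction I rule: infinite_finite_induct) (auto simp: gen_cone_0 intro!: gen_cone_add gen_cone_scaleR)

lemma gen_cone_subset:
  assumes "0 \<in> K" "\<And>x y. x \<in> K \<Longrightarrow> y \<in> K \<Longrightarrow> x + y \<in> K"
    "\<And>r x. r \<ge> 0 \<Longrightarrow> x \<in> K \<Longrightarrow> r *\<^sub>R x \<in> K" "B \<subseteq> K"
  shows "gen_cone B \<subseteq> K"
proof
  fix x assume "x \<in> gen_cone B"
  then obtain w where w: "\<forall>b\<in>B. 0 \<le> w b" "x = (\<Sum>b\<in>B. w b *\<^sub>R b)"
    by (auto simp: gen_cone_def)
  have "(\<Sum>b\<in>B. w b *\<^sub>R b) \<in> K"
    using w(1) assms(4) by (induction B rule: infinite_finite_induct) (auto intro!: assms)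
  with w show "x \<in> K" by simp
qed

lemma gen_cone_mono: "finite B \<Longrightarrow> A \<subseteq> B \<Longrightarrow> gen_cone A \<subseteq> gen_cone B"
  by (rule gen_cone_subset) (auto intro: gen_cone_0 gen_cone_add gen_cone_scaleR gen_cone_generator)

lemma gen_cone_Un:
  assumes "finite A" "finite B"
  shows "gen_cone (A \<union> B) = gen_cone A + gen_cone B"
proof
  show "gen_cone (A \<union> B) \<subseteq> gen_cone A + gen_cone B"
  proof (rule gen_cone_subset)
    show "0 \<in> gen_cone A + gen_cone B"
      using set_plus_intro[OF gen_cone_0 gen_cone_0, of A B] by simp
    show "x + y \<in> gen_cone A + gen_cone B"
      if "x \<in> gen_cone A + gen_cone B" "y \<in> gen_cone A + gen_cone B" for x y
    proof -
      obtain a b a' b' where "a \<in> gen_cone A" "a' \<in> gen_cone A" "b \<in> gen_cone B" "b' \<in> gen_cone B"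
        "x = a + b" "y = a' + b'"
        using \<open>x \<in> _\<close> \<open>y \<in> _\<close> by (auto elim!: set_plus_elim)
      then show ?thesis
        using set_plus_intro[OF gen_cone_add[of a A a'] gen_cone_add[of b B b']]
        by (simp add: algebra_simps)
    qed
    show "r *\<^sub>R x \<in> gen_cone A + gen_cone B" if "r \<ge> 0" "x \<in> gen_cone A + gen_cone B" for r x
      using that by (auto elim!: set_plus_elim simp: scaleR_add_right intro!: gen_cone_scaleR)
    show "A \<union> B \<subseteq> gen_cone A + gen_cone B"
    proof
      fix x assume "x \<in> A \<union> B"
      then show "x \<in> gen_cone A + gen_cone B"
        using set_plus_intro[OF gen_cone_generator[of A x] gen_cone_0[of B]] assms
          set_plus_intro[OF gen_cone_0[of A] gen_cone_generator[of B x]]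
        by auto
    qed
  qed
  show "gen_cone A + gen_cone B \<subseteq> gen_cone (A \<union> B)"
    using gen_cone_mono[of "A \<union> B" A] gen_cone_mono[of "A \<union> B" B] assms
    by (auto elim!: set_plus_elim intro!: gen_cone_add)
qed

lemma inner_gen_cone_nonneg:
  assumes "\<And>b. b \<in> B \<Longrightarrow> 0 \<le> l \<bullet> b" "x \<in> gen_cone B"
  shows "0 \<le> l \<bullet> x"
  using assms gen_cone_subset[of "{x. 0 \<le> l \<bullet> x}" B] by (auto simp: inner_add_right)

text \<open>The scalar \<open>t\<close> of the new generator is eliminated from \<open>x - t c \<in> gen_cone B\<close>.\<close>

lemma rational_weyl:
  fixes B :: "'a::euclidean_space set"
  assumes "finite B" "\<And>b. b \<in> B \<Longrightarrow> rational_vector b"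
  shows "\<exists>A. finite A \<and> (\<forall>a\<in>A. rational_vector a) \<and> gen_cone B = {x. \<forall>a\<in>A. a \<bullet> x \<le> 0}"
  using assms
proof (induction B rule: finite_induct)
  case empty
  have "(\<forall>a\<in>Basis \<union> uminus ` Basis. a \<bullet> x \<le> 0) \<longleftrightarrow> x = 0" for x :: 'a
  proof
    assume "\<forall>a\<in>Basis \<union> uminus ` Basis. a \<bullet> x \<le> 0"
    then have "b \<bullet> x \<le> 0" "(- b) \<bullet> x \<le> 0" if "b \<in> Basis" for b
      using that by blast+
    then have "x \<bullet> b = 0" if "b \<in> Basis" for b
      using that by (simp add: inner_commute antisym)
    then show "x = 0" by (metis euclidean_all_zero_iff)
  qed simp
  then show ?case
    by (intro exI[of _ "Basis \<union> uminus ` Basis"])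
       (auto intro: rational_vector_Basis rational_vector_minus)
next
  case (insert c B)
  then obtain A where A: "finite A" "\<forall>a\<in>A. rational_vector a"
    "gen_cone B = {x. \<forall>a\<in>A. a \<bullet> x \<le> 0}"
    by auto
  \<comment> \<open>Fourier-Motzkin elimination: a normal with a \<bullet> c > 0 bounds t from
    below, one with a' \<bullet> c < 0 bounds it from above. The positive combination of such a pair
    that is orthogonal to c says that the lower bound does not exceed the upper one; the normals
    with a \<bullet> c \<le> 0 that are kept do the same for the lower bound 0.\<close>
  define pairs where "pairs = {(a, a') \<in> A \<times> A. a \<bullet> c > 0 \<and> a' \<bullet> c < 0}"
  define A' where "A' = {a \<in> A. a \<bullet> c \<le> 0} \<union> (\<lambda>(a, a'). (a \<bullet> c) *\<^sub>R a' - (a' \<bullet> c) *\<^sub>R a) ` pairs"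
  have fin: "finite pairs" unfolding pairs_def by (rule finite_subset[of _ "A \<times> A"]) (use A in auto)
  have "(\<exists>t\<ge>0. \<forall>a\<in>A. a \<bullet> (x - t *\<^sub>R c) \<le> 0) \<longleftrightarrow> (\<forall>a\<in>A'. a \<bullet> x \<le> 0)" for x
  proof
    assume "\<exists>t\<ge>0. \<forall>a\<in>A. a \<bullet> (x - t *\<^sub>R c) \<le> 0"
    then obtain t where t: "t \<ge> 0" "\<And>a. a \<in> A \<Longrightarrow> a \<bullet> x \<le> t * (a \<bullet> c)"
      by (auto simp: inner_diff_right)
    show "\<forall>a\<in>A'. a \<bullet> x \<le> 0"
    proof
      fix e assume "e \<in> A'"
      then consider "e \<in> A" "e \<bullet> c \<le> 0" | a a' where "a \<in> A" "a' \<in> A" "a \<bullet> c > 0" "a' \<bullet> c < 0"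
        "e = (a \<bullet> c) *\<^sub>R a' - (a' \<bullet> c) *\<^sub>R a"
        by (auto simp: A'_def pairs_def)
      then show "e \<bullet> x \<le> 0"
      proof cases
        case 1
        then have "t * (e \<bullet> c) \<le> 0" using t(1) by (simp add: mult_nonneg_nonpos)
        with t(2)[of e] 1 show ?thesis by linarith
      next
        case 2
        have "(a \<bullet> c) * (a' \<bullet> x) \<le> (a \<bullet> c) * (t * (a' \<bullet> c))"
          using 2 t by (intro mult_left_mono) auto
        moreover have "- (a' \<bullet> c) * (a \<bullet> x) \<le> - (a' \<bullet> c) * (t * (a \<bullet> c))"
          using 2 t by (intro mult_left_mono) auto
        ultimately show ?thesis unfolding 2(5) by (simp add: inner_diff_left algebra_simps)
      qed
    qed
  next
    assume r: "\<forall>a\<in>A'. a \<bullet> x \<le> 0"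
    \<comment> \<open>The elements of \<open>T\<close> are the lower bounds for t, so that
      \<open>Max T\<close> is the smallest admissible candidate.\<close>
    define T where "T = insert 0 ((\<lambda>a. (a \<bullet> x) / (a \<bullet> c)) ` {a \<in> A. a \<bullet> c > 0})"
    have T: "finite T" "T \<noteq> {}" using A by (auto simp: T_def)
    have "a \<bullet> x \<le> Max T * (a \<bullet> c)" if a: "a \<in> A" for a
    proof (cases "a \<bullet> c > 0")
      case True
      then have "(a \<bullet> x) / (a \<bullet> c) \<le> Max T"
        using T a by (intro Max_ge) (auto simp: T_def)
      with True show ?thesis by (simp add: pos_divide_le_eq)
    next
      case False
      have a0: "a \<bullet> x \<le> 0" using r a False by (auto simp: A'_def)
      have "Max T \<in> T" using T by (rule Max_in)
      then consider "Max T = 0" | a' where "a' \<in> A" "a' \<bullet> c > 0" "Max T = (a' \<bullet> x) / (a' \<bullet> c)"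
        by (auto simp: T_def)
      then show ?thesis
      proof cases
        case 1 with a0 show ?thesis by simp
      next
        case 2
        show ?thesis
        proof (cases "a \<bullet> c = 0")
          case True with a0 show ?thesis by simp
        next
          case ne: False
          have "((a' \<bullet> c) *\<^sub>R a - (a \<bullet> c) *\<^sub>R a') \<bullet> x \<le> 0"
            using r a 2 False ne by (force simp: A'_def pairs_def)
          then have "(a' \<bullet> c) * (a \<bullet> x) \<le> (a \<bullet> c) * (a' \<bullet> x)"
            by (simp add: inner_diff_left)
          moreover have "a' \<bullet> x = (a' \<bullet> c) * Max T"
            using 2 by simp
          ultimately have "(a' \<bullet> c) * (a \<bullet> x) \<le> (a' \<bullet> c) * (Max T * (a \<bullet> c))"
            by (simp only: mult_ac)
          with 2(2) show ?thesis by (rule mult_left_le_imp_le[rotated])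
        qed
      qed
    qed
    moreover have "Max T \<ge> 0" using T by (intro Max_ge) (auto simp: T_def)
    ultimately show "\<exists>t\<ge>0. \<forall>a\<in>A. a \<bullet> (x - t *\<^sub>R c) \<le> 0"
      by (intro exI[of _ "Max T"]) (auto simp: inner_diff_right)
  qed
  then have "gen_cone (insert c B) = {x. \<forall>a\<in>A'. a \<bullet> x \<le> 0}"
    using insert.hyps A(3) by (simp add: gen_cone_insert)
  moreover have "\<forall>a\<in>A'. rational_vector a"
    using A(2) insert.prems unfolding A'_def pairs_def
    by (auto intro!: rational_vector_diff rational_vector_scaleR rational_vector_inner)
  moreover have "finite A'"
    using A(1) fin by (simp add: A'_def)
  ultimately show ?case by blast
qed

text \<open>
  If \<open>B\<close> consists of the normals of the cone generated by \<open>A\<close>, then the cone with normals \<open>A\<close> is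
  generated by \<open>B\<close>: a point outside of \<open>gen_cone B\<close> violates one of the normals of \<open>gen_cone B\<close>, and
  these lie in \<open>gen_cone A\<close>.
\<close>

lemma rational_minkowski:
  fixes A :: "'a::euclidean_space set"
  assumes "finite A" "\<And>a. a \<in> A \<Longrightarrow> rational_vector a"
  shows "\<exists>B. finite B \<and> (\<forall>b\<in>B. rational_vector b) \<and> {x. \<forall>a\<in>A. a \<bullet> x \<le> 0} = gen_cone B"
proof -
  obtain B where B: "finite B" "\<forall>b\<in>B. rational_vector b" "gen_cone A = {x. \<forall>b\<in>B. b \<bullet> x \<le> 0}"
    using rational_weyl[OF assms] by blast
  obtain D where D: "finite D" "gen_cone B = {x. \<forall>d\<in>D. d \<bullet> x \<le> 0}"
    using rational_weyl[of B] B by blast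
  have "gen_cone B \<subseteq> {x. \<forall>a\<in>A. a \<bullet> x \<le> 0}"
  proof (rule gen_cone_subset)
    have "a \<bullet> b \<le> 0" if "a \<in> A" "b \<in> B" for a b
    proof -
      have "a \<in> {x. \<forall>b\<in>B. b \<bullet> x \<le> 0}"
        using gen_cone_generator[OF assms(1) that(1)] B(3) by blast
      with that(2) have "b \<bullet> a \<le> 0" by blast
      then show ?thesis by (subst inner_commute)
    qed
    then show "B \<subseteq> {x. \<forall>a\<in>A. a \<bullet> x \<le> 0}"
      by blast
  qed (auto simp: inner_add_right intro!: add_nonpos_nonpos mult_nonneg_nonpos)
  moreover have "x \<in> gen_cone B" if x: "\<forall>a\<in>A. a \<bullet> x \<le> 0" for x
  proof -
    have "d \<bullet> x \<le> 0" if "d \<in> D" for d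
    proof -
      have d: "d \<in> gen_cone A"
      proof -
        have "d \<bullet> b \<le> 0" if "b \<in> B" for b
          using gen_cone_generator[OF B(1) that] D(2) \<open>d \<in> D\<close> by blast
        then show ?thesis by (auto simp: B(3) inner_commute)
      qed
      have nonneg: "0 \<le> (- x) \<bullet> a" if "a \<in> A" for a
        using x that by (subst inner_commute) simp
      have "0 \<le> (- x) \<bullet> d"
        by (rule inner_gen_cone_nonneg[OF nonneg d])
      then show ?thesis by (subst inner_commute) simp
    qed
    then show ?thesis by (simp add: D(2))
  qed
  ultimately have "{x. \<forall>a\<in>A. a \<bullet> x \<le> 0} = gen_cone B" by blast
  with B show ?thesis by blast
qed

text \<open>Homogenisation: P is the slice at height 1 of a rational cone with one more dimension.
  Generators of positive height are rescaled to height 1 and give \<open>V\<close>, generators of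
  height 0 give \<open>C\<close>.\<close>

lemma rational_polyhedron_imp_generated:
  fixes P :: "(real ^ 'n) set"
  assumes "rational_polyhedron P" "P \<noteq> {}"
  shows "\<exists>V C. finite V \<and> finite C \<and> (\<forall>v\<in>V. rational_vector v) \<and> (\<forall>c\<in>C. rational_vector c) \<and>
           V \<noteq> {} \<and> P = convex hull V + gen_cone C"
proof -
  obtain F where F: "finite F" "P = \<Inter>F"
    "\<forall>H\<in>F. \<exists>a b. a \<noteq> 0 \<and> (\<forall>i. a $ i \<in> \<rat>) \<and> b \<in> \<rat> \<and> H = {x. a \<bullet> x \<le> b}"
    using assms unfolding rational_polyhedron_def by blast
  then obtain a b where ab: "\<And>H. H \<in> F \<Longrightarrow> rational_vector (a H)" "\<And>H. H \<in> F \<Longrightarrow> b H \<in> \<rat>"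
    "\<And>H. H \<in> F \<Longrightarrow> H = {x. a H \<bullet> x \<le> b H}"
    unfolding rational_vector_cart by metis
  have P: "x \<in> P \<longleftrightarrow> (\<forall>H\<in>F. a H \<bullet> x \<le> b H)" for x
    unfolding F(2) using ab(3) by blast
  \<comment> \<open>The inequality a \<bullet> x \<le> b becomes a \<bullet> x - b s \<le> 0, and
    the normal (0, -1) says s \<ge> 0.\<close>
  define A where "A = insert (0, -1) ((\<lambda>H. (a H, - b H)) ` F)"
  have "finite A" "\<And>e. e \<in> A \<Longrightarrow> rational_vector e"
    using F(1) ab by (auto simp: A_def rational_vector_Pair rational_vector_real)
  then obtain B where B: "finite B" "\<forall>b\<in>B. rational_vector b" "{x. \<forall>e\<in>A. e \<bullet> x \<le> 0} = gen_cone B"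
    using rational_minkowski[of A] by blast
  have cone: "(x, s) \<in> gen_cone B \<longleftrightarrow> s \<ge> 0 \<and> (\<forall>H\<in>F. a H \<bullet> x \<le> b H * s)" for x s
    unfolding B(3)[symmetric] by (auto simp: A_def)
  have Bcone: "snd y \<ge> 0 \<and> (\<forall>H\<in>F. a H \<bullet> fst y \<le> b H * snd y)" if "y \<in> B" for y
    using gen_cone_generator[OF B(1) that] cone[of "fst y" "snd y"] by simp
  define V where "V = (\<lambda>y. inverse (snd y) *\<^sub>R fst y) ` {y \<in> B. snd y > 0}"
  define C where "C = fst ` {y \<in> B. snd y = 0}"
  have fin: "finite V" "finite C" using B(1) by (auto simp: V_def C_def)
  have Brat: "rational_vector (fst y)" "snd y \<in> \<rat>" if "y \<in> B" for y
    using B(2) that rational_vector_Pair[of "fst y" "snd y"] by (auto simp: rational_vector_real)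
  have VP: "V \<subseteq> P"
  proof
    fix v assume "v \<in> V"
    then obtain y where y: "y \<in> B" "snd y > 0" "v = inverse (snd y) *\<^sub>R fst y"
      by (auto simp: V_def)
    have "a H \<bullet> v \<le> b H" if "H \<in> F" for H
      using Bcone[OF y(1)] that y(2) by (simp add: y(3) field_simps)
    then show "v \<in> P" by (simp add: P)
  qed
  have sub: "x \<in> convex hull V + gen_cone C" if "x \<in> P" for x
  proof -
    have "(x, 1) \<in> gen_cone B" using that by (simp add: cone P)
    then obtain w where w: "\<forall>y\<in>B. 0 \<le> w y" "(x, 1) = (\<Sum>y\<in>B. w y *\<^sub>R y)"
      by (auto simp: gen_cone_def)
    have split: "(\<Sum>y\<in>B. g y) = (\<Sum>y\<in>{y\<in>B. snd y > 0}. g y) + (\<Sum>y\<in>{y\<in>B. snd y = 0}. g y)"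
      for g :: "(real ^ 'n) \<times> real \<Rightarrow> 'z::comm_monoid_add"
    proof -
      have "B = {y\<in>B. snd y > 0} \<union> {y\<in>B. snd y = 0}" using Bcone by force
      then have "sum g B = sum g ({y\<in>B. snd y > 0} \<union> {y\<in>B. snd y = 0})" by simp
      also have "\<dots> = sum g {y\<in>B. snd y > 0} + sum g {y\<in>B. snd y = 0}"
        using B(1) by (intro sum.union_disjoint) auto
      finally show ?thesis .
    qed
    have "x = fst (\<Sum>y\<in>B. w y *\<^sub>R y)" using w(2) by (metis fst_conv)
    also have "\<dots> = (\<Sum>y\<in>B. w y *\<^sub>R fst y)" by (simp add: fst_sum)
    also have "\<dots> = (\<Sum>y\<in>{y\<in>B. snd y > 0}. w y *\<^sub>R fst y) + (\<Sum>y\<in>{y\<in>B. snd y = 0}. w y *\<^sub>R fst y)"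
      by (rule split)
    also have "(\<Sum>y\<in>{y\<in>B. snd y > 0}. w y *\<^sub>R fst y) =
        (\<Sum>y\<in>{y\<in>B. snd y > 0}. (w y * snd y) *\<^sub>R (inverse (snd y) *\<^sub>R fst y))"
      by (intro sum.cong) auto
    finally have x: "x = \<dots> + (\<Sum>y\<in>{y\<in>B. snd y = 0}. w y *\<^sub>R fst y)" .
    have "1 = snd (\<Sum>y\<in>B. w y *\<^sub>R y)" using w(2) by (metis snd_conv)
    also have "\<dots> = (\<Sum>y\<in>B. w y * snd y)" by (simp add: snd_sum)
    also have "\<dots> = (\<Sum>y\<in>{y\<in>B. snd y > 0}. w y * snd y)" by (subst split) simp
    finally have s1: "(\<Sum>y\<in>{y\<in>B. snd y > 0}. w y * snd y) = 1" ..
    have "(\<Sum>y\<in>{y\<in>B. snd y > 0}. (w y * snd y) *\<^sub>R (inverse (snd y) *\<^sub>R fst y)) \<in> convex hull V"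
    proof (rule convex_sum)
      show "finite {y \<in> B. 0 < snd y}" using B(1) by simp
      show "(inverse (snd y) *\<^sub>R fst y) \<in> convex hull V" if "y \<in> {y \<in> B. 0 < snd y}" for y
        using that by (intro hull_inc) (auto simp: V_def)
    qed (use s1 w(1) in auto)
    moreover have "(\<Sum>y\<in>{y\<in>B. snd y = 0}. w y *\<^sub>R fst y) \<in> gen_cone C"
      by (rule gen_cone_sum) (use w(1) fin in \<open>auto simp: C_def intro!: gen_cone_generator\<close>)
    ultimately show ?thesis unfolding x by (rule set_plus_intro)
  qed
  have conv: "convex P"
    unfolding F(2) using ab(3) by (intro convex_Inter) (metis convex_halfspace_le)
  have "convex hull V \<subseteq> P" using VP conv by (simp add: hull_minimal)
  moreover have "gen_cone C \<subseteq> {c. \<forall>H\<in>F. a H \<bullet> c \<le> 0}"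
    by (rule gen_cone_subset)
       (use Bcone in \<open>fastforce simp: C_def inner_add_right intro!: add_nonpos_nonpos mult_nonneg_nonpos\<close>)+
  ultimately have "convex hull V + gen_cone C \<subseteq> P"
    by (fastforce elim!: set_plus_elim simp: P inner_add_right)
  with sub have eq: "P = convex hull V + gen_cone C" by blast
  moreover have "V \<noteq> {}" using eq assms(2) by (auto elim!: set_plus_elim)
  moreover have "\<forall>v\<in>V. rational_vector v" "\<forall>c\<in>C. rational_vector c"
    using Brat by (auto simp: V_def C_def intro!: rational_vector_scaleR)
  ultimately show ?thesis using fin by blast
qed

text \<open>The way back from the cone over the polyhedron: it is generated by the pairs (v, 1) and
  (c, 0), and each of its normals (a, s) yields the inequality a \<bullet> x \<le> -s at height
  1.\<close>

lemma generated_imp_rational_polyhedron: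
  fixes V C :: "(real ^ 'n) set"
  assumes "finite V" "finite C" "\<And>v. v \<in> V \<Longrightarrow> rational_vector v" "\<And>c. c \<in> C \<Longrightarrow> rational_vector c"
    "V \<noteq> {}"
  shows "rational_polyhedron (convex hull V + gen_cone C)"
proof -
  define B where "B = (\<lambda>v. (v, 1::real)) ` V \<union> (\<lambda>c. (c, 0)) ` C"
  have B: "finite B" "\<And>b. b \<in> B \<Longrightarrow> rational_vector b"
    using assms by (auto simp: B_def rational_vector_Pair rational_vector_real)
  obtain A where A: "finite A" "\<forall>a\<in>A. rational_vector a" "gen_cone B = {x. \<forall>a\<in>A. a \<bullet> x \<le> 0}"
    using rational_weyl[OF B] by blast
  have mem: "x \<in> convex hull V + gen_cone C \<longleftrightarrow> (x, 1) \<in> gen_cone B" for x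
  proof
    assume "x \<in> convex hull V + gen_cone C"
    then obtain p c where pc: "p \<in> convex hull V" "c \<in> gen_cone C" "x = p + c"
      by (auto elim: set_plus_elim)
    have "convex hull V \<subseteq> {p. (p, 1) \<in> gen_cone B}"
    proof (rule hull_minimal)
      show "V \<subseteq> {p. (p, 1) \<in> gen_cone B}"
        using gen_cone_generator[OF B(1)] by (auto simp: B_def)
      show "convex {p. (p, 1) \<in> gen_cone B}"
      proof (rule convexI)
        fix x y u v assume *: "x \<in> {p. (p, 1) \<in> gen_cone B}" "y \<in> {p. (p, 1) \<in> gen_cone B}"
          "0 \<le> u" "0 \<le> v" "u + v = (1::real)"
        then have "u *\<^sub>R (x, 1) + v *\<^sub>R (y, 1) \<in> gen_cone B"
          by (intro gen_cone_add gen_cone_scaleR) auto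
        with * show "u *\<^sub>R x + v *\<^sub>R y \<in> {p. (p, 1) \<in> gen_cone B}" by simp
      qed
    qed
    moreover have "gen_cone C \<subseteq> {c. (c, 0) \<in> gen_cone B}"
    proof (rule gen_cone_subset)
      show "C \<subseteq> {c. (c, 0) \<in> gen_cone B}"
        using gen_cone_generator[OF B(1)] by (auto simp: B_def)
    qed (use gen_cone_add[of _ B] gen_cone_scaleR[of _ _ B] gen_cone_0[of B] in
          \<open>force simp: zero_prod_def\<close>)+
    ultimately have "(p, 1) + (c, 0) \<in> gen_cone B"
      using pc by (intro gen_cone_add) auto
    then show "(x, 1) \<in> gen_cone B" using pc by simp
  next
    assume "(x, 1) \<in> gen_cone B"
    then obtain w where w: "\<forall>b\<in>B. 0 \<le> w b" "(x, 1) = (\<Sum>b\<in>B. w b *\<^sub>R b)"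
      by (auto simp: gen_cone_def)
    have "(\<Sum>b\<in>B. w b *\<^sub>R b) = (\<Sum>b\<in>(\<lambda>v. (v, 1::real)) ` V. w b *\<^sub>R b) + (\<Sum>b\<in>(\<lambda>c. (c, 0)) ` C. w b *\<^sub>R b)"
      unfolding B_def using assms by (intro sum.union_disjoint) auto
    also have "(\<Sum>b\<in>(\<lambda>v. (v, 1::real)) ` V. w b *\<^sub>R b) = (\<Sum>v\<in>V. w (v, 1) *\<^sub>R (v, 1))"
      by (subst sum.reindex) (auto simp: inj_on_def)
    also have "(\<Sum>b\<in>(\<lambda>c. (c, 0::real)) ` C. w b *\<^sub>R b) = (\<Sum>c\<in>C. w (c, 0) *\<^sub>R (c, 0))"
      by (subst sum.reindex) (auto simp: inj_on_def)
    finally have sB: "(\<Sum>b\<in>B. w b *\<^sub>R b) = (\<Sum>v\<in>V. w (v, 1) *\<^sub>R (v, 1)) + (\<Sum>c\<in>C. w (c, 0) *\<^sub>R (c, 0))" .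
    have *: "(x, 1::real) = (\<Sum>v\<in>V. w (v, 1) *\<^sub>R (v, 1)) + (\<Sum>c\<in>C. w (c, 0) *\<^sub>R (c, 0))"
      by (rule trans[OF w(2) sB])
    have x: "x = (\<Sum>v\<in>V. w (v, 1) *\<^sub>R v) + (\<Sum>c\<in>C. w (c, 0) *\<^sub>R c)"
      using arg_cong[OF *, of fst] by (simp add: fst_sum)
    have s1: "(\<Sum>v\<in>V. w (v, 1)) = 1"
      using arg_cong[OF *, of snd] by (simp add: snd_sum)
    have "(\<Sum>v\<in>V. w (v, 1) *\<^sub>R v) \<in> convex hull V"
      using assms(1) w(1) s1 by (intro convex_sum) (auto simp: B_def intro: hull_inc)
    moreover have "(\<Sum>c\<in>C. w (c, 0) *\<^sub>R c) \<in> gen_cone C"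
      using assms(2) w(1) by (intro gen_cone_sum) (auto simp: B_def intro: gen_cone_generator)
    ultimately show "x \<in> convex hull V + gen_cone C"
      unfolding x by (rule set_plus_intro)
  qed
  obtain v0 where v0: "v0 \<in> V" using assms(5) by blast
  have "v0 + 0 \<in> convex hull V + gen_cone C"
    using v0 by (intro set_plus_intro gen_cone_0) (auto intro: hull_inc)
  then have v0cone: "a \<bullet> (v0, 1) \<le> 0" if "a \<in> A" for a
    using that A(3) mem by auto
  define F where "F = (\<lambda>a. {x. fst a \<bullet> x \<le> - snd a}) ` {a \<in> A. fst a \<noteq> 0}"
  show ?thesis unfolding rational_polyhedron_def
  proof (intro exI[of _ F] conjI)
    show "finite F" using A(1) by (simp add: F_def)
    show "convex hull V + gen_cone C = \<Inter> F"
    proof (rule Set.set_eqI)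
      fix x
      have "x \<in> convex hull V + gen_cone C \<longleftrightarrow> (\<forall>a\<in>A. fst a \<bullet> x + snd a \<le> 0)"
        unfolding mem A(3) by (auto simp: inner_prod_def)
      also have "\<dots> \<longleftrightarrow> (\<forall>a\<in>{a \<in> A. fst a \<noteq> 0}. fst a \<bullet> x + snd a \<le> 0)"
        using v0cone by (force simp: inner_prod_def)
      also have "\<dots> \<longleftrightarrow> x \<in> \<Inter> F" by (force simp: F_def)
      finally show "x \<in> convex hull V + gen_cone C \<longleftrightarrow> x \<in> \<Inter> F" .
    qed
    show "\<forall>H\<in>F. \<exists>a b. a \<noteq> 0 \<and> (\<forall>i. a $ i \<in> \<rat>) \<and> b \<in> \<rat> \<and> H = {x. a \<bullet> x \<le> b}"
    proof
      fix H assume "H \<in> F"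
      then obtain a where a: "a \<in> A" "fst a \<noteq> 0" "H = {x. fst a \<bullet> x \<le> - snd a}"
        by (auto simp: F_def)
      have "rational_vector (fst a)" "snd a \<in> \<rat>"
        using A(2) a(1) rational_vector_Pair[of "fst a" "snd a"] by (auto simp: rational_vector_real)
      with a show "\<exists>a b. a \<noteq> 0 \<and> (\<forall>i. a $ i \<in> \<rat>) \<and> b \<in> \<rat> \<and> H = {x. a \<bullet> x \<le> b}"
        by (intro exI[of _ "fst a"] exI[of _ "- snd a"]) (auto simp: rational_vector_cart)
    qed
  qed
qed

lemma rational_polyhedron_closed: "rational_polyhedron P \<Longrightarrow> closed P"
  unfolding rational_polyhedron_def by (auto intro!: closed_Inter simp: closed_halfspace_le)

lemma rational_polyhedron_convex: "rational_polyhedron P \<Longrightarrow> convex P"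
  unfolding rational_polyhedron_def by (fastforce intro!: convex_Inter simp: convex_halfspace_le)

lemma rational_polyhedron_polyhedron:
  assumes "rational_polyhedron P"
  shows "polyhedron P"
proof -
  obtain F where F: "finite F" "P = \<Inter> F"
    "\<forall>H\<in>F. \<exists>a b. a \<noteq> 0 \<and> (\<forall>i. a $ i \<in> \<rat>) \<and> b \<in> \<rat> \<and> H = {x. a \<bullet> x \<le> b}"
    using assms unfolding rational_polyhedron_def by blast
  have "\<exists>a b. a \<noteq> 0 \<and> H = {x. a \<bullet> x \<le> b}" if "H \<in> F" for H
    using F(3) that by blast
  with F(1,2) show ?thesis unfolding polyhedron_def by blast
qed

text \<open>The closure is essential: a recession direction of one polyhedron is reached from a
  point of the other only as a limit of ever longer segments.\<close>

lemma closure_convex_hull_Un_generated: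
  assumes "finite V" "finite C" "\<And>v. v \<in> V \<Longrightarrow> rational_vector v" "\<And>c. c \<in> C \<Longrightarrow> rational_vector c"
    "V \<noteq> {}" "finite V'" "finite C'" "\<And>v. v \<in> V' \<Longrightarrow> rational_vector v"
    "\<And>c. c \<in> C' \<Longrightarrow> rational_vector c" "V' \<noteq> {}"
  shows "closure (convex hull ((convex hull V + gen_cone C) \<union> (convex hull V' + gen_cone C'))) =
     convex hull (V \<union> V') + gen_cone (C \<union> C' :: (real ^ 'n) set)" (is "?L = ?R")
proof
  let ?U = "(convex hull V + gen_cone C) \<union> (convex hull V' + gen_cone C')"
  have rat: "rational_polyhedron ?R"
    using assms by (intro generated_imp_rational_polyhedron) auto
  have "?U \<subseteq> ?R"
    using hull_mono[of V "V \<union> V'" convex] hull_mono[of V' "V \<union> V'" convex]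
      gen_cone_mono[of "C \<union> C'" C] gen_cone_mono[of "C \<union> C'" C'] assms
    by (intro Un_least set_plus_mono2) auto
  then show "?L \<subseteq> ?R"
    using rational_polyhedron_closed[OF rat] rational_polyhedron_convex[OF rat]
    by (intro closure_minimal hull_minimal) auto
  have conv: "convex ?L" by (simp add: convex_closure)
  have U: "?U \<subseteq> ?L" using closure_subset hull_subset by fast
  have V: "V \<union> V' \<subseteq> ?L"
    using set_plus_intro[OF hull_inc gen_cone_0[of C], of _ V convex]
       set_plus_intro[OF hull_inc gen_cone_0[of C'], of _ V' convex] U by auto
  have "\<exists>p\<in>?L. \<forall>r\<ge>0. p + r *\<^sub>R c \<in> ?L" if "c \<in> C \<union> C'" for c
  proof -
    have "\<exists>v. \<forall>r\<ge>0. v + r *\<^sub>R c \<in> ?U"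
    proof (cases "c \<in> C")
      case True
      obtain v where "v \<in> V" using assms(5) by blast
      then have "v + r *\<^sub>R c \<in> convex hull V + gen_cone C" if "r \<ge> 0" for r
        using True assms(2) that by (intro set_plus_intro hull_inc gen_cone_scaleR gen_cone_generator)
      then show ?thesis by blast
    next
      case False
      obtain v where "v \<in> V'" using assms(10) by blast
      then have "v + r *\<^sub>R c \<in> convex hull V' + gen_cone C'" if "r \<ge> 0" for r
        using False \<open>c \<in> C \<union> C'\<close> assms(7) that
        by (intro set_plus_intro hull_inc gen_cone_scaleR gen_cone_generator) auto
      then show ?thesis by blast
    qed
    then obtain v where v: "\<forall>r\<ge>0. v + r *\<^sub>R c \<in> ?U" by blast
    then have "v + 0 *\<^sub>R c \<in> ?U" by blast
    then have "v \<in> ?L" using U by auto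
    with v U show ?thesis by blast
  qed
  then have rec1: "x + r *\<^sub>R c \<in> ?L" if "c \<in> C \<union> C'" "x \<in> ?L" "r \<ge> 0" for c x r
  proof -
    obtain p where p: "p \<in> ?L" "\<And>r. r \<ge> 0 \<Longrightarrow> p + r *\<^sub>R c \<in> ?L"
      using \<open>c \<in> C \<union> C' \<Longrightarrow> _\<close> \<open>c \<in> C \<union> C'\<close> by blast
    \<comment> \<open>Points on the segments from x to p + (n + 1) r c; they tend to x + r c
      although the far end escapes.\<close>
    define f where "f n = (1 - inverse (real (Suc n))) *\<^sub>R x + inverse (real (Suc n)) *\<^sub>R (p + (real (Suc n) * r) *\<^sub>R c)" for n
    have f: "f n = x + inverse (real (Suc n)) *\<^sub>R (p - x) + r *\<^sub>R c" for n
    proof -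
      have "inverse (real (Suc n)) * (real (Suc n) * r) = r" by simp
      then show ?thesis
        unfolding f_def scaleR_add_right scaleR_scaleR by (simp only:) (simp add: algebra_simps)
    qed
    have "f n \<in> ?L" for n
      unfolding f_def using conv that p
      by (intro convexD) (auto simp: divide_simps)
    moreover have "f \<longlonglongrightarrow> x + 0 *\<^sub>R (p - x) + r *\<^sub>R c"
      unfolding f by (intro tendsto_intros LIMSEQ_inverse_real_of_nat)
    ultimately show ?thesis
      using closed_sequentially[of ?L f "x + r *\<^sub>R c"] by auto
  qed
  have rec: "gen_cone (C \<union> C') \<subseteq> {y. \<forall>x\<in>?L. \<forall>r\<ge>0. x + r *\<^sub>R y \<in> ?L}"
  proof (rule gen_cone_subset)
    fix y z assume "y \<in> {y. \<forall>x\<in>?L. \<forall>r\<ge>0. x + r *\<^sub>R y \<in> ?L}" "z \<in> {y. \<forall>x\<in>?L. \<forall>r\<ge>0. x + r *\<^sub>R y \<in> ?L}"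
    then have "x + r *\<^sub>R y + r *\<^sub>R z \<in> ?L" if "x \<in> ?L" "r \<ge> 0" for x r
      using that by blast
    then show "y + z \<in> {y. \<forall>x\<in>?L. \<forall>r\<ge>0. x + r *\<^sub>R y \<in> ?L}"
      by (simp add: scaleR_add_right add.assoc)
  qed (use rec1 in auto)
  have "convex hull (V \<union> V') \<subseteq> ?L" using V conv by (simp add: hull_minimal)
  moreover have "x + 1 *\<^sub>R y \<in> ?L" if "x \<in> ?L" "y \<in> gen_cone (C \<union> C')" for x y
  proof -
    have "y \<in> {y. \<forall>x\<in>?L. \<forall>r\<ge>0. x + r *\<^sub>R y \<in> ?L}" using rec that(2) by (rule subsetD)
    with that(1) show ?thesis using zero_le_one by blast
  qed
  ultimately show "?R \<subseteq> ?L" by (auto elim!: set_plus_elim)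
qed

section \<open>Minima of linear forms on polyhedra\<close>

text \<open>The support function with minima in place of maxima. The value
  \<open>\<infinity>\<close> characterises the zero of the semiring, the value
  \<open>-\<infinity>\<close> means that l lies outside of the support.\<close>

definition min_value :: "'a::euclidean_space set \<Rightarrow> 'a \<Rightarrow> ereal" where
  "min_value P l = (INF x\<in>P. ereal (l \<bullet> x))"

lemma le_min_value_iff: "c \<le> min_value P l \<longleftrightarrow> (\<forall>x\<in>P. c \<le> ereal (l \<bullet> x))"
  by (simp add: min_value_def le_INF_iff)

lemma min_value_le: "x \<in> P \<Longrightarrow> min_value P l \<le> ereal (l \<bullet> x)"
  unfolding min_value_def by (rule INF_lower)

lemma min_value_eqI: "x \<in> P \<Longrightarrow> (\<And>y. y \<in> P \<Longrightarrow> l \<bullet> x \<le> l \<bullet> y) \<Longrightarrow> min_value P l = ereal (l \<bullet> x)"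
  by (intro antisym min_value_le) (auto simp: le_min_value_iff)

lemma min_value_empty [simp]: "min_value {} l = \<infinity>"
  by (simp add: min_value_def top_ereal_def)

lemma min_value_singleton [simp]: "min_value {x} l = ereal (l \<bullet> x)"
  by (simp add: min_value_def)

lemma min_value_eq_PInf_iff: "min_value P l = \<infinity> \<longleftrightarrow> P = {}"
  using min_value_le[of _ P l] by fastforce

text \<open>For an empty summand this relies on the convention that the sum of
  \<open>\<infinity>\<close> and \<open>-\<infinity>\<close> is \<open>\<infinity>\<close>, which
  mirrors the absorbing zero of the semiring.\<close>

lemma min_value_plus: "min_value (P + Q) l = min_value P l + min_value Q l"
proof (cases "P = {} \<or> Q = {}")
  case True
  then have "P + Q = {}" by (auto simp: set_plus_def)
  with True show ?thesis by auto
next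
  case False
  show ?thesis
  proof (rule antisym)
    show "min_value P l + min_value Q l \<le> min_value (P + Q) l"
      unfolding le_min_value_iff
      by (auto elim!: set_plus_elim simp: inner_add_right simp flip: plus_ereal.simps
            intro!: add_mono min_value_le)
    let ?m = "min_value (P + Q) l"
    have *: "?m \<le> min_value Q l + ereal (l \<bullet> x)" if "x \<in> P" for x
    proof -
      have "?m \<le> ereal (l \<bullet> y) + ereal (l \<bullet> x)" if "y \<in> Q" for y
        using min_value_le[OF set_plus_intro[OF \<open>x \<in> P\<close> that], of l] by (simp add: inner_add_right add.commute)
      then have "?m - ereal (l \<bullet> x) \<le> min_value Q l"
        unfolding le_min_value_iff by (simp add: ereal_minus_le)
      then show ?thesis by (simp add: ereal_minus_le)
    qed
    show "?m \<le> min_value P l + min_value Q l"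
    proof (cases "min_value Q l")
      case (real r)
      then have "?m - ereal r \<le> min_value P l"
        unfolding le_min_value_iff using * by (simp add: ereal_minus_le add.commute del: plus_ereal.simps)
      then show ?thesis using real by (simp add: ereal_minus_le)
    next
      case PInf
      with False show ?thesis by (simp add: min_value_eq_PInf_iff)
    next
      case MInf
      obtain x where "x \<in> P" using False by blast
      then have "?m = -\<infinity>" using * MInf by fastforce
      then show ?thesis by simp
    qed
  qed
qed

lemma min_value_closure_convex_hull: "min_value (closure (convex hull P)) l = min_value P l"
proof (rule antisym)
  show "min_value (closure (convex hull P)) l \<le> min_value P l"
    unfolding min_value_def by (intro INF_superset_mono) (use closure_subset hull_subset in fast)+
  define c where "c = min_value P l"
  have "closure (convex hull P) \<subseteq> {x. c \<le> ereal (l \<bullet> x)}"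
  proof (intro closure_minimal hull_minimal)
    show "P \<subseteq> {x. c \<le> ereal (l \<bullet> x)}" by (auto simp: c_def min_value_le)
    show "convex {x. c \<le> ereal (l \<bullet> x)}" "closed {x. c \<le> ereal (l \<bullet> x)}"
      by (cases c; simp add: convex_halfspace_ge closed_halfspace_ge)+
  qed
  then show "min_value P l \<le> min_value (closure (convex hull P)) l"
    by (auto simp: le_min_value_iff c_def)
qed

lemma min_value_Un: "min_value (P \<union> Q) l = min (min_value P l) (min_value Q l)"
  by (simp add: min_value_def INF_union inf_min)

text \<open>A point of Q outside of P would be separated from P by a hyperplane. All inclusions
  between polyhedra below are reduced to values of forms in this way.\<close>

lemma subset_if_min_value_le:
  assumes "closed P" "convex P" "\<And>l. min_value P l \<le> min_value Q l"
  shows "Q \<subseteq> P"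
proof (rule ccontr)
  assume "\<not> Q \<subseteq> P"
  then obtain z where z: "z \<in> Q" "z \<notin> P" by blast
  then obtain a b where ab: "a \<bullet> z < b" "\<forall>x\<in>P. b < a \<bullet> x"
    using separating_hyperplane_closed_point assms by metis
  have "ereal b \<le> min_value P a" using ab(2) by (auto simp: le_min_value_iff less_imp_le)
  also have "\<dots> \<le> min_value Q a" by (rule assms(3))
  also have "\<dots> \<le> ereal (a \<bullet> z)" using z by (intro min_value_le)
  finally show False using ab(1) by simp
qed

lemma min_value_inject:
  assumes "closed P" "convex P" "closed Q" "convex Q" "\<And>l. min_value P l = min_value Q l"
  shows "P = Q"
  using subset_if_min_value_le[of P Q] subset_if_min_value_le[of Q P] assms by (simp add: subset_antisym)

lemma min_value_generated_MInf:
  assumes "finite C" "v \<in> V" "c \<in> C" "l \<bullet> c < 0"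
  shows "min_value (convex hull V + gen_cone C) l = -\<infinity>"
proof -
  let ?P = "convex hull V + gen_cone C"
  have le: "min_value ?P l \<le> ereal (l \<bullet> v + r * (l \<bullet> c))" if "r \<ge> 0" for r
  proof -
    have "v + r *\<^sub>R c \<in> ?P"
      by (intro set_plus_intro hull_inc gen_cone_scaleR gen_cone_generator assms that)
    from min_value_le[OF this, of l] show ?thesis by (simp add: inner_add_right)
  qed
  have "min_value ?P l \<le> ereal b" for b
  proof -
    have "0 \<le> \<bar>(b - l \<bullet> v) / (l \<bullet> c)\<bar>" by simp
    moreover have "l \<bullet> v + \<bar>(b - l \<bullet> v) / (l \<bullet> c)\<bar> * (l \<bullet> c) \<le> b"
      using assms(4) by (auto simp: abs_if field_simps)
    ultimately show ?thesis using le by (meson ereal_less_eq(3) order_trans)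
  qed
  then show ?thesis by (simp add: ereal_bot)
qed

lemma le_min_value_generated:
  assumes "\<And>v. v \<in> V \<Longrightarrow> m \<le> l \<bullet> v" "\<And>c. c \<in> C \<Longrightarrow> 0 \<le> l \<bullet> c"
  shows "ereal m \<le> min_value (convex hull V + gen_cone C) l"
  unfolding le_min_value_iff
proof
  fix x assume "x \<in> convex hull V + gen_cone C"
  then obtain p c where pc: "p \<in> convex hull V" "c \<in> gen_cone C" "x = p + c"
    by (auto elim: set_plus_elim)
  have "convex hull V \<subseteq> {x. l \<bullet> x \<ge> m}"
    by (rule hull_minimal) (use assms(1) in \<open>auto simp: convex_halfspace_ge\<close>)
  moreover have "0 \<le> l \<bullet> c" using assms(2) pc(2) by (rule inner_gen_cone_nonneg)
  ultimately show "ereal m \<le> ereal (l \<bullet> x)" using pc by (auto simp: inner_add_right)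
qed

text \<open>The point v together with the open half-space where g exceeds g \<bullet> v is a convex
  set, so strictness passes from the generators to everything they generate.\<close>

lemma strict_min_generated:
  fixes V C :: "'a::euclidean_space set"
  assumes "\<And>u. u \<in> V \<Longrightarrow> u \<noteq> v \<Longrightarrow> g \<bullet> v < g \<bullet> u" "\<And>c. c \<in> C \<Longrightarrow> c \<noteq> 0 \<Longrightarrow> 0 < g \<bullet> c"
    and x: "x \<in> convex hull V + gen_cone C" "x \<noteq> v"
  shows "g \<bullet> v < g \<bullet> x"
proof -
  have le: "g \<bullet> v \<le> g \<bullet> p" if "p = v \<or> g \<bullet> v < g \<bullet> p" for p using that by auto
  have "convex hull V \<subseteq> {p. p = v \<or> g \<bullet> v < g \<bullet> p}"
  proof (rule hull_minimal)
    show "V \<subseteq> {p. p = v \<or> g \<bullet> v < g \<bullet> p}" using assms(1) by blast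
    show "convex {p. p = v \<or> g \<bullet> v < g \<bullet> p}"
    proof (rule convexI)
      fix p q :: 'a and s t :: real
      assume p: "p \<in> {p. p = v \<or> g \<bullet> v < g \<bullet> p}" and q: "q \<in> {p. p = v \<or> g \<bullet> v < g \<bullet> p}"
        and st: "0 \<le> s" "0 \<le> t" "s + t = 1"
      have v: "v = s *\<^sub>R v + t *\<^sub>R v" using st by (simp flip: scaleR_left_distrib)
      have gv: "g \<bullet> v = s * (g \<bullet> v) + t * (g \<bullet> v)" using st by (simp flip: distrib_right)
      consider "s = 0" | "t = 0" | "p = v" "q = v" | "s > 0" "t > 0" "p \<noteq> v" | "s > 0" "t > 0" "q \<noteq> v"
        using st by fastforce
      then show "s *\<^sub>R p + t *\<^sub>R q \<in> {p. p = v \<or> g \<bullet> v < g \<bullet> p}"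
      proof cases
        case 1 then show ?thesis using q st by auto
      next
        case 2 then show ?thesis using p st by auto
      next
        case 3 then show ?thesis using v by auto
      next
        case 4
        then have "s * (g \<bullet> v) < s * (g \<bullet> p)" using p by auto
        moreover have "t * (g \<bullet> v) \<le> t * (g \<bullet> q)" using q le 4 by (intro mult_left_mono) auto
        ultimately show ?thesis using gv by (simp add: inner_add_right)
      next
        case 5
        then have "t * (g \<bullet> v) < t * (g \<bullet> q)" using q by auto
        moreover have "s * (g \<bullet> v) \<le> s * (g \<bullet> p)" using p le 5 by (intro mult_left_mono) auto
        ultimately show ?thesis using gv by (simp add: inner_add_right)
      qed
    qed
  qed
  moreover have "gen_cone C \<subseteq> {c. c = 0 \<or> 0 < g \<bullet> c}"
  proof (rule gen_cone_subset)
    show "r *\<^sub>R c \<in> {c. c = 0 \<or> 0 < g \<bullet> c}" if "0 \<le> r" "c \<in> {c. c = 0 \<or> 0 < g \<bullet> c}" for r c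
      using that by (cases "r = 0") auto
  qed (use assms(2) in \<open>auto simp: inner_add_right\<close>)
  ultimately show ?thesis
    using x by (fastforce elim!: set_plus_elim simp: inner_add_right)
qed

lemma strict_min_extreme_point:
  assumes "v \<in> S" "\<And>x. x \<in> S \<Longrightarrow> x \<noteq> v \<Longrightarrow> g \<bullet> v < g \<bullet> x"
  shows "v extreme_point_of S"
  unfolding extreme_point_of_def
proof (intro conjI ballI notI)
  fix a b assume ab: "a \<in> S" "b \<in> S" "v \<in> open_segment a b"
  then obtain u where u: "a \<noteq> b" "0 < u" "u < 1" "v = (1 - u) *\<^sub>R a + u *\<^sub>R b"
    by (auto simp: in_segment)
  have ne: "v \<noteq> a" "v \<noteq> b" using ab(3) by (auto simp: open_segment_def)
  have "(1 - u) * (g \<bullet> v) < (1 - u) * (g \<bullet> a)" "u * (g \<bullet> v) < u * (g \<bullet> b)"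
    using assms(2)[of a] assms(2)[of b] ab ne u by auto
  then have "(1 - u) * (g \<bullet> v) + u * (g \<bullet> v) < g \<bullet> v"
    by (subst (3) u(4)) (simp add: inner_add_right)
  then show False by (simp add: algebra_simps)
qed (rule assms(1))

lemma extreme_point_of_subset:
  "v extreme_point_of S \<Longrightarrow> T \<subseteq> S \<Longrightarrow> v \<in> T \<Longrightarrow> v extreme_point_of T"
  by (auto simp: extreme_point_of_def)

text \<open>The difference x - y has rational coordinates, so equal values would be a rational
  relation. This turns minima of \<omega> on finite sets of rational points into strict
  minima.\<close>

lemma rationally_independent_inj:
  fixes \<omega> :: "real ^ 'n"
  assumes "rationally_independent \<omega>" "rational_vector x" "rational_vector y" "\<omega> \<bullet> x = \<omega> \<bullet> y"
  shows "x = y"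
proof -
  have "\<forall>i. \<exists>q. (x - y) $ i = of_rat q"
    using rational_vector_diff[OF assms(2,3)] unfolding rational_vector_cart by (metis Rats_cases)
  then obtain q where q: "\<And>i. (x - y) $ i = of_rat (q i)" by metis
  have "(\<Sum>i\<in>UNIV. of_rat (q i) * \<omega> $ i) = \<omega> \<bullet> (x - y)"
    by (simp only: inner_vec_def q[symmetric]) (simp add: mult.commute)
  also have "\<dots> = 0" using assms(4) by (simp add: inner_diff_right)
  finally have "q i = 0" for i
    using assms(1) unfolding rationally_independent_def by blast
  then have "x - y = 0" using q by (simp add: Finite_Cartesian_Product.vec_eq_iff)
  then show ?thesis by simp
qed

section \<open>Generators and vertices of positive polyhedra\<close>

locale polyhedra =
  fixes \<omega> :: "real ^ 'n"
  assumes independent: "rationally_independent \<omega>"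
begin

abbreviation "A \<equiv> polyhedra_semiring \<omega>"

lemma A_simps [simp]:
  "zero A = {}" "one A = {0}" "add A P Q = closure (convex hull (P \<union> Q))" "mult A P Q = P + Q"
  by (simp_all add: polyhedra_semiring_def)

lemma carrier_A: "carrier A = insert {} {P. rational_polyhedron P \<and> P \<noteq> {} \<and> positive_for \<omega> P}"
  by (simp add: polyhedra_semiring_def)

lemma carrier_closed: "P \<in> carrier A \<Longrightarrow> closed P"
  by (auto simp: carrier_A rational_polyhedron_closed)

lemma carrier_convex: "P \<in> carrier A \<Longrightarrow> convex P"
  by (auto simp: carrier_A rational_polyhedron_convex)

lemma carrier_eqI:
  "P \<in> carrier A \<Longrightarrow> Q \<in> carrier A \<Longrightarrow> (\<And>l. min_value P l = min_value Q l) \<Longrightarrow> P = Q"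
  by (rule min_value_inject) (auto simp: carrier_closed carrier_convex)

lemma generated_carrier:
  assumes "finite V" "finite C" "\<And>v. v \<in> V \<Longrightarrow> rational_vector v" "\<And>c. c \<in> C \<Longrightarrow> rational_vector c"
    "V \<noteq> {}" "\<And>c. c \<in> C \<Longrightarrow> 0 \<le> \<omega> \<bullet> c"
  shows "convex hull V + gen_cone C \<in> carrier A - {{}}"
proof -
  let ?P = "convex hull V + gen_cone C"
  have rat: "rational_polyhedron ?P"
    by (rule generated_imp_rational_polyhedron) (use assms in auto)
  define m where "m = Min ((\<lambda>v. \<omega> \<bullet> v) ` V)"
  have "m \<in> (\<lambda>v. \<omega> \<bullet> v) ` V" unfolding m_def using assms by (intro Min_in) auto
  then obtain v where v: "v \<in> V" "m = \<omega> \<bullet> v" by blast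
  have "v + 0 \<in> ?P" by (intro set_plus_intro hull_inc v gen_cone_0)
  moreover have "\<omega> \<bullet> v \<le> \<omega> \<bullet> x" if "x \<in> ?P" for x
  proof -
    obtain p c where pc: "p \<in> convex hull V" "c \<in> gen_cone C" "x = p + c"
      using \<open>x \<in> ?P\<close> by (auto elim: set_plus_elim)
    have "convex hull V \<subseteq> {x. \<omega> \<bullet> x \<ge> m}"
      by (rule hull_minimal) (use assms in \<open>auto simp: m_def convex_halfspace_ge\<close>)
    moreover have "0 \<le> \<omega> \<bullet> c" using assms(6) pc(2) by (rule inner_gen_cone_nonneg)
    ultimately show ?thesis using pc v by (auto simp: inner_add_right)
  qed
  ultimately show ?thesis using rat by (force simp: carrier_A positive_for_def)
qed

text \<open>Adding a recession direction to a minimiser of \<omega> cannot lower the value, so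
  \<omega> is nonnegative on \<open>C\<close>. It is strictly positive on the nonzero elements
  because they are rational, and the zero vector is discarded.\<close>

lemma carrier_generated:
  assumes "P \<in> carrier A" "P \<noteq> {}"
  obtains V C where "finite V" "finite C" "\<And>v. v \<in> V \<Longrightarrow> rational_vector v"
    "\<And>c. c \<in> C \<Longrightarrow> rational_vector c" "V \<noteq> {}" "\<And>c. c \<in> C \<Longrightarrow> c \<noteq> 0 \<and> 0 < \<omega> \<bullet> c"
    "P = convex hull V + gen_cone C"
proof -
  have "rational_polyhedron P" "positive_for \<omega> P" using assms by (auto simp: carrier_A)
  obtain V C where VC: "finite V" "finite C" "\<forall>v\<in>V. rational_vector v" "\<forall>c\<in>C. rational_vector c"
    "V \<noteq> {}" "P = convex hull V + gen_cone C"
    using rational_polyhedron_imp_generated[OF \<open>rational_polyhedron P\<close> assms(2)] by blast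
  obtain x where x: "x \<in> P" "\<And>y. y \<in> P \<Longrightarrow> \<omega> \<bullet> x \<le> \<omega> \<bullet> y"
    using \<open>positive_for \<omega> P\<close> by (auto simp: positive_for_def)
  then obtain p c where pc: "p \<in> convex hull V" "c \<in> gen_cone C" "x = p + c"
    using VC(6) by (auto elim: set_plus_elim)
  have nonneg: "0 \<le> \<omega> \<bullet> e" if "e \<in> C" for e
  proof -
    have "p + (c + e) \<in> P" unfolding VC(6)
      by (intro set_plus_intro pc gen_cone_add gen_cone_generator VC that)
    from x(2)[OF this] show ?thesis using pc by (simp add: inner_add_right)
  qed
  have pos: "0 < \<omega> \<bullet> e" if "e \<in> C - {0}" for e
  proof -
    have "\<omega> \<bullet> e \<noteq> 0"
      using rationally_independent_inj[OF independent, of e 0] that VC(4) by auto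
    with nonneg[of e] that show ?thesis by auto
  qed
  have "gen_cone C = gen_cone (C - {0})"
  proof
    have "e \<in> gen_cone (C - {0})" if "e \<in> C" for e
      using gen_cone_generator[of "C - {0}" e] gen_cone_0[of "C - {0}"] VC(2) that by (cases "e = 0") auto
    then have "C \<subseteq> gen_cone (C - {0})" by blast
    then show "gen_cone C \<subseteq> gen_cone (C - {0})"
      by (intro gen_cone_subset gen_cone_0 gen_cone_add gen_cone_scaleR)
    show "gen_cone (C - {0}) \<subseteq> gen_cone C" using VC(2) by (intro gen_cone_mono) auto
  qed
  show ?thesis
  proof (rule that[of V "C - {0}"])
  qed (use VC pos \<open>gen_cone C = _\<close> in auto)
qed

text \<open>Among the generators that minimise l there is exactly one with least \<omega>-value. It
  is the strict minimiser of l + e \<omega> for small e > 0, since \<omega> is positive on all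
  recession directions and settles the ties of l; hence it is a vertex.\<close>

lemma carrier_vertex:
  assumes P: "P \<in> carrier A" "P \<noteq> {}" and l: "min_value P l \<noteq> -\<infinity>"
  obtains v where "v extreme_point_of P" "rational_vector v" "min_value P l = ereal (l \<bullet> v)"
proof -
  obtain V C where VC: "finite V" "finite C" "\<And>v. v \<in> V \<Longrightarrow> rational_vector v"
    "\<And>c. c \<in> C \<Longrightarrow> rational_vector c" "V \<noteq> {}" "\<And>c. c \<in> C \<Longrightarrow> c \<noteq> 0 \<and> 0 < \<omega> \<bullet> c"
    "P = convex hull V + gen_cone C"
    using carrier_generated[OF P] by metis
  have VP: "v \<in> P" if "v \<in> V" for v
    using set_plus_intro[OF hull_inc[OF that] gen_cone_0[of C], of convex] VC(7) by simp
  obtain v0 where "v0 \<in> V" using VC(5) by blast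
  then have lC: "0 \<le> l \<bullet> c" if "c \<in> C" for c
    using min_value_generated_MInf[OF VC(2) _ that, of v0 V l] l VC(7) by fastforce
  define m where "m = Min ((\<lambda>v. l \<bullet> v) ` V)"
  define V1 where "V1 = {v \<in> V. l \<bullet> v = m}"
  have "m \<in> (\<lambda>v. l \<bullet> v) ` V" unfolding m_def using VC by (intro Min_in) auto
  then have V1: "V1 \<noteq> {}" "finite V1" using VC(1) by (auto simp: V1_def)
  have "Min ((\<lambda>v. \<omega> \<bullet> v) ` V1) \<in> (\<lambda>v. \<omega> \<bullet> v) ` V1" using V1 by (intro Min_in) auto
  then obtain v where v: "v \<in> V1" "Min ((\<lambda>v. \<omega> \<bullet> v) ` V1) = \<omega> \<bullet> v" by blast
  have vV: "v \<in> V" "l \<bullet> v = m" using v by (auto simp: V1_def)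
  have strict: "\<forall>\<^sub>F e in at_right 0. l \<bullet> v + e * (\<omega> \<bullet> v) < l \<bullet> u + e * (\<omega> \<bullet> u)" if u: "u \<in> V - {v}" for u
  proof (cases "u \<in> V1")
    case True
    then have "\<omega> \<bullet> v \<le> \<omega> \<bullet> u" using V1(2) v(2) by (metis Min_le finite_imageI imageI)
    moreover have "\<omega> \<bullet> v \<noteq> \<omega> \<bullet> u"
      using rationally_independent_inj[OF independent, of v u] VC(3) vV u by auto
    ultimately have "\<omega> \<bullet> v < \<omega> \<bullet> u" by simp
    moreover have "\<forall>\<^sub>F e in at_right 0. (0::real) < e" by (simp add: eventually_at_right_less)
    ultimately show ?thesis using True vV by (auto elim!: eventually_mono simp: V1_def)
  next
    case False
    have "m \<le> l \<bullet> u" unfolding m_def using VC(1) u by (intro Min_le) auto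
    with False u have lt: "l \<bullet> v < l \<bullet> u" using vV by (auto simp: V1_def)
    have "((\<lambda>e. l \<bullet> u + e * (\<omega> \<bullet> u) - (l \<bullet> v + e * (\<omega> \<bullet> v))) \<longlongrightarrow> l \<bullet> u + 0 * (\<omega> \<bullet> u) - (l \<bullet> v + 0 * (\<omega> \<bullet> v)))
        (at_right 0)"
      by (intro tendsto_intros)
    from order_tendstoD(1)[OF this, of 0] lt show ?thesis by simp
  qed
  have "\<forall>\<^sub>F e in at_right 0. \<forall>u\<in>V - {v}. l \<bullet> v + e * (\<omega> \<bullet> v) < l \<bullet> u + e * (\<omega> \<bullet> u)"
    using VC(1) strict by (intro eventually_ball_finite) auto
  moreover have "\<forall>\<^sub>F e in at_right 0. (0::real) < e" by (simp add: eventually_at_right_less)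
  ultimately have "\<forall>\<^sub>F e in at_right 0. 0 < e \<and> (\<forall>u\<in>V - {v}. l \<bullet> v + e * (\<omega> \<bullet> v) < l \<bullet> u + e * (\<omega> \<bullet> u))"
    by (rule eventually_conj[rotated])
  then obtain e where e: "0 < e" "\<forall>u\<in>V - {v}. l \<bullet> v + e * (\<omega> \<bullet> v) < l \<bullet> u + e * (\<omega> \<bullet> u)"
    using eventually_happens'[OF trivial_limit_at_right_real] by blast
  define g where "g = l + e *\<^sub>R \<omega>"
  have "g \<bullet> v < g \<bullet> x" if "x \<in> P" "x \<noteq> v" for x
  proof (rule strict_min_generated[of V])
    show "g \<bullet> v < g \<bullet> u" if "u \<in> V" "u \<noteq> v" for u
      using e(2) that by (auto simp: g_def inner_add_left)
    show "0 < g \<bullet> c" if "c \<in> C" "c \<noteq> 0" for c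
      using lC[OF that(1)] VC(6)[OF that(1)] e(1) by (auto simp: g_def inner_add_left intro: add_nonneg_pos)
  qed (use that VC(7) in auto)
  then have "v extreme_point_of P"
    by (intro strict_min_extreme_point[of v P g] VP vV) auto
  moreover have "min_value P l = ereal (l \<bullet> v)"
  proof (rule antisym)
    show "ereal (l \<bullet> v) \<le> min_value P l"
      unfolding VC(7) by (rule le_min_value_generated) (use VC(1) lC vV(2) in \<open>auto simp: m_def\<close>)
  qed (rule min_value_le[OF VP[OF vV(1)]])
  ultimately show ?thesis using VC(3) vV that by blast
qed

lemma min_value_omega: "P \<in> carrier A \<Longrightarrow> min_value P \<omega> \<noteq> -\<infinity>"
  by (cases "P = {}") (auto simp: carrier_A positive_for_def min_value_eqI)

end

section \<open>The semirings of polyhedra and of polynomials\<close>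

lemma ereal_min_add: "min a b + c = min (a + c) (b + (c::ereal))"
  by (cases a b rule: linorder_le_cases) (auto simp: min_absorb1 min_absorb2 add_right_mono)

lemma finite_INF_add_ereal:
  assumes "finite I" "I \<noteq> {}"
  shows "(INF i\<in>I. f i) + c = (INF i\<in>I. f i + (c::ereal))"
  using assms by (induction rule: finite_ne_induct) (auto simp: ereal_min_add inf_min)

text \<open>The product of polynomials with coefficients in (min, +); multiplication in
  \<open>UP A\<close> becomes this operation at each form.\<close>

definition minconv :: "(nat \<Rightarrow> ereal) \<Rightarrow> (nat \<Rightarrow> ereal) \<Rightarrow> nat \<Rightarrow> ereal" where
  "minconv f g n = (INF i\<in>{..n}. f i + g (n - i))"

lemma minconv_commute: "minconv f g n = minconv g f n"
proof -
  have "{..n} = (\<lambda>i. n - i) ` {..n}"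
  proof (intro equalityI subsetI)
    fix i assume "i \<in> {..n}"
    then show "i \<in> (\<lambda>i. n - i) ` {..n}" by (intro image_eqI[of _ _ "n - i"]) auto
  qed auto
  then have "minconv f g n = (INF i\<in>(\<lambda>i. n - i) ` {..n}. f i + g (n - i))"
    unfolding minconv_def by (rule arg_cong)
  also have "\<dots> = (INF i\<in>{..n}. f (n - i) + g (n - (n - i)))" by (simp add: image_comp)
  also have "\<dots> = minconv g f n" unfolding minconv_def by (intro INF_cong) (auto simp: add.commute)
  finally show ?thesis .
qed

lemma minconv_assoc: "minconv (minconv f g) h n = minconv f (minconv g h) n"
proof -
  have "minconv (minconv f g) h n = (INF i\<in>{..n}. INF j\<in>{..i}. f j + g (i - j) + h (n - i))"
    unfolding minconv_def by (subst finite_INF_add_ereal) auto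
  also have "\<dots> = (INF i\<in>{..n}. INF j\<in>{..n - i}. f i + (g j + h (n - i - j)))"
  proof (rule antisym; intro INF_greatest)
    fix i j assume "i \<in> {..n}" "j \<in> {..n - i}"
    then have "(INF i\<in>{..n}. INF j\<in>{..i}. f j + g (i - j) + h (n - i)) \<le> f i + g (i + j - i) + h (n - (i + j))"
      by (intro INF_lower2[of "i + j"] INF_lower2[of i]) auto
    then show "(INF i\<in>{..n}. INF j\<in>{..i}. f j + g (i - j) + h (n - i)) \<le> f i + (g j + h (n - i - j))"
      by (simp add: add.assoc)
  next
    fix i j assume ij: "i \<in> {..n}" "j \<in> {..i}"
    then have "(INF i\<in>{..n}. INF j\<in>{..n - i}. f i + (g j + h (n - i - j))) \<le> f j + (g (i - j) + h (n - j - (i - j)))"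
      by (intro INF_lower2[of j] INF_lower2[of "i - j"]) auto
    then show "(INF i\<in>{..n}. INF j\<in>{..n - i}. f i + (g j + h (n - i - j))) \<le> f j + g (i - j) + h (n - i)"
      using ij by (simp add: add.assoc)
  qed
  also have "\<dots> = (INF i\<in>{..n}. (INF j\<in>{..n - i}. g j + h (n - i - j)) + f i)"
    by (subst finite_INF_add_ereal) (auto simp: add.commute)
  also have "\<dots> = minconv f (minconv g h) n"
    unfolding minconv_def by (simp add: add.commute)
  finally show ?thesis .
qed

text \<open>Convexity without subtraction, so that infinite values are allowed. Indices i < j that
  are not adjacent are included because this also forces the indices with value different from
  \<open>\<infinity>\<close> to form an interval.\<close>

definition exchange_convex :: "(nat \<Rightarrow> ereal) \<Rightarrow> bool" where
  "exchange_convex c \<longleftrightarrow> (\<forall>i j. i < j \<longrightarrow> c (i + 1) + c (j - 1) \<le> c i + c j)"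

lemma exchange_convex_add:
  assumes "exchange_convex c"
  shows "exchange_convex (\<lambda>n. a + c n)"
  unfolding exchange_convex_def
proof (intro allI impI)
  fix i j :: nat assume "i < j"
  then have "(a + a) + (c (i + 1) + c (j - 1)) \<le> (a + a) + (c i + c j)"
    using assms by (intro add_left_mono) (auto simp: exchange_convex_def)
  then show "a + c (i + 1) + (a + c (j - 1)) \<le> a + c i + (a + c j)"
    by (simp only: ac_simps)
qed

text \<open>The new sequence belongs to the product with Y \<oplus> P, where p is the value of P.
  Each minimum on the right-hand side is attained by one of two terms; in each of the four cases the
  minima on the left can be bounded by terms that turn the claim into an equality or into an
  exchange inequality of \<open>c\<close>.\<close>

lemma exchange_convex_mult_linear:
  assumes "exchange_convex c"
  shows "exchange_convex (\<lambda>n. min (p + c n) (if n = 0 then \<infinity> else c (n - 1)))"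
  unfolding exchange_convex_def
proof (intro allI impI)
  fix i j :: nat assume ij: "i < j"
  let ?d = "\<lambda>n. min (p + c n) (if n = 0 then \<infinity> else c (n - 1))"
  have c: "c (k + 1) + c (l - 1) \<le> c k + c l" if "k < l" for k l
    using assms that by (auto simp: exchange_convex_def)
  have up: "?d (Suc n) \<le> c n" and stay: "?d n \<le> p + c n" for n by auto
  have "?d (i + 1) + ?d (j - 1) \<le> x + y"
    if x: "x = p + c i \<or> i > 0 \<and> x = c (i - 1)" and y: "y = p + c j \<or> y = c (j - 1)" for x y
    using x
  proof
    assume x: "x = p + c i"
    show ?thesis using y
    proof
      assume y: "y = p + c j"
      have "?d (i + 1) + ?d (j - 1) \<le> (p + c (i + 1)) + (p + c (j - 1))" by (intro add_mono stay)
      also have "\<dots> = (p + p) + (c (i + 1) + c (j - 1))" by (simp only: ac_simps)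
      also have "\<dots> \<le> (p + p) + (c i + c j)" by (intro add_left_mono c ij)
      also have "\<dots> = x + y" unfolding x y by (simp only: ac_simps)
      finally show ?thesis .
    next
      assume y: "y = c (j - 1)"
      have "?d (i + 1) + ?d (j - 1) \<le> c i + (p + c (j - 1))" using up[of i] stay by (intro add_mono) auto
      also have "\<dots> = x + y" unfolding x y by (simp only: ac_simps)
      finally show ?thesis .
    qed
  next
    assume "i > 0 \<and> x = c (i - 1)"
    then have x: "x = c (i - 1)" and i: "i > 0" by auto
    show ?thesis using y
    proof
      assume y: "y = p + c j"
      have "?d (i + 1) + ?d (j - 1) \<le> c i + (p + c (j - 1))" using up[of i] stay by (intro add_mono) auto
      also have "\<dots> = p + (c (i - 1 + 1) + c (j - 1))" using i by (simp add: ac_simps)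
      also have "\<dots> \<le> p + (c (i - 1) + c j)" using ij by (intro add_left_mono c) auto
      also have "\<dots> = x + y" unfolding x y by (simp only: ac_simps)
      finally show ?thesis .
    next
      assume y: "y = c (j - 1)"
      \<comment> \<open>Here 0 < i < j, hence j \<ge> 2 and \<open>j - 2\<close> is not
        truncated.\<close>
      have "?d (j - 1) \<le> c (j - 2)" using up[of "j - 2"] i ij by (simp add: numeral_2_eq_2 Suc_diff_Suc)
      then have "?d (i + 1) + ?d (j - 1) \<le> c i + c (j - 2)" using up[of i] by (intro add_mono) auto
      also have "\<dots> = c (i - 1 + 1) + c (j - 1 - 1)" using i by (simp add: numeral_2_eq_2)
      also have "\<dots> \<le> c (i - 1) + c (j - 1)" using ij i by (intro c) auto
      finally show ?thesis using x y by simp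
    qed
  qed
  moreover have "?d i = p + c i \<or> i > 0 \<and> ?d i = c (i - 1) \<or> ?d i = \<infinity>" by (auto simp: min_def)
  moreover have "?d j = p + c j \<or> ?d j = c (j - 1)" using ij by (auto simp: min_def)
  ultimately show "?d (i + 1) + ?d (j - 1) \<le> ?d i + ?d j" by (metis ereal_less_eq(1) plus_ereal.simps(2))
qed

section \<open>The semiring laws\<close>

context polyhedra
begin

lemma carrier_singleton: "rational_vector x \<Longrightarrow> {x} \<in> carrier A"
  using generated_carrier[of "{x}" "{}"] by simp

lemma empty_carrier [simp]: "{} \<in> carrier A"
  by (simp add: carrier_A)

lemma one_carrier [simp]: "{0} \<in> carrier A"
  by (rule carrier_singleton) simp

lemma plus_carrier:
  assumes "P \<in> carrier A" "Q \<in> carrier A"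
  shows "P + Q \<in> carrier A"
proof (cases "P = {} \<or> Q = {}")
  case True
  then have "P + Q = {}" by (auto simp: set_plus_def)
  then show ?thesis by simp
next
  case False
  obtain V C where P: "finite V" "finite C" "\<And>v. v \<in> V \<Longrightarrow> rational_vector v"
    "\<And>c. c \<in> C \<Longrightarrow> rational_vector c" "V \<noteq> {}" "\<And>c. c \<in> C \<Longrightarrow> c \<noteq> 0 \<and> 0 < \<omega> \<bullet> c"
    "P = convex hull V + gen_cone C"
    using carrier_generated[OF assms(1)] False by metis
  obtain V' C' where Q: "finite V'" "finite C'" "\<And>v. v \<in> V' \<Longrightarrow> rational_vector v"
    "\<And>c. c \<in> C' \<Longrightarrow> rational_vector c" "V' \<noteq> {}" "\<And>c. c \<in> C' \<Longrightarrow> c \<noteq> 0 \<and> 0 < \<omega> \<bullet> c"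
    "Q = convex hull V' + gen_cone C'"
    using carrier_generated[OF assms(2)] False by metis
  have "P + Q = convex hull (V + V') + gen_cone (C \<union> C')"
    using P Q by (simp add: convex_hull_set_plus gen_cone_Un ac_simps)
  also have "\<dots> \<in> carrier A - {{}}"
  proof (rule generated_carrier)
    show "V + V' \<noteq> {}" using P(5) Q(5) by (auto simp: set_plus_def)
    show "rational_vector v" if "v \<in> V + V'" for v
      using that P(3) Q(3) by (auto intro: rational_vector_add elim!: set_plus_elim)
    show "0 \<le> \<omega> \<bullet> c" if "c \<in> C \<union> C'" for c using that P(6) Q(6) by (auto intro: less_imp_le)
  qed (use P Q in \<open>auto intro: finite_set_plus\<close>)
  finally show ?thesis by simp
qed

lemma hull_carrier:
  assumes "P \<in> carrier A" "Q \<in> carrier A"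
  shows "closure (convex hull (P \<union> Q)) \<in> carrier A"
proof (cases "P = {} \<or> Q = {}")
  case True
  then show ?thesis
    using assms carrier_closed carrier_convex by (auto simp: hull_same)
next
  case False
  obtain V C where P: "finite V" "finite C" "\<And>v. v \<in> V \<Longrightarrow> rational_vector v"
    "\<And>c. c \<in> C \<Longrightarrow> rational_vector c" "V \<noteq> {}" "\<And>c. c \<in> C \<Longrightarrow> c \<noteq> 0 \<and> 0 < \<omega> \<bullet> c"
    "P = convex hull V + gen_cone C"
    using carrier_generated[OF assms(1)] False by metis
  obtain V' C' where Q: "finite V'" "finite C'" "\<And>v. v \<in> V' \<Longrightarrow> rational_vector v"
    "\<And>c. c \<in> C' \<Longrightarrow> rational_vector c" "V' \<noteq> {}" "\<And>c. c \<in> C' \<Longrightarrow> c \<noteq> 0 \<and> 0 < \<omega> \<bullet> c"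
    "Q = convex hull V' + gen_cone C'"
    using carrier_generated[OF assms(2)] False by metis
  have "closure (convex hull (P \<union> Q)) = convex hull (V \<union> V') + gen_cone (C \<union> C')"
    unfolding P(7) Q(7) by (rule closure_convex_hull_Un_generated) (use P Q in auto)
  also have "\<dots> \<in> carrier A - {{}}"
    by (rule generated_carrier) (use P Q in \<open>auto intro: less_imp_le\<close>)
  finally show ?thesis by simp
qed

lemma min_value_add_A: "min_value (P \<oplus>\<^bsub>A\<^esub> Q) l = min (min_value P l) (min_value Q l)"
  by (simp add: min_value_closure_convex_hull min_value_Un)

lemma abelian_monoid_A: "abelian_monoid A"
proof (rule abelian_monoidI)
  fix P Q R assume c: "P \<in> carrier A" "Q \<in> carrier A" "R \<in> carrier A"
  then show "P \<oplus>\<^bsub>A\<^esub> Q \<oplus>\<^bsub>A\<^esub> R = P \<oplus>\<^bsub>A\<^esub> (Q \<oplus>\<^bsub>A\<^esub> R)"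
    by (intro carrier_eqI) (auto intro!: hull_carrier simp: min_value_closure_convex_hull min_value_Un min.assoc)
next
  fix P assume "P \<in> carrier A"
  then show "\<zero>\<^bsub>A\<^esub> \<oplus>\<^bsub>A\<^esub> P = P" by (simp add: hull_same carrier_convex carrier_closed)
qed (auto intro: hull_carrier simp: Un_commute)

lemma comm_monoid_A: "comm_monoid A"
proof (rule comm_monoidI)
  fix P assume "P \<in> carrier A"
  show "\<one>\<^bsub>A\<^esub> \<otimes>\<^bsub>A\<^esub> P = P" by (simp flip: set_zero)
qed (auto intro: plus_carrier simp: ac_simps)

sublocale A: abelian_monoid A by (rule abelian_monoid_A)
sublocale A: comm_monoid A by (rule comm_monoid_A)

lemma min_value_finsum:
  assumes "finite S" "\<And>i. i \<in> S \<Longrightarrow> T i \<in> carrier A"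
  shows "min_value (\<Oplus>\<^bsub>A\<^esub>i\<in>S. T i) l = (INF i\<in>S. min_value (T i) l)"
  using assms
proof (induction S rule: finite_induct)
  case empty
  then show ?case by (simp add: top_ereal_def)
next
  case (insert i S)
  then have "(\<Oplus>\<^bsub>A\<^esub>i\<in>insert i S. T i) = T i \<oplus>\<^bsub>A\<^esub> (\<Oplus>\<^bsub>A\<^esub>i\<in>S. T i)"
    by (intro A.finsum_insert) auto
  with insert show ?case by (simp add: min_value_add_A inf_min del: A_simps)
qed

lemma min_value_finprod:
  assumes "finite S" "\<And>i. i \<in> S \<Longrightarrow> T i \<in> carrier A"
  shows "min_value (\<Otimes>\<^bsub>A\<^esub>i\<in>S. T i) l = (\<Sum>i\<in>S. min_value (T i) l)"
  using assms
proof (induction S rule: finite_induct)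
  case empty
  then show ?case by simp
next
  case (insert i S)
  then have "(\<Otimes>\<^bsub>A\<^esub>i\<in>insert i S. T i) = T i \<otimes>\<^bsub>A\<^esub> (\<Otimes>\<^bsub>A\<^esub>i\<in>S. T i)"
    by (intro A.finprod_insert) auto
  with insert show ?case by (simp add: min_value_plus)
qed

text \<open>For k = 0 the convention that 0 times an infinite value is 0 agrees with the zeroth
  power being {0}.\<close>

lemma min_value_pow: "min_value (P [^]\<^bsub>A\<^esub> (k::nat)) l = ereal (real k) * min_value P l"
proof (induction k)
  case 0
  show ?case by (simp flip: zero_ereal_def)
next
  case (Suc k)
  then show ?case
    by (cases "min_value P l"; cases "k = 0") (auto simp: min_value_plus algebra_simps)
qed

section \<open>Univariate polynomials over the semiring\<close>

lemma carrier_UP: "p \<in> carrier (UP A) \<longleftrightarrow> (\<forall>n. p n \<in> carrier A) \<and> (\<exists>n. \<forall>m>n. p m = {})"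
  by (auto simp: UP_def up_def bound_def)

lemma UP_eqI:
  assumes "p \<in> carrier (UP A)" "q \<in> carrier (UP A)" "\<And>n l. min_value (p n) l = min_value (q n) l"
  shows "p = q"
proof
  fix n show "p n = q n"
    by (rule carrier_eqI) (use assms in \<open>auto simp: carrier_UP\<close>)
qed

lemma UP_mult:
  assumes "p \<in> carrier (UP A)" "q \<in> carrier (UP A)"
  shows "(p \<otimes>\<^bsub>UP A\<^esub> q) n = (\<Oplus>\<^bsub>A\<^esub>i\<in>{..n}. p i \<otimes>\<^bsub>A\<^esub> q (n - i))"
  using assms by (simp add: UP_def)

lemma UP_add:
  assumes "p \<in> carrier (UP A)" "q \<in> carrier (UP A)"
  shows "(p \<oplus>\<^bsub>UP A\<^esub> q) n = p n \<oplus>\<^bsub>A\<^esub> q n"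
  using assms by (simp add: UP_def)

lemma UP_zero: "\<zero>\<^bsub>UP A\<^esub> = (\<lambda>n. {})"
  by (simp add: UP_def)

lemma UP_one: "\<one>\<^bsub>UP A\<^esub> = (\<lambda>n. if n = 0 then {0} else {})"
  by (simp add: UP_def fun_eq_iff)

lemma UP_monom: "P \<in> carrier A \<Longrightarrow> monom (UP A) P k = (\<lambda>n. if n = k then P else {})"
  by (simp add: UP_def fun_eq_iff)

lemma UP_coeff: "p \<in> carrier (UP A) \<Longrightarrow> coeff (UP A) p n = p n"
  by (simp add: UP_def)

lemma monom_carrier: "P \<in> carrier A \<Longrightarrow> monom (UP A) P k \<in> carrier (UP A)"
  by (auto simp: UP_monom carrier_UP)

lemma min_value_UP_mult:
  assumes "p \<in> carrier (UP A)" "q \<in> carrier (UP A)"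
  shows "min_value ((p \<otimes>\<^bsub>UP A\<^esub> q) n) l = minconv (\<lambda>n. min_value (p n) l) (\<lambda>n. min_value (q n) l) n"
  unfolding UP_mult[OF assms] minconv_def using assms
  by (subst min_value_finsum) (auto simp: min_value_plus carrier_UP intro: plus_carrier)

lemma UP_mult_carrier:
  assumes "p \<in> carrier (UP A)" "q \<in> carrier (UP A)"
  shows "p \<otimes>\<^bsub>UP A\<^esub> q \<in> carrier (UP A)"
proof -
  obtain M N where MN: "\<And>m. m > M \<Longrightarrow> p m = {}" "\<And>m. m > N \<Longrightarrow> q m = {}"
    using assms by (auto simp: carrier_UP)
  have "(p \<otimes>\<^bsub>UP A\<^esub> q) m = {}" if "m > M + N" for m
  proof -
    have "\<infinity> \<le> min_value (p i) 0 + min_value (q (m - i)) 0" for i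
      using MN(1)[of i] MN(2)[of "m - i"] that by (cases "i > M") auto
    then have "\<infinity> \<le> min_value ((p \<otimes>\<^bsub>UP A\<^esub> q) m) 0"
      unfolding min_value_UP_mult[OF assms] minconv_def by (intro INF_greatest)
    then show ?thesis by (simp add: min_value_eq_PInf_iff)
  qed
  moreover have "(p \<otimes>\<^bsub>UP A\<^esub> q) n \<in> carrier A" for n
    unfolding UP_mult[OF assms] using assms
    by (intro A.finsum_closed) (auto simp: carrier_UP intro: plus_carrier)
  ultimately show ?thesis unfolding carrier_UP by blast
qed

lemma UP_add_carrier:
  assumes "p \<in> carrier (UP A)" "q \<in> carrier (UP A)"
  shows "p \<oplus>\<^bsub>UP A\<^esub> q \<in> carrier (UP A)"
proof -
  obtain M N where MN: "\<And>m. m > M \<Longrightarrow> p m = {}" "\<And>m. m > N \<Longrightarrow> q m = {}"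
    using assms by (auto simp: carrier_UP)
  have "(p \<oplus>\<^bsub>UP A\<^esub> q) m = {}" if "m > M + N" for m
    using MN that unfolding UP_add[OF assms] by simp
  moreover have "(p \<oplus>\<^bsub>UP A\<^esub> q) n \<in> carrier A" for n
    unfolding UP_add[OF assms] using assms by (auto simp: carrier_UP intro: hull_carrier)
  ultimately show ?thesis unfolding carrier_UP by blast
qed

lemma min_value_UP_one: "min_value (\<one>\<^bsub>UP A\<^esub> n) l = (if n = 0 then 0 else \<infinity>)"
  by (simp add: UP_one)

text \<open>Addition in \<open>A\<close> has no inverses, so \<open>UP A\<close> is no polynomial
  ring over a ring. Its laws are checked on values, where they are laws of
  \<open>minconv\<close>.\<close>

lemma comm_monoid_UP: "comm_monoid (UP A)"
proof (rule comm_monoidI)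
  have one: "\<one>\<^bsub>UP A\<^esub> \<in> carrier (UP A)" by (auto simp: UP_one carrier_UP)
  then show "\<one>\<^bsub>UP A\<^esub> \<in> carrier (UP A)" .
  fix p q r assume p: "p \<in> carrier (UP A)"
  show "\<one>\<^bsub>UP A\<^esub> \<otimes>\<^bsub>UP A\<^esub> p = p"
  proof (rule UP_eqI)
    fix n l
    have "(INF i\<in>{..n}. min_value (\<one>\<^bsub>UP A\<^esub> i) l + min_value (p (n - i)) l) = min_value (p n) l"
      by (rule antisym) (auto intro!: INF_greatest INF_lower2[of 0] simp: min_value_UP_one)
    then show "min_value ((\<one>\<^bsub>UP A\<^esub> \<otimes>\<^bsub>UP A\<^esub> p) n) l = min_value (p n) l"
      by (simp add: min_value_UP_mult one p minconv_def)
  qed (use p one in \<open>auto intro: UP_mult_carrier\<close>)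
  assume q: "q \<in> carrier (UP A)"
  show "p \<otimes>\<^bsub>UP A\<^esub> q \<in> carrier (UP A)" using p q by (rule UP_mult_carrier)
  show "p \<otimes>\<^bsub>UP A\<^esub> q = q \<otimes>\<^bsub>UP A\<^esub> p"
    by (rule UP_eqI) (use p q in \<open>auto intro: UP_mult_carrier minconv_commute simp: min_value_UP_mult\<close>)
  assume r: "r \<in> carrier (UP A)"
  show "p \<otimes>\<^bsub>UP A\<^esub> q \<otimes>\<^bsub>UP A\<^esub> r = p \<otimes>\<^bsub>UP A\<^esub> (q \<otimes>\<^bsub>UP A\<^esub> r)"
  proof (rule UP_eqI)
    show "min_value ((p \<otimes>\<^bsub>UP A\<^esub> q \<otimes>\<^bsub>UP A\<^esub> r) n) l = min_value ((p \<otimes>\<^bsub>UP A\<^esub> (q \<otimes>\<^bsub>UP A\<^esub> r)) n) l" for n l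
      using p q r by (simp add: min_value_UP_mult UP_mult_carrier minconv_assoc)
  qed (use p q r in \<open>auto intro: UP_mult_carrier\<close>)
qed

lemma abelian_monoid_UP: "abelian_monoid (UP A)"
proof (rule abelian_monoidI)
  show zero: "\<zero>\<^bsub>UP A\<^esub> \<in> carrier (UP A)" by (auto simp: UP_zero carrier_UP)
  fix p q r assume p: "p \<in> carrier (UP A)"
  show "\<zero>\<^bsub>UP A\<^esub> \<oplus>\<^bsub>UP A\<^esub> p = p"
    by (rule ext) (use p zero in \<open>simp only: UP_add, simp add: UP_zero carrier_UP hull_same carrier_convex carrier_closed\<close>)
  assume q: "q \<in> carrier (UP A)"
  show "p \<oplus>\<^bsub>UP A\<^esub> q \<in> carrier (UP A)" using p q by (rule UP_add_carrier)
  show "p \<oplus>\<^bsub>UP A\<^esub> q = q \<oplus>\<^bsub>UP A\<^esub> p"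
    by (rule ext) (use p q in \<open>simp add: UP_add Un_commute\<close>)
  assume r: "r \<in> carrier (UP A)"
  show "p \<oplus>\<^bsub>UP A\<^esub> q \<oplus>\<^bsub>UP A\<^esub> r = p \<oplus>\<^bsub>UP A\<^esub> (q \<oplus>\<^bsub>UP A\<^esub> r)"
  proof (rule UP_eqI)
    show "min_value ((p \<oplus>\<^bsub>UP A\<^esub> q \<oplus>\<^bsub>UP A\<^esub> r) n) l = min_value ((p \<oplus>\<^bsub>UP A\<^esub> (q \<oplus>\<^bsub>UP A\<^esub> r)) n) l" for n l
      using p q r by (simp add: UP_add UP_add_carrier min_value_add_A min.assoc del: A_simps)
  qed (use p q r in \<open>auto intro: UP_add_carrier\<close>)
qed

lemma UP_finsum_monom:
  assumes "finite S" "\<And>i. i \<in> S \<Longrightarrow> Q i \<in> carrier A"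
  shows "(\<Oplus>\<^bsub>UP A\<^esub>i\<in>S. monom (UP A) (Q i) i) = (\<lambda>n. if n \<in> S then Q n else {})"
proof -
  interpret UP: abelian_monoid "UP A" by (rule abelian_monoid_UP)
  show ?thesis using assms
  proof (induction S rule: finite_induct)
    case empty
    then show ?case by (simp add: UP_zero)
  next
    case (insert i S)
    have S: "(\<Oplus>\<^bsub>UP A\<^esub>i\<in>S. monom (UP A) (Q i) i) = (\<lambda>n. if n \<in> S then Q n else {})"
      using insert by simp
    have "(\<Oplus>\<^bsub>UP A\<^esub>i\<in>S. monom (UP A) (Q i) i) \<in> carrier (UP A)"
      using insert by (intro UP.finsum_closed) (auto intro: monom_carrier)
    moreover have "(\<Oplus>\<^bsub>UP A\<^esub>i\<in>insert i S. monom (UP A) (Q i) i) =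
        monom (UP A) (Q i) i \<oplus>\<^bsub>UP A\<^esub> (\<Oplus>\<^bsub>UP A\<^esub>i\<in>S. monom (UP A) (Q i) i)"
      using insert by (intro UP.finsum_insert) (auto intro: monom_carrier)
    ultimately have "(\<Oplus>\<^bsub>UP A\<^esub>i\<in>insert i S. monom (UP A) (Q i) i) n =
        monom (UP A) (Q i) i n \<oplus>\<^bsub>A\<^esub> (if n \<in> S then Q n else {})" for n
      using insert.prems by (simp add: UP_add monom_carrier S del: A_simps)
    then show ?case
      using insert.hyps insert.prems by (auto simp: fun_eq_iff UP_monom hull_same carrier_convex carrier_closed)
  qed
qed

text \<open>The sequence 0, \<open>\<infinity>\<close>, \<open>\<infinity>\<close>, ... of the unit
  polynomial is convex, every factor Y \<oplus> P preserves convexity, and the factor Q adds a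
  constant.\<close>

lemma exchange_convex_product_form:
  assumes "product_form A \<phi>"
  shows "exchange_convex (\<lambda>n. min_value (\<phi> n) l)"
proof -
  interpret UP: comm_monoid "UP A" by (rule comm_monoid_UP)
  obtain Q P where Q: "Q \<in> carrier A" and P: "\<And>i. i \<in> {1..deg A \<phi>} \<Longrightarrow> P i \<in> carrier A"
    and \<phi>: "\<phi> = monom (UP A) Q 0 \<otimes>\<^bsub>UP A\<^esub> (\<Otimes>\<^bsub>UP A\<^esub>i\<in>{1..deg A \<phi>}.
      monom (UP A) \<one>\<^bsub>A\<^esub> 1 \<oplus>\<^bsub>UP A\<^esub> monom (UP A) (P i) 0)"
    using assms unfolding product_form_def by blast
  define L where "L i = monom (UP A) \<one>\<^bsub>A\<^esub> 1 \<oplus>\<^bsub>UP A\<^esub> monom (UP A) (P i) 0" for i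
  have L: "L i \<in> carrier (UP A)" if "P i \<in> carrier A" for i
    unfolding L_def using that by (intro UP_add_carrier monom_carrier) auto
  have mL: "min_value (L i n) l = (if n = 0 then min_value (P i) l else if n = 1 then 0 else \<infinity>)"
    if "P i \<in> carrier A" for i n
  proof -
    have "L i n = monom (UP A) \<one>\<^bsub>A\<^esub> 1 n \<oplus>\<^bsub>A\<^esub> monom (UP A) (P i) 0 n"
      unfolding L_def using that by (intro UP_add monom_carrier) auto
    then show ?thesis using that by (simp add: min_value_add_A UP_monom del: A_simps(3))
  qed
  have mult: "minconv (\<lambda>n. min_value (L i n) l) c n =
      min (min_value (P i) l + c n) (if n = 0 then \<infinity> else c (n - 1))" if "P i \<in> carrier A" for i c n
  proof -
    have "{..n} = (if n = 0 then {0} else {0, 1} \<union> {2..n})" by auto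
    then show ?thesis
      unfolding minconv_def mL[OF that]
      by (auto simp: INF_union inf_min min_def top_ereal_def INF_constant intro!: antisym)
  qed
  have "exchange_convex (\<lambda>n. min_value ((\<Otimes>\<^bsub>UP A\<^esub>i\<in>S. L i) n) l)"
    if "finite S" "\<And>i. i \<in> S \<Longrightarrow> P i \<in> carrier A" for S
    using that
  proof (induction S rule: finite_induct)
    case empty
    then show ?case by (simp add: exchange_convex_def min_value_UP_one)
  next
    case (insert i S)
    have "(\<Otimes>\<^bsub>UP A\<^esub>i\<in>insert i S. L i) = L i \<otimes>\<^bsub>UP A\<^esub> (\<Otimes>\<^bsub>UP A\<^esub>i\<in>S. L i)"
      using insert by (intro UP.finprod_insert) (auto intro: L)
    moreover have "(\<Otimes>\<^bsub>UP A\<^esub>i\<in>S. L i) \<in> carrier (UP A)"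
      using insert by (intro UP.finprod_closed) (auto intro: L)
    ultimately show ?case
      using insert exchange_convex_mult_linear by (simp add: min_value_UP_mult L mult)
  qed
  from this[of "{1..deg A \<phi>}"] have conv: "exchange_convex (\<lambda>n. min_value ((\<Otimes>\<^bsub>UP A\<^esub>i\<in>{1..deg A \<phi>}. L i) n) l)"
    using P by simp
  have F: "(\<Otimes>\<^bsub>UP A\<^esub>i\<in>{1..deg A \<phi>}. L i) \<in> carrier (UP A)"
    using P by (intro UP.finprod_closed) (auto intro: L)
  have "minconv (\<lambda>n. min_value (monom (UP A) Q 0 n) l) c n = min_value Q l + c n" for c n
    unfolding minconv_def UP_monom[OF Q]
    by (rule antisym) (auto intro!: INF_greatest INF_lower2[of 0])
  moreover have "\<phi> = monom (UP A) Q 0 \<otimes>\<^bsub>UP A\<^esub> (\<Otimes>\<^bsub>UP A\<^esub>i\<in>{1..deg A \<phi>}. L i)"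
    unfolding L_def by (rule \<phi>)
  ultimately have "min_value (\<phi> n) l = min_value Q l + min_value ((\<Otimes>\<^bsub>UP A\<^esub>i\<in>{1..deg A \<phi>}. L i) n) l" for n
    using min_value_UP_mult[OF monom_carrier[OF Q] F] by metis
  with exchange_convex_add[OF conv] show ?thesis by presburger
qed

end

section \<open>Complex polynomials and projective sets\<close>

definition meval :: "(nat \<Rightarrow>\<^sub>0 nat) \<Rightarrow> (nat \<Rightarrow> complex) \<Rightarrow> complex" where
  "meval \<alpha> v = (\<Prod>i\<in>Poly_Mapping.keys \<alpha>. v i ^ Poly_Mapping.lookup \<alpha> i)"

lemma meval_superset:
  assumes "finite S" "Poly_Mapping.keys \<alpha> \<subseteq> S"
  shows "meval \<alpha> v = (\<Prod>i\<in>S. v i ^ Poly_Mapping.lookup \<alpha> i)"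
  unfolding meval_def using assms by (intro prod.mono_neutral_left) (auto simp: in_keys_iff)

lemma meval_0 [simp]: "meval 0 v = 1"
  by (simp add: meval_def)

lemma meval_add: "meval (\<alpha> + \<beta>) v = meval \<alpha> v * meval \<beta> v"
proof -
  let ?S = "Poly_Mapping.keys \<alpha> \<union> Poly_Mapping.keys \<beta>"
  have "meval (\<alpha> + \<beta>) v = (\<Prod>i\<in>?S. v i ^ Poly_Mapping.lookup (\<alpha> + \<beta>) i)"
    by (rule meval_superset) (auto simp: in_keys_iff lookup_add)
  also have "\<dots> = meval \<alpha> v * meval \<beta> v"
    by (simp add: meval_superset[of ?S] lookup_add power_add prod.distrib)
  finally show ?thesis .
qed

lemma ceval_def': "ceval f v = (\<Sum>\<alpha>\<in>Poly_Mapping.keys f. Poly_Mapping.lookup f \<alpha> * meval \<alpha> v)"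
  by (simp add: ceval_def meval_def)

lemma ceval_superset:
  assumes "finite T" "Poly_Mapping.keys f \<subseteq> T"
  shows "ceval f v = (\<Sum>\<alpha>\<in>T. Poly_Mapping.lookup f \<alpha> * meval \<alpha> v)"
  unfolding ceval_def' using assms by (intro sum.mono_neutral_left) (auto simp: in_keys_iff)

lemma ceval_0 [simp]: "ceval 0 v = 0"
  by (simp add: ceval_def)

lemma ceval_single: "ceval (Poly_Mapping.single \<alpha> c) v = c * meval \<alpha> v"
  by (subst ceval_superset[of "{\<alpha>}"]) auto

lemma ceval_1 [simp]: "ceval 1 v = 1"
  by (metis ceval_single meval_0 mult_1 single_one)

lemma ceval_add: "ceval (f + g) v = ceval f v + ceval g v"
proof -
  let ?T = "Poly_Mapping.keys f \<union> Poly_Mapping.keys g"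
  have "ceval (f + g) v = (\<Sum>\<alpha>\<in>?T. Poly_Mapping.lookup (f + g) \<alpha> * meval \<alpha> v)"
    by (rule ceval_superset) (auto simp: in_keys_iff lookup_add)
  also have "\<dots> = ceval f v + ceval g v"
    by (simp add: ceval_superset[of ?T] lookup_add distrib_right sum.distrib)
  finally show ?thesis .
qed

lemma ceval_sum: "ceval (\<Sum>i\<in>S. f i) v = (\<Sum>i\<in>S. ceval (f i) v)"
  by (induction S rule: infinite_finite_induct) (auto simp: ceval_add)

lemma poly_mapping_sum_single:
  "f = (\<Sum>\<alpha>\<in>Poly_Mapping.keys f. Poly_Mapping.single \<alpha> (Poly_Mapping.lookup f \<alpha>))"
proof (rule poly_mapping_eqI)
  fix \<beta>
  have "(\<Sum>\<alpha>\<in>Poly_Mapping.keys f. Poly_Mapping.lookup (Poly_Mapping.single \<alpha> (Poly_Mapping.lookup f \<alpha>)) \<beta>) =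
      (\<Sum>\<alpha>\<in>Poly_Mapping.keys f. if \<beta> = \<alpha> then Poly_Mapping.lookup f \<alpha> else 0)"
    by (rule sum.cong) (auto simp: lookup_single)
  also have "\<dots> = Poly_Mapping.lookup f \<beta>"
    by (simp add: not_in_keys_iff_lookup_eq_zero)
  finally show "Poly_Mapping.lookup f \<beta> =
      Poly_Mapping.lookup (\<Sum>\<alpha>\<in>Poly_Mapping.keys f. Poly_Mapping.single \<alpha> (Poly_Mapping.lookup f \<alpha>)) \<beta>"
    by (simp add: lookup_sum)
qed

lemma ceval_mult: "ceval (f * g) v = ceval f v * ceval g v"
proof -
  have "f * g = (\<Sum>\<alpha>\<in>Poly_Mapping.keys f. \<Sum>\<beta>\<in>Poly_Mapping.keys g.
      Poly_Mapping.single (\<alpha> + \<beta>) (Poly_Mapping.lookup f \<alpha> * Poly_Mapping.lookup g \<beta>))"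
    by (subst (1) poly_mapping_sum_single[of f], subst (1) poly_mapping_sum_single[of g])
       (simp add: sum_product mult_single)
  then have "ceval (f * g) v = (\<Sum>\<alpha>\<in>Poly_Mapping.keys f. \<Sum>\<beta>\<in>Poly_Mapping.keys g.
      (Poly_Mapping.lookup f \<alpha> * Poly_Mapping.lookup g \<beta>) * (meval \<alpha> v * meval \<beta> v))"
    by (simp only: ceval_sum ceval_single meval_add)
  also have "\<dots> = ceval f v * ceval g v"
    unfolding ceval_def' sum_product by (simp only: ac_simps)
  finally show ?thesis .
qed

lemma ceval_uminus: "ceval (- f) v = - ceval f v"
  using ceval_add[of "- f" f v] by (simp add: eq_neg_iff_add_eq_0)

lemma ceval_diff: "ceval (f - g) v = ceval f v - ceval g v"
  using ceval_add[of f "- g" v] by (simp add: ceval_uminus)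

lemma comm_ring_hom_ceval: "comm_ring_hom (\<lambda>f. ceval f v)"
  by unfold_locales (auto simp: ceval_add ceval_mult)

definition pvar :: "nat \<Rightarrow> cmpoly" where
  "pvar i = Poly_Mapping.single (Poly_Mapping.single i 1) 1"

lemma ceval_pvar [simp]: "ceval (pvar i) v = v i"
  by (simp add: pvar_def ceval_single meval_def)

lemma ceval_of_nat [simp]: "ceval (of_nat n) v = of_nat n"
  by (induction n) (auto simp: ceval_add)

lemma cpolys_0 [simp]: "0 \<in> cpolys I" by (simp add: cpolys_def)

lemma cpolys_single: "Poly_Mapping.keys \<alpha> \<subseteq> I \<Longrightarrow> Poly_Mapping.single \<alpha> c \<in> cpolys I"
  by (simp add: cpolys_def)

lemma cpolys_1 [simp]: "1 \<in> cpolys I"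
  using cpolys_single[of 0 I 1] by simp

lemma cpolys_pvar: "i \<in> I \<Longrightarrow> pvar i \<in> cpolys I"
  unfolding pvar_def by (rule cpolys_single) auto

lemma cpolys_add: "f \<in> cpolys I \<Longrightarrow> g \<in> cpolys I \<Longrightarrow> f + g \<in> cpolys I"
  using keys_add[of f g] by (auto simp: cpolys_def subset_iff)

lemma cpolys_uminus: "f \<in> cpolys I \<Longrightarrow> - f \<in> cpolys I"
  by (auto simp: cpolys_def in_keys_iff)

lemma cpolys_diff: "f \<in> cpolys I \<Longrightarrow> g \<in> cpolys I \<Longrightarrow> f - g \<in> cpolys I"
  using cpolys_add[of f I "- g"] cpolys_uminus[of g I] by simp

lemma cpolys_mult:
  assumes "f \<in> cpolys I" "g \<in> cpolys I"
  shows "f * g \<in> cpolys I"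
  unfolding cpolys_def
proof (intro CollectI ballI)
  fix \<gamma> assume "\<gamma> \<in> Poly_Mapping.keys (f * g)"
  then obtain \<alpha> \<beta> where "\<alpha> \<in> Poly_Mapping.keys f" "\<beta> \<in> Poly_Mapping.keys g" "\<gamma> = \<alpha> + \<beta>"
    using keys_mult[of f g] by blast
  then show "Poly_Mapping.keys \<gamma> \<subseteq> I"
    using assms keys_add[of \<alpha> \<beta>] by (fastforce simp: cpolys_def)
qed

lemma cpolys_sum: "(\<And>i. i \<in> S \<Longrightarrow> f i \<in> cpolys I) \<Longrightarrow> (\<Sum>i\<in>S. f i) \<in> cpolys I"
  by (induction S rule: infinite_finite_induct) (auto intro: cpolys_add)

lemma cpolys_prod: "(\<And>i. i \<in> S \<Longrightarrow> f i \<in> cpolys I) \<Longrightarrow> (\<Prod>i\<in>S. f i) \<in> cpolys I"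
  by (induction S rule: infinite_finite_induct) (auto intro: cpolys_mult)

lemma cpolys_of_nat: "of_nat n \<in> cpolys I"
  by (induction n) (auto intro: cpolys_add)

lemma ceval_cpolys:
  assumes "f \<in> cpolys I" "finite I"
  shows "ceval f v = (\<Sum>\<alpha>\<in>Poly_Mapping.keys f. Poly_Mapping.lookup f \<alpha> * (\<Prod>i\<in>I. v i ^ Poly_Mapping.lookup \<alpha> i))"
  unfolding ceval_def' using assms by (intro sum.cong refl) (auto simp: cpolys_def meval_superset)

definition tdeg :: "(nat \<Rightarrow>\<^sub>0 nat) \<Rightarrow> nat" where
  "tdeg \<alpha> = (\<Sum>i\<in>Poly_Mapping.keys \<alpha>. Poly_Mapping.lookup \<alpha> i)"

lemma tdeg_superset:
  assumes "finite S" "Poly_Mapping.keys \<alpha> \<subseteq> S"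
  shows "tdeg \<alpha> = (\<Sum>i\<in>S. Poly_Mapping.lookup \<alpha> i)"
  unfolding tdeg_def using assms by (intro sum.mono_neutral_left) (auto simp: in_keys_iff)

lemma tdeg_add: "tdeg (\<alpha> + \<beta>) = tdeg \<alpha> + tdeg \<beta>"
proof -
  let ?S = "Poly_Mapping.keys \<alpha> \<union> Poly_Mapping.keys \<beta>"
  have "tdeg (\<alpha> + \<beta>) = (\<Sum>i\<in>?S. Poly_Mapping.lookup (\<alpha> + \<beta>) i)"
    by (rule tdeg_superset) (auto simp: in_keys_iff lookup_add)
  also have "\<dots> = tdeg \<alpha> + tdeg \<beta>"
    by (simp add: tdeg_superset[of ?S] lookup_add sum.distrib)
  finally show ?thesis .
qed

lemma homogeneous_def': "homogeneous k f \<longleftrightarrow> (\<forall>\<alpha>\<in>Poly_Mapping.keys f. tdeg \<alpha> = k)"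
  by (simp add: homogeneous_def tdeg_def)

lemma homogeneous_0 [simp]: "homogeneous k 0"
  by (simp add: homogeneous_def)

lemma homogeneous_1: "homogeneous 0 1"
  by (auto simp: homogeneous_def' tdeg_def)

lemma homogeneous_pvar: "homogeneous 1 (pvar i)"
  by (auto simp: homogeneous_def' pvar_def tdeg_def)

lemma homogeneous_add: "homogeneous k f \<Longrightarrow> homogeneous k g \<Longrightarrow> homogeneous k (f + g)"
  using keys_add[of f g] by (auto simp: homogeneous_def')

lemma homogeneous_uminus: "homogeneous k f \<Longrightarrow> homogeneous k (- f)"
  by (auto simp: homogeneous_def' in_keys_iff)

lemma homogeneous_diff: "homogeneous k f \<Longrightarrow> homogeneous k g \<Longrightarrow> homogeneous k (f - g)"
  using homogeneous_add[of k f "- g"] homogeneous_uminus[of k g] by simp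

lemma homogeneous_mult:
  assumes "homogeneous k f" "homogeneous l g"
  shows "homogeneous (k + l) (f * g)"
  unfolding homogeneous_def'
proof
  fix \<gamma> assume "\<gamma> \<in> Poly_Mapping.keys (f * g)"
  then obtain \<alpha> \<beta> where "\<alpha> \<in> Poly_Mapping.keys f" "\<beta> \<in> Poly_Mapping.keys g" "\<gamma> = \<alpha> + \<beta>"
    using keys_mult[of f g] by blast
  then show "tdeg \<gamma> = k + l" using assms by (auto simp: homogeneous_def' tdeg_add)
qed

lemma homogeneous_of_nat_mult: "homogeneous k f \<Longrightarrow> homogeneous k (of_nat n * f)"
  by (induction n) (auto simp: distrib_right intro: homogeneous_add)

lemma homogeneous_sum: "(\<And>i. i \<in> S \<Longrightarrow> homogeneous k (f i)) \<Longrightarrow> homogeneous k (\<Sum>i\<in>S. f i)"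
  by (induction S rule: infinite_finite_induct) (auto intro: homogeneous_add)

lemma homogeneous_prod:
  assumes "finite S" "\<And>i. i \<in> S \<Longrightarrow> homogeneous 1 (f i)"
  shows "homogeneous (card S) (\<Prod>i\<in>S. f i)"
  using assms
proof (induction S rule: finite_induct)
  case (insert i S)
  then show ?case using homogeneous_mult[of 1 "f i" "card S" "\<Prod>i\<in>S. f i"] by simp
qed (simp add: homogeneous_1)

lemma ceval_scale:
  assumes "homogeneous k f"
  shows "ceval f (\<lambda>i. c * v i) = c ^ k * ceval f v"
proof -
  have "meval \<alpha> (\<lambda>i. c * v i) = c ^ k * meval \<alpha> v" if "\<alpha> \<in> Poly_Mapping.keys f" for \<alpha>
    using assms that
    by (auto simp: meval_def power_mult_distrib prod.distrib homogeneous_def' tdeg_def simp flip: power_sum)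
  then show ?thesis by (simp add: ceval_def' sum_distrib_left ac_simps)
qed

lemma ceval_tendsto:
  assumes "\<And>i. ((\<lambda>t. \<gamma> t i) \<longlongrightarrow> v i) F"
  shows "((\<lambda>t. ceval f (\<gamma> t)) \<longlongrightarrow> ceval f v) F"
  unfolding ceval_def by (intro tendsto_intros assms)

text \<open>The derivative along a curve depends on the velocity only.\<close>

lemma ceval_derivative:
  "\<exists>D. \<forall>\<gamma> w. \<gamma> 0 = p \<longrightarrow> (\<forall>i. ((\<lambda>t. \<gamma> t i) has_field_derivative w i) (at 0)) \<longrightarrow>
     ((\<lambda>t. ceval f (\<gamma> t)) has_field_derivative D w) (at 0)"
proof (intro exI allI impI)
  fix \<gamma> :: "complex \<Rightarrow> nat \<Rightarrow> complex" and w
  assume \<gamma>: "\<gamma> 0 = p" "\<forall>i. ((\<lambda>t. \<gamma> t i) has_field_derivative w i) (at 0)"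
  show "((\<lambda>t. ceval f (\<gamma> t)) has_field_derivative
      (\<Sum>\<alpha>\<in>Poly_Mapping.keys f. Poly_Mapping.lookup f \<alpha> * (\<Sum>i\<in>Poly_Mapping.keys \<alpha>.
        (of_nat (Poly_Mapping.lookup \<alpha> i) * (w i * p i ^ (Poly_Mapping.lookup \<alpha> i - Suc 0))) *
        (\<Prod>j\<in>Poly_Mapping.keys \<alpha> - {i}. p j ^ Poly_Mapping.lookup \<alpha> j)))) (at 0)"
    unfolding ceval_def
    by (rule DERIV_sum, rule DERIV_cmult, rule has_field_derivative_prod[THEN DERIV_cong])
       (use \<gamma> in \<open>auto intro!: DERIV_power\<close>)
qed

lemma ceval_poly:
  assumes "\<And>i. \<exists>p. \<forall>x. \<gamma> x i = poly p x"
  shows "\<exists>p. \<forall>x. ceval f (\<gamma> x) = poly p x"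
proof -
  obtain p where "\<And>i x. \<gamma> x i = poly (p i) x" using assms by metis
  then have "ceval f (\<gamma> x) = poly (\<Sum>\<alpha>\<in>Poly_Mapping.keys f. Polynomial.smult (Poly_Mapping.lookup f \<alpha>)
      (\<Prod>i\<in>Poly_Mapping.keys \<alpha>. p i ^ Poly_Mapping.lookup \<alpha> i)) x" for x
    by (simp add: ceval_def poly_sum poly_prod)
  then show ?thesis by blast
qed

section \<open>Closed sets and irreducible sets in homogeneous coordinates\<close>

lemma hcoords_scale: "v \<in> hcoords I \<Longrightarrow> c \<noteq> 0 \<Longrightarrow> (\<lambda>i. c * v i) \<in> hcoords I"
  by (auto simp: hcoords_def fun_eq_iff)

lemma hcoords_nonzero: "v \<in> hcoords I \<Longrightarrow> \<exists>i\<in>I. v i \<noteq> 0"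
  by (auto simp: hcoords_def fun_eq_iff)

lemma proj_closed_proj_zeros:
  "(\<And>f. f \<in> F \<Longrightarrow> f \<in> cpolys I \<and> (\<exists>k. homogeneous k f)) \<Longrightarrow> proj_closed I (proj_zeros I F)"
  unfolding proj_closed_def by (intro exI[of _ F]) auto

lemma proj_closed_scale:
  assumes "proj_closed I Z" "v \<in> Z" "c \<noteq> 0"
  shows "(\<lambda>i. c * v i) \<in> Z"
proof -
  obtain F where F: "\<And>f. f \<in> F \<Longrightarrow> \<exists>k. homogeneous k f" "Z = proj_zeros I F"
    using assms(1) unfolding proj_closed_def by blast
  have "ceval f (\<lambda>i. c * v i) = 0" if "f \<in> F" for f
    using F(1)[OF that] assms(2) that ceval_scale[of _ f c v] by (auto simp: F(2) proj_zeros_def)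
  then show ?thesis using assms F(2) hcoords_scale by (auto simp: proj_zeros_def)
qed

lemma proj_closed_empty: "proj_closed I {}"
proof -
  have "proj_zeros I {1} = {}" by (simp add: proj_zeros_def)
  then show ?thesis
    using proj_closed_proj_zeros[of "{1}" I] homogeneous_1 by fastforce
qed

lemma proj_closed_Int:
  assumes "proj_closed I Z" "proj_closed I Z'"
  shows "proj_closed I (Z \<inter> Z')"
proof -
  obtain F F' where F: "F \<subseteq> {f \<in> cpolys I. \<exists>k. homogeneous k f}" "Z = proj_zeros I F"
    "F' \<subseteq> {f \<in> cpolys I. \<exists>k. homogeneous k f}" "Z' = proj_zeros I F'"
    using assms unfolding proj_closed_def by blast
  have "Z \<inter> Z' = proj_zeros I (F \<union> F')" unfolding F by (auto simp: proj_zeros_def)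
  then show ?thesis
    unfolding proj_closed_def using F(1,3) by (intro exI[of _ "F \<union> F'"] conjI Un_least)
qed

lemma proj_closed_Un:
  assumes "proj_closed I Z" "proj_closed I Z'"
  shows "proj_closed I (Z \<union> Z')"
proof -
  obtain F F' where F: "F \<subseteq> {f \<in> cpolys I. \<exists>k. homogeneous k f}" "Z = proj_zeros I F"
    "F' \<subseteq> {f \<in> cpolys I. \<exists>k. homogeneous k f}" "Z' = proj_zeros I F'"
    using assms unfolding proj_closed_def by blast
  have "Z \<union> Z' = proj_zeros I {f * f' | f f'. f \<in> F \<and> f' \<in> F'}" (is "_ = proj_zeros I ?G")
  proof (intro equalityI subsetI)
    fix v assume "v \<in> proj_zeros I ?G"
    then have "v \<in> hcoords I" and *: "\<And>f f'. f \<in> F \<Longrightarrow> f' \<in> F' \<Longrightarrow> ceval f v = 0 \<or> ceval f' v = 0"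
      by (force simp: proj_zeros_def ceval_mult)+
    then show "v \<in> Z \<union> Z'" unfolding F by (auto simp: proj_zeros_def)
  qed (auto simp: F proj_zeros_def ceval_mult)
  moreover have "proj_closed I (proj_zeros I ?G)"
    using F(1,3) by (intro proj_closed_proj_zeros) (blast intro: cpolys_mult homogeneous_mult)
  ultimately show ?thesis by simp
qed

lemma proj_closure_eq: "proj_closed I Z \<Longrightarrow> proj_closure I Z = Z"
  unfolding proj_closure_def by blast

text \<open>Projective sets are encoded by all their homogeneous coordinate vectors, so a single
  point is a punctured line.\<close>

definition ppoint :: "(nat \<Rightarrow> complex) \<Rightarrow> (nat \<Rightarrow> complex) set" where
  "ppoint p = {v. \<exists>c. c \<noteq> 0 \<and> v = (\<lambda>i. c * p i)}"

lemma ppoint_self: "p \<in> ppoint p"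
  by (auto simp: ppoint_def intro!: exI[of _ 1])

lemma ppoint_eq: "q \<in> ppoint p \<Longrightarrow> ppoint q = ppoint p"
  unfolding ppoint_def
proof safe
  fix c d :: complex assume "c \<noteq> 0" "d \<noteq> 0"
  then show "\<exists>e. e \<noteq> 0 \<and> (\<lambda>i. d * (c * p i)) = (\<lambda>i. e * p i)"
    by (intro exI[of _ "d * c"]) (auto simp: mult.assoc)
  show "\<exists>e. e \<noteq> 0 \<and> (\<lambda>i. d * p i) = (\<lambda>i. e * (c * p i))"
    using \<open>c \<noteq> 0\<close> \<open>d \<noteq> 0\<close> by (intro exI[of _ "d / c"]) (auto simp: mult.assoc)
qed

lemma ppoint_subset: "proj_closed I Z \<Longrightarrow> p \<in> Z \<Longrightarrow> ppoint p \<subseteq> Z"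
  by (auto simp: ppoint_def intro: proj_closed_scale)

text \<open>The equations are the 2 by 2 minors of the matrix with rows p and v.\<close>

lemma proj_closed_ppoint:
  assumes p: "p \<in> hcoords I"
  shows "proj_closed I (ppoint p)"
proof -
  let ?q = "\<lambda>i j. Poly_Mapping.single 0 (p i) * pvar j - Poly_Mapping.single 0 (p j) * pvar i"
  let ?F = "{?q i j | i j. i \<in> I \<and> j \<in> I}"
  have "homogeneous 0 (Poly_Mapping.single 0 c)" for c :: complex
    by (simp add: homogeneous_def' tdeg_def)
  from homogeneous_mult[OF this homogeneous_pvar]
  have "homogeneous (0 + 1) (?q i j)" for i j by (intro homogeneous_diff)
  moreover have "?q i j \<in> cpolys I" if "i \<in> I" "j \<in> I" for i j
    using that by (intro cpolys_diff cpolys_mult cpolys_single cpolys_pvar) auto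
  ultimately have "proj_closed I (proj_zeros I ?F)"
    by (intro proj_closed_proj_zeros) blast
  moreover have "proj_zeros I ?F = ppoint p"
  proof (intro equalityI subsetI)
    fix v assume "v \<in> proj_zeros I ?F"
    then have v: "v \<in> hcoords I" and "\<forall>i\<in>I. \<forall>j\<in>I. ceval (?q i j) v = 0"
      by (auto simp: proj_zeros_def)
    then have eq: "p i * v j = p j * v i" if "i \<in> I" "j \<in> I" for i j
      using that by (simp add: ceval_diff ceval_mult ceval_single)
    obtain k where k: "k \<in> I" "p k \<noteq> 0" using hcoords_nonzero[OF p] by blast
    define c where "c = v k / p k"
    have vc: "v i = c * p i" for i
    proof (cases "i \<in> I")
      case True
      then show ?thesis using eq[OF k(1) True] k(2) by (simp add: c_def field_simps)
    next
      case False
      then show ?thesis using v p by (simp add: hcoords_def)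
    qed
    moreover have "c \<noteq> 0" using vc hcoords_nonzero[OF v] by auto
    ultimately show "v \<in> ppoint p" unfolding ppoint_def by blast
  next
    fix v assume "v \<in> ppoint p"
    then show "v \<in> proj_zeros I ?F"
      using hcoords_scale[OF p] by (auto simp: ppoint_def proj_zeros_def ceval_diff ceval_mult ceval_single)
  qed
  ultimately show ?thesis by simp
qed

lemma proj_irreducible_ppoint:
  assumes "p \<in> hcoords I"
  shows "proj_irreducible I (ppoint p)"
  unfolding proj_irreducible_def
proof (intro conjI allI impI)
  fix Z1 Z2 assume Z: "proj_closed I Z1 \<and> proj_closed I Z2 \<and> ppoint p = Z1 \<union> Z2"
  then consider "p \<in> Z1" | "p \<in> Z2" using ppoint_self by blast
  then show "ppoint p = Z1 \<or> ppoint p = Z2"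
    using Z ppoint_subset[of I Z1 p] ppoint_subset[of I Z2 p] by cases blast+
qed (use assms ppoint_self proj_closed_ppoint in blast)+

lemma proj_irreducible_subset_finite_union:
  assumes "proj_irreducible I C" "finite B" "\<And>p. p \<in> B \<Longrightarrow> proj_closed I (Z p)" "C \<subseteq> (\<Union>p\<in>B. Z p)"
  shows "\<exists>p\<in>B. C \<subseteq> Z p"
  using assms(2-4)
proof (induction B rule: finite_induct)
  case empty
  with assms(1) show ?case by (auto simp: proj_irreducible_def)
next
  case (insert p B)
  have "proj_closed I (\<Union>p\<in>B. Z p)" if "finite B" "\<And>p. p \<in> B \<Longrightarrow> proj_closed I (Z p)" for B
    using that by (induction B rule: finite_induct) (auto intro: proj_closed_empty proj_closed_Un)
  then have "proj_closed I (\<Union>p\<in>B. Z p)" using insert by blast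
  moreover have C: "proj_closed I C" using assms(1) by (simp add: proj_irreducible_def)
  ultimately have "proj_closed I (C \<inter> Z p)" "proj_closed I (C \<inter> (\<Union>p\<in>B. Z p))"
    using insert.prems by (auto intro: proj_closed_Int)
  moreover have "C = (C \<inter> Z p) \<union> (C \<inter> (\<Union>p\<in>B. Z p))" using insert.prems by blast
  ultimately have "C = C \<inter> Z p \<or> C = C \<inter> (\<Union>p\<in>B. Z p)"
    using assms(1) unfolding proj_irreducible_def by blast
  then show ?case using insert.IH insert.prems by blast
qed

section \<open>The rational normal curve\<close>

text \<open>The common factor x^a of the monomials x^i y^(d - i) is divided out. This removes their
  common zero when a > 0 and gives the rational normal curve of degree d - a.\<close>

definition rnc :: "nat \<Rightarrow> nat \<Rightarrow> complex \<Rightarrow> complex \<Rightarrow> nat \<Rightarrow> complex" where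
  "rnc a d x y i = (if i \<in> {a..d} then x ^ (i - a) * y ^ (d - i) else 0)"

definition rnc_cone :: "nat \<Rightarrow> nat \<Rightarrow> (nat \<Rightarrow> complex) set" where
  "rnc_cone a d = {v \<in> hcoords {a..d}. \<exists>c x y. v = (\<lambda>i. c * rnc a d x y i)}"

text \<open>A 2 by 2 minor of the matrix with rows v_a, ..., v_(d-1) and v_(a+1), ..., v_d.\<close>

definition quadric :: "nat \<Rightarrow> nat \<Rightarrow> cmpoly" where
  "quadric i j = pvar i * pvar (Suc j) - pvar (Suc i) * pvar j"

lemma ceval_quadric: "ceval (quadric i j) v = v i * v (Suc j) - v (Suc i) * v j"
  by (simp add: quadric_def ceval_diff ceval_mult)

lemma quadric_cpolys: "i \<in> {a..<d} \<Longrightarrow> j \<in> {a..<d} \<Longrightarrow> quadric i j \<in> cpolys {a..d}"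
  unfolding quadric_def by (intro cpolys_diff cpolys_mult cpolys_pvar) auto

lemma homogeneous_quadric: "homogeneous 2 (quadric i j)"
  unfolding quadric_def one_add_one[symmetric]
  by (intro homogeneous_diff homogeneous_mult homogeneous_pvar)

lemma rnc_hcoords: "a \<le> d \<Longrightarrow> x \<noteq> 0 \<or> y \<noteq> 0 \<Longrightarrow> rnc a d x y \<in> hcoords {a..d}"
proof -
  assume "a \<le> d" "x \<noteq> 0 \<or> y \<noteq> 0"
  then have "rnc a d x y d \<noteq> 0 \<or> rnc a d x y a \<noteq> 0" by (auto simp: rnc_def)
  then have "rnc a d x y \<noteq> (\<lambda>_. 0)" by metis
  then show ?thesis by (auto simp: hcoords_def rnc_def)
qed

lemma rnc_outside: "i \<notin> {a..d} \<Longrightarrow> rnc a d x y i = 0"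
  by (auto simp: rnc_def)

lemma rnc_affine: "rnc a d z 1 i = (if i \<in> {a..d} then z ^ (i - a) else 0)"
  by (simp add: rnc_def)

lemma rnc_infinity: "rnc a d 1 0 i = (if i = d \<and> a \<le> d then 1 else 0)"
  by (auto simp: rnc_def)

lemma rnc_Suc: "i \<in> {a..<d} \<Longrightarrow> y * rnc a d x y (Suc i) = x * rnc a d x y i"
proof -
  assume i: "i \<in> {a..<d}"
  then have "d - i = Suc (d - Suc i)" "Suc i - a = Suc (i - a)" by auto
  with i show ?thesis by (simp add: rnc_def)
qed

text \<open>Both rows are proportional: y v_(k+1) = x v_k. This yields the equation multiplied by y
  as well as by x, and if both are 0 then so is v.\<close>

lemma rnc_cone_quadric:
  assumes "v \<in> rnc_cone a d" "i \<in> {a..<d}" "j \<in> {a..<d}"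
  shows "v i * v (Suc j) = v (Suc i) * v j"
proof -
  obtain c x y where v: "v = (\<lambda>i. c * rnc a d x y i)" using assms(1) by (auto simp: rnc_cone_def)
  have vs: "y * v (Suc k) = x * v k" if "k \<in> {a..<d}" for k
    using rnc_Suc[OF that, of y x] by (simp add: v)
  have y: "y * (v i * v (Suc j)) = y * (v (Suc i) * v j)"
  proof -
    have "y * (v i * v (Suc j)) = v i * (x * v j)" by (simp flip: vs[OF assms(3)])
    also have "\<dots> = (x * v i) * v j" by simp
    also have "\<dots> = y * (v (Suc i) * v j)" by (simp flip: vs[OF assms(2)])
    finally show ?thesis .
  qed
  have x: "x * (v i * v (Suc j)) = x * (v (Suc i) * v j)"
  proof -
    have "x * (v i * v (Suc j)) = (y * v (Suc i)) * v (Suc j)" by (simp add: vs[OF assms(2)])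
    also have "\<dots> = v (Suc i) * (y * v (Suc j))" by simp
    also have "\<dots> = x * (v (Suc i) * v j)" by (simp add: vs[OF assms(3)])
    finally show ?thesis .
  qed
  show ?thesis
  proof (cases "x = 0 \<and> y = 0")
    case True
    then have "v = (\<lambda>_. 0)" using assms(2) by (auto simp: v rnc_def fun_eq_iff)
    then show ?thesis by simp
  qed (use x y in auto)
qed

text \<open>If v_a is nonzero, the quadrics that involve a make v a geometric progression. Otherwise
  v_k v_(k+2) = v_(k+1)^2 propagates the zero up to index d - 1, and only the point at infinity is
  left.\<close>

lemma quadrics_imp_rnc:
  assumes "v \<in> hcoords {a..d}" "\<And>i j. i \<in> {a..<d} \<Longrightarrow> j \<in> {a..<d} \<Longrightarrow> v i * v (Suc j) = v (Suc i) * v j"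
  obtains c z where "c \<noteq> 0" "v = (\<lambda>i. c * rnc a d z 1 i)"
  | c where "c \<noteq> 0" "v = (\<lambda>i. c * rnc a d 1 0 i)"
proof (cases "v a = 0")
  case False
  have out: "v i = 0" if "i \<notin> {a..d}" for i using assms(1) that by (auto simp: hcoords_def)
  define z where "z = v (Suc a) / v a"
  have "v (a + k) = v a * z ^ k" if "a + k \<le> d" for k
    using that
  proof (induction k)
    case (Suc k)
    then have "v a * v (Suc (a + k)) = v (Suc a) * v (a + k)" by (intro assms(2)) auto
    then have "v (a + Suc k) = z * v (a + k)" using False by (simp add: z_def field_simps)
    with Suc show ?case by simp
  qed simp
  then have vi: "v i = v a * rnc a d z 1 i" for i
    using out[of i] by (cases "i \<in> {a..d}") (auto simp: rnc_affine dest!: le_Suc_ex)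
  have "v = (\<lambda>i. v a * rnc a d z 1 i)" using vi by (rule ext)
  with False show ?thesis by (rule that(1))
next
  case True
  have out: "v i = 0" if "i \<notin> {a..d}" for i using assms(1) that by (auto simp: hcoords_def)
  have "v (a + k) = 0" if "a + k < d" for k
    using that
  proof (induction k)
    case (Suc k)
    then have "v (a + k) * v (Suc (a + Suc k)) = v (Suc (a + k)) * v (a + Suc k)" by (intro assms(2)) auto
    with Suc show ?case by simp
  qed (use True in simp)
  then have vi: "v i = v d * rnc a d 1 0 i" for i
    using out[of i] by (cases "i \<in> {a..d}"; cases "i = d") (auto simp: rnc_infinity dest!: le_Suc_ex)
  obtain i where "v i \<noteq> 0" using hcoords_nonzero[OF assms(1)] by blast
  then have "v d \<noteq> 0" using vi[of i] by force
  moreover have "v = (\<lambda>i. v d * rnc a d 1 0 i)" using vi by (rule ext)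
  ultimately show ?thesis by (rule that(2))
qed

lemma rnc_cone_cases:
  assumes "v \<in> rnc_cone a d"
  obtains c z where "c \<noteq> 0" "v = (\<lambda>i. c * rnc a d z 1 i)"
  | c where "c \<noteq> 0" "v = (\<lambda>i. c * rnc a d 1 0 i)"
  by (rule quadrics_imp_rnc[of v a d])
     (use assms rnc_cone_quadric[OF assms] that in \<open>auto simp: rnc_cone_def\<close>)

lemma rnc_cone_eq: "rnc_cone a d = proj_zeros {a..d} {quadric i j | i j. i \<in> {a..<d} \<and> j \<in> {a..<d}}"
proof (intro equalityI subsetI)
  fix v assume v: "v \<in> rnc_cone a d"
  then have "v \<in> hcoords {a..d}" by (simp add: rnc_cone_def)
  then show "v \<in> proj_zeros {a..d} {quadric i j | i j. i \<in> {a..<d} \<and> j \<in> {a..<d}}"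
    by (auto simp: proj_zeros_def ceval_quadric rnc_cone_quadric[OF v])
next
  fix v assume "v \<in> proj_zeros {a..d} {quadric i j | i j. i \<in> {a..<d} \<and> j \<in> {a..<d}}"
  then have v: "v \<in> hcoords {a..d}" and "\<And>i j. i \<in> {a..<d} \<Longrightarrow> j \<in> {a..<d} \<Longrightarrow> ceval (quadric i j) v = 0"
    unfolding proj_zeros_def by blast+
  then have "\<And>i j. i \<in> {a..<d} \<Longrightarrow> j \<in> {a..<d} \<Longrightarrow> v i * v (Suc j) = v (Suc i) * v j"
    by (simp add: ceval_quadric)
  then show "v \<in> rnc_cone a d"
    by (rule quadrics_imp_rnc[OF v]) (use v in \<open>auto simp: rnc_cone_def\<close>)
qed

lemma proj_closed_rnc_cone: "proj_closed {a..d} (rnc_cone a d)"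
  unfolding rnc_cone_eq by (rule proj_closed_proj_zeros) (use quadric_cpolys homogeneous_quadric in blast)

lemma rnc_cone_mem: "a \<le> d \<Longrightarrow> c \<noteq> 0 \<Longrightarrow> x \<noteq> 0 \<or> y \<noteq> 0 \<Longrightarrow> (\<lambda>i. c * rnc a d x y i) \<in> rnc_cone a d"
  unfolding rnc_cone_def using hcoords_scale[OF rnc_hcoords] by blast

lemma rnc_mem: "a \<le> d \<Longrightarrow> x \<noteq> 0 \<or> y \<noteq> 0 \<Longrightarrow> rnc a d x y \<in> rnc_cone a d"
  using rnc_cone_mem[of a d 1 x y] by simp

text \<open>The parametrisation by x^i y^(d - i) reaches all points except possibly the one with z =
  0, and the larger set is already closed.\<close>

lemma monomial_curve_eq:
  assumes "a \<le> d"
  shows "monomial_curve {a..d} = rnc_cone a d"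
proof -
  let ?S = "{v \<in> hcoords {a..d}. \<exists>c x y. \<forall>i\<in>{a..d}. v i = c * (x ^ i * y ^ (Max {a..d} - i))}"
  have M: "Max {a..d} = d" using assms by (intro Max_eqI) auto
  have S: "(\<lambda>i. c * rnc a d x y i) \<in> ?S" if "(\<lambda>i. c * rnc a d x y i) \<in> hcoords {a..d}" "x \<noteq> 0" for c x y
  proof -
    have "c * rnc a d x y i = c / x ^ a * (x ^ i * y ^ (d - i))" if "i \<in> {a..d}" for i
      using that \<open>x \<noteq> 0\<close> by (auto simp: rnc_def power_diff)
    then show ?thesis using that(1) unfolding M by blast
  qed
  have "?S \<subseteq> rnc_cone a d"
  proof
    fix v assume "v \<in> ?S"
    then obtain c x y where v: "v \<in> hcoords {a..d}" "\<And>i. i \<in> {a..d} \<Longrightarrow> v i = c * (x ^ i * y ^ (d - i))"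
      unfolding M by blast
    have "v i = (c * x ^ a) * rnc a d x y i" for i
    proof (cases "i \<in> {a..d}")
      case True
      then have "x ^ i = x ^ a * x ^ (i - a)" by (simp flip: power_add)
      with True v(2) show ?thesis by (simp add: rnc_def)
    next
      case False
      then show ?thesis using v(1) by (auto simp: hcoords_def rnc_def)
    qed
    then have "v = (\<lambda>i. (c * x ^ a) * rnc a d x y i)" by (rule ext)
    with v(1) show "v \<in> rnc_cone a d" unfolding rnc_cone_def by blast
  qed
  moreover have "rnc_cone a d \<subseteq> Z" if Z: "proj_closed {a..d} Z" "?S \<subseteq> Z" for Z
  proof
    fix v assume "v \<in> rnc_cone a d"
    then have v: "v \<in> hcoords {a..d}" by (simp add: rnc_cone_def)
    show "v \<in> Z" using \<open>v \<in> rnc_cone a d\<close>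
    proof (cases rule: rnc_cone_cases)
      case (1 c z)
      show ?thesis
      proof (cases "z = 0")
        case False
        then have "v \<in> ?S" using S[of c z 1] 1 v by simp
        then show ?thesis using Z(2) by blast
      next
        \<comment> \<open>For a > 0 this point is not parametrised. It is the limit of the points
          with s \<noteq> 0, and the equations of \<open>Z\<close> are continuous.\<close>
        case True
        obtain F where F: "F \<subseteq> {f \<in> cpolys {a..d}. \<exists>k. homogeneous k f}" "Z = proj_zeros {a..d} F"
          using Z(1) unfolding proj_closed_def by blast
        have "ceval f v = 0" if f: "f \<in> F" for f
        proof -
          have "(\<lambda>i. c * rnc a d s 1 i) \<in> Z" if "s \<noteq> 0" for s
            using S[of c s 1] that Z(2) rnc_cone_mem[OF assms 1(1), of s 1] by (auto simp: rnc_cone_def)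
          then have ev: "\<forall>\<^sub>F s in at 0. ceval f (\<lambda>i. c * rnc a d s 1 i) = 0"
            using f unfolding F(2) by (auto simp: eventually_at_filter proj_zeros_def)
          have lim: "((\<lambda>s. ceval f (\<lambda>i. c * rnc a d s 1 i)) \<longlongrightarrow> ceval f (\<lambda>i. c * rnc a d 0 1 i)) (at 0)"
            by (rule ceval_tendsto) (auto simp: rnc_def intro!: tendsto_intros)
          have "ceval f (\<lambda>i. c * rnc a d 0 1 i) = 0"
            by (rule tendsto_unique[OF trivial_limit_at lim tendsto_eventually[OF ev]])
          then show ?thesis using 1 True by simp
        qed
        then show ?thesis unfolding F(2) proj_zeros_def using v by blast
      qed
    next
      case (2 c)
      then have "v \<in> ?S" using S[of c 1 0] v by simp
      then show ?thesis using Z(2) by blast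
    qed
  qed
  ultimately show ?thesis
    unfolding monomial_curve_def proj_closure_def using proj_closed_rnc_cone[of a d]
    by (intro antisym Inter_lower Inter_greatest) auto
qed

text \<open>On the affine chart f is a polynomial in z, which vanishes identically if it has
  infinitely many zeros; the point at infinity follows by continuity. Consequently a proper closed
  subset of the curve is finite, which yields both irreducibility and dimension.\<close>

lemma rnc_vanishing:
  assumes "a < d" "homogeneous k f" "infinite {z. ceval f (rnc a d z 1) = 0}" "v \<in> rnc_cone a d"
  shows "ceval f v = 0"
proof -
  have "\<exists>p. \<forall>x. rnc a d x 1 i = poly p x" for i
    unfolding rnc_affine
    by (cases "i \<in> {a..d}") (auto simp: poly_monom intro: exI[of _ 0] exI[of _ "Polynomial.monom 1 (i - a)"])
  from ceval_poly[of "\<lambda>x. rnc a d x 1" f, OF this]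
  obtain p where p: "\<And>x. ceval f (rnc a d x 1) = poly p x" by blast
  then have "p = 0" using assms(3) poly_roots_finite[of p] by auto
  with p have zero: "ceval f (rnc a d x 1) = 0" for x by simp
  have "ceval f (rnc a d 1 s) = 0" if "s \<noteq> 0" for s
  proof -
    \<comment> \<open>The change of chart z = 1 / s; homogeneity of f absorbs the factor s^(d -
      a).\<close>
    have "rnc a d 1 s = (\<lambda>i. s ^ (d - a) * rnc a d (1 / s) 1 i)"
    proof
      fix i
      have "s ^ (d - i) = s ^ (d - a) * (1 / s) ^ (i - a)" if "i \<in> {a..d}"
        using that \<open>s \<noteq> 0\<close> by (simp add: power_one_over field_simps flip: power_add)
      then show "rnc a d 1 s i = s ^ (d - a) * rnc a d (1 / s) 1 i" by (simp add: rnc_def)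
    qed
    then show ?thesis using ceval_scale[OF assms(2), of "s ^ (d - a)" "rnc a d (1 / s) 1"] zero by simp
  qed
  then have ev: "\<forall>\<^sub>F s in at 0. ceval f (rnc a d 1 s) = 0" by (auto simp: eventually_at_filter)
  have lim: "((\<lambda>s. ceval f (rnc a d 1 s)) \<longlongrightarrow> ceval f (rnc a d 1 0)) (at 0)"
    by (rule ceval_tendsto) (auto simp: rnc_def intro!: tendsto_intros)
  have inf: "ceval f (rnc a d 1 0) = 0"
    by (rule tendsto_unique[OF trivial_limit_at lim tendsto_eventually[OF ev]])
  show ?thesis using assms(4)
    by (cases rule: rnc_cone_cases) (auto simp: ceval_scale[OF assms(2)] zero inf)
qed

lemma proj_irreducible_rnc_cone:
  assumes "a < d"
  shows "proj_irreducible {a..d} (rnc_cone a d)"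
  unfolding proj_irreducible_def
proof (intro conjI allI impI)
  show "rnc_cone a d \<noteq> {}" using rnc_mem[of a d 1 1] assms by auto
  fix Z1 Z2 assume Z: "proj_closed {a..d} Z1 \<and> proj_closed {a..d} Z2 \<and> rnc_cone a d = Z1 \<union> Z2"
  show "rnc_cone a d = Z1 \<or> rnc_cone a d = Z2"
  proof (rule ccontr)
    assume "\<not> ?thesis"
    then obtain v1 v2 where v: "v1 \<in> rnc_cone a d" "v1 \<notin> Z1" "v2 \<in> rnc_cone a d" "v2 \<notin> Z2"
      using Z by blast
    \<comment> \<open>Each of the two proper closed subsets contains only finitely many affine
      points, so they cannot cover the infinite field.\<close>
    have fin: "finite {z. rnc a d z 1 \<in> Z'}" if Z': "proj_closed {a..d} Z'" "v \<in> rnc_cone a d" "v \<notin> Z'" for Z' v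
    proof -
      obtain F where F: "F \<subseteq> {f \<in> cpolys {a..d}. \<exists>k. homogeneous k f}" "Z' = proj_zeros {a..d} F"
        using Z'(1) unfolding proj_closed_def by blast
      obtain f where f: "f \<in> F" "ceval f v \<noteq> 0" using Z' unfolding F(2) by (auto simp: proj_zeros_def rnc_cone_def)
      obtain k where "homogeneous k f" using f(1) F(1) by blast
      then have "finite {z. ceval f (rnc a d z 1) = 0}"
        using rnc_vanishing[OF assms _ _ Z'(2)] f(2) by blast
      then show ?thesis by (rule rev_finite_subset) (use f(1) F(2) in \<open>auto simp: proj_zeros_def\<close>)
    qed
    have "rnc a d z 1 \<in> Z1 \<union> Z2" for z using Z rnc_mem[of a d z 1] assms by auto
    then have "UNIV = {z. rnc a d z 1 \<in> Z1} \<union> {z. rnc a d z 1 \<in> Z2}" by blast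
    moreover have "finite \<dots>" using fin Z v by blast
    ultimately show False using infinite_UNIV_char_0[where 'a = complex] by simp
  qed
qed (rule proj_closed_rnc_cone)

lemma proj_irreducible_subset_rnc_cone:
  assumes "a < d" "proj_irreducible {a..d} C" "C \<subseteq> rnc_cone a d" "C \<noteq> rnc_cone a d"
  shows "\<exists>p. C = ppoint p"
proof -
  have C: "proj_closed {a..d} C" "C \<noteq> {}" using assms(2) by (auto simp: proj_irreducible_def)
  obtain F where F: "F \<subseteq> {f \<in> cpolys {a..d}. \<exists>k. homogeneous k f}" "C = proj_zeros {a..d} F"
    using C(1) unfolding proj_closed_def by blast
  obtain v where v: "v \<in> rnc_cone a d" "v \<notin> C" using assms by blast
  then obtain f where f: "f \<in> F" "ceval f v \<noteq> 0" unfolding F(2) by (auto simp: proj_zeros_def rnc_cone_def)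
  obtain k where k: "homogeneous k f" using f(1) F(1) by blast
  have fin: "finite {z. ceval f (rnc a d z 1) = 0}"
    using rnc_vanishing[OF assms(1) k _ v(1)] f(2) by blast
  define B where "B = insert (rnc a d 1 0) ((\<lambda>z. rnc a d z 1) ` {z. ceval f (rnc a d z 1) = 0})"
  have "C \<subseteq> (\<Union>p\<in>B. ppoint p)"
  proof
    fix w assume w: "w \<in> C"
    then have f0: "ceval f w = 0" using f(1) unfolding F(2) by (auto simp: proj_zeros_def)
    have "w \<in> rnc_cone a d" using w assms(3) by blast
    then show "w \<in> (\<Union>p\<in>B. ppoint p)"
    proof (cases rule: rnc_cone_cases)
      case (1 c z)
      then have "ceval f (rnc a d z 1) = 0" using f0 ceval_scale[OF k, of c "rnc a d z 1"] by auto
      then have "rnc a d z 1 \<in> B" by (auto simp: B_def)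
      moreover have "w \<in> ppoint (rnc a d z 1)" using 1 unfolding ppoint_def by blast
      ultimately show ?thesis by blast
    next
      case (2 c)
      then have "w \<in> ppoint (rnc a d 1 0)" unfolding ppoint_def by blast
      then show ?thesis by (auto simp: B_def)
    qed
  qed
  moreover have "p \<in> hcoords {a..d}" if "p \<in> B" for p
    using that rnc_hcoords[of a d] assms(1) by (auto simp: B_def)
  ultimately obtain p where p: "p \<in> B" "C \<subseteq> ppoint p"
    using proj_irreducible_subset_finite_union[OF assms(2), of B ppoint] fin proj_closed_ppoint
    unfolding B_def by blast
  obtain q where "q \<in> C" using C(2) by blast
  then have "ppoint q \<subseteq> C" "ppoint q = ppoint p"
    using ppoint_subset[OF C(1)] ppoint_eq p(2) by blast+
  then show ?thesis using p(2) by blast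
qed

text \<open>Proper irreducible subsets of the curve are points, and distinct points are not nested;
  so the chain from a point to the curve cannot be refined.\<close>

lemma proj_dim_rnc_cone:
  assumes "a < d"
  shows "proj_dim {a..d} (rnc_cone a d) = 1"
  unfolding proj_dim_def
proof (rule cSup_eq_maximum)
  let ?X = "rnc_cone a d"
  let ?p = "rnc a d 0 1"
  have p: "?p \<in> ?X" using assms by (intro rnc_mem) auto
  then have "ppoint ?p \<subseteq> ?X" by (rule ppoint_subset[OF proj_closed_rnc_cone])
  moreover have "rnc a d 1 0 \<in> ?X" using assms by (intro rnc_mem) auto
  moreover have "rnc a d 1 0 \<notin> ppoint ?p"
  proof
    assume "rnc a d 1 0 \<in> ppoint ?p"
    then obtain c where "rnc a d 1 0 = (\<lambda>i. c * ?p i)" by (auto simp: ppoint_def)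
    from fun_cong[OF this, of d] show False using assms by (simp add: rnc_affine rnc_infinity zero_power)
  qed
  ultimately have "ppoint ?p \<subset> ?X" by blast
  moreover have "proj_irreducible {a..d} (ppoint ?p)"
    using p by (intro proj_irreducible_ppoint) (simp add: rnc_cone_def)
  ultimately show "1 \<in> {k. \<exists>C. (\<forall>j\<le>k. proj_irreducible {a..d} (C j) \<and> C j \<subseteq> ?X) \<and> (\<forall>j<k. C j \<subset> C (Suc j))}"
    using proj_irreducible_rnc_cone[OF assms]
    by (intro CollectI exI[of _ "\<lambda>j. if j = 0 then ppoint ?p else ?X"]) auto
  fix k assume "k \<in> {k. \<exists>C. (\<forall>j\<le>k. proj_irreducible {a..d} (C j) \<and> C j \<subseteq> ?X) \<and> (\<forall>j<k. C j \<subset> C (Suc j))}"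
  then obtain C where C: "\<And>j. j \<le> k \<Longrightarrow> proj_irreducible {a..d} (C j) \<and> C j \<subseteq> ?X"
    "\<And>j. j < k \<Longrightarrow> C j \<subset> C (Suc j)" by blast
  show "k \<le> 1"
  proof (rule ccontr)
    assume "\<not> k \<le> 1"
    then have C01: "C 0 \<subset> C 1" and "C 1 \<subset> C (Suc 1)" and "C (Suc 1) \<subseteq> ?X"
      using C(2)[of 0] C(2)[of 1] C(1)[of "Suc 1"] by auto
    then have "C 0 \<noteq> ?X" "C 1 \<noteq> ?X" by blast+
    then obtain p q where pq: "C 0 = ppoint p" "C 1 = ppoint q"
      using proj_irreducible_subset_rnc_cone[OF assms] C(1)[of 0] C(1)[of 1] \<open>\<not> k \<le> 1\<close> by (metis le0 nle_le)
    then have "ppoint p = ppoint q" using C01 ppoint_self[of p] ppoint_eq[of p q] by blast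
    then show False using C01 pq by simp
  qed
qed

section \<open>The dual variety of the rational normal curve\<close>

text \<open>The velocity of a curve inside Z is annihilated by all differentials. Curves thus bound
  the tangent space from below without knowledge of the full vanishing ideal, while the quadrics
  bound it from above.\<close>

lemma affine_tangent_spaceI:
  assumes "\<gamma> 0 = p" "\<And>i. ((\<lambda>t. \<gamma> t i) has_field_derivative w i) (at 0)" "\<forall>\<^sub>F t in nhds 0. \<gamma> t \<in> Z"
    and "\<And>i. i \<notin> I \<Longrightarrow> w i = 0"
  shows "w \<in> affine_tangent_space I Z p"
  unfolding affine_tangent_space_def
proof (intro CollectI conjI allI impI ballI assms(4))
  fix f assume f: "f \<in> vanishing_ideal I Z"
  obtain D where D: "\<And>\<gamma> w. \<gamma> 0 = p \<Longrightarrow> (\<And>i. ((\<lambda>t. \<gamma> t i) has_field_derivative w i) (at 0)) \<Longrightarrow>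
     ((\<lambda>t. ceval f (\<gamma> t)) has_field_derivative D w) (at 0)"
    using ceval_derivative[of p f] by blast
  have "\<forall>\<^sub>F t in nhds 0. ceval f (\<gamma> t) = 0"
    using assms(3) by eventually_elim (use f in \<open>auto simp: vanishing_ideal_def\<close>)
  moreover have "((\<lambda>t. ceval f (\<gamma> t)) has_field_derivative D w) (at 0)"
    by (rule D) (use assms in auto)
  ultimately have "((\<lambda>t. 0) has_field_derivative D w) (at 0)"
    using DERIV_cong_ev[OF refl _ refl, of "\<lambda>t. ceval f (\<gamma> t)" "\<lambda>t. 0" 0 "D w"] by simp
  then have "D w = 0" using DERIV_unique DERIV_const by blast
  moreover have "((\<lambda>t. ceval f (\<lambda>i. p i + t * w i)) has_field_derivative D w) (at 0)"
    by (rule D) (auto intro!: derivative_eq_intros)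
  ultimately show "((\<lambda>t. ceval f (\<lambda>i. p i + t * w i)) has_field_derivative 0) (at 0)" by simp
qed

lemma quadric_tangent:
  assumes "w \<in> affine_tangent_space I Z p" "quadric i j \<in> vanishing_ideal I Z"
  shows "p i * w (Suc j) + w i * p (Suc j) = p (Suc i) * w j + w (Suc i) * p j"
proof -
  have "((\<lambda>t. ceval (quadric i j) (\<lambda>i. p i + t * w i)) has_field_derivative 0) (at 0)"
    using assms by (auto simp: affine_tangent_space_def)
  moreover have "((\<lambda>t. ceval (quadric i j) (\<lambda>i. p i + t * w i)) has_field_derivative
      (p i * w (Suc j) + w i * p (Suc j) - (p (Suc i) * w j + w (Suc i) * p j))) (at 0)"
    unfolding ceval_quadric by (auto intro!: derivative_eq_intros simp: algebra_simps)
  ultimately have "0 = p i * w (Suc j) + w i * p (Suc j) - (p (Suc i) * w j + w (Suc i) * p j)"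
    by (rule DERIV_unique)
  then show ?thesis by simp
qed

lemma quadric_vanishing: "i \<in> {a..<d} \<Longrightarrow> j \<in> {a..<d} \<Longrightarrow> quadric i j \<in> vanishing_ideal {a..d} (rnc_cone a d)"
  by (auto simp: vanishing_ideal_def quadric_cpolys ceval_quadric rnc_cone_quadric)

lemma dim_two:
  fixes A B :: "nat \<Rightarrow> complex"
  assumes "A \<in> T" "B \<in> T" "\<And>w. w \<in> T \<Longrightarrow> \<exists>x y. w = (\<lambda>i. x * A i + y * B i)"
    and "A k \<noteq> 0" "B k = 0" "B l \<noteq> 0"
  shows "vector_space.dim (\<lambda>(c :: complex) v i. c * v i) T = 2"
proof -
  interpret vs: vector_space "\<lambda>(c :: complex) v (i::nat). c * v i"
    by unfold_locales (auto simp: fun_eq_iff algebra_simps)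
  have "A \<noteq> B" using assms(4,5) by auto
  have "B \<notin> vs.span {A}"
  proof
    assume "B \<in> vs.span {A}"
    then obtain c where c: "B = (\<lambda>i. c * A i)" by (auto simp: vs.span_singleton)
    then have "c = 0" using fun_cong[OF c, of k] assms(4,5) by simp
    with c assms(6) show False by simp
  qed
  moreover have "A \<noteq> 0" using assms(4) by auto
  ultimately have "vs.independent {B, A}"
    by (intro vs.independent_insertI) (auto simp: vs.independent_insert vs.independent_empty)
  moreover have "T \<subseteq> vs.span {B, A}"
  proof
    fix w assume "w \<in> T"
    then obtain x y where w: "w = (\<lambda>i. x * A i + y * B i)" using assms(3) by blast
    have "(\<lambda>i. x * A i) + (\<lambda>i. y * B i) \<in> vs.span {B, A}"
      by (intro vs.span_add vs.span_scale vs.span_base) auto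
    then show "w \<in> vs.span {B, A}" by (simp add: w plus_fun_def)
  qed
  moreover have "card {B, A} = 2" using \<open>A \<noteq> B\<close> by simp
  ultimately show ?thesis using assms(1,2) by (intro vs.dim_unique[of "{B, A}"]) auto
qed

definition drnc :: "nat \<Rightarrow> nat \<Rightarrow> complex \<Rightarrow> nat \<Rightarrow> complex" where
  "drnc a d z i = (if i \<in> {a..d} then of_nat (i - a) * z ^ (i - a - 1) else 0)"

text \<open>The two tangent vectors come from rescaling the point and from moving the parameter z.
  That there are no others follows from the quadrics with first index a.\<close>

lemma tangent_affine:
  assumes "a < d" "c \<noteq> 0" and p: "p = (\<lambda>i. c * rnc a d z 1 i)"
  defines "T \<equiv> affine_tangent_space {a..d} (rnc_cone a d) p"
  shows "rnc a d z 1 \<in> T" "drnc a d z \<in> T"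
    "\<And>w. w \<in> T \<Longrightarrow> \<exists>x y. w = (\<lambda>i. x * rnc a d z 1 i + y * drnc a d z i)"
proof -
  show "rnc a d z 1 \<in> T" unfolding T_def
  proof (rule affine_tangent_spaceI[of "\<lambda>t i. (c + t) * rnc a d z 1 i"])
    show "(\<lambda>i. (c + 0) * rnc a d z 1 i) = p" by (simp add: p)
    have "\<forall>\<^sub>F t in nhds 0. c + t \<noteq> 0"
    proof (rule eventually_mono)
      show "\<forall>\<^sub>F t in nhds 0. t \<in> - {- c}" by (rule eventually_nhds_in_open) (use assms in auto)
    qed (auto simp: add_eq_0_iff)
    then show "\<forall>\<^sub>F t in nhds 0. (\<lambda>i. (c + t) * rnc a d z 1 i) \<in> rnc_cone a d"
      by eventually_elim (use assms in \<open>auto intro: rnc_cone_mem\<close>)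
  qed (auto intro!: derivative_eq_intros simp: rnc_outside)
  show "drnc a d z \<in> T" unfolding T_def
  \<comment> \<open>The parameter moves by t / c so that the factor c of the point cancels in the
    velocity.\<close>
  proof (rule affine_tangent_spaceI[of "\<lambda>t i. c * rnc a d (z + t / c) 1 i"])
    show "(\<lambda>i. c * rnc a d (z + 0 / c) 1 i) = p" by (simp add: p)
    show "\<forall>\<^sub>F t in nhds 0. (\<lambda>i. c * rnc a d (z + t / c) 1 i) \<in> rnc_cone a d"
      using assms by (intro always_eventually allI rnc_cone_mem) auto
    show "((\<lambda>t. c * rnc a d (z + t / c) 1 i) has_field_derivative drnc a d z i) (at 0)" for i
    proof -
      have "((\<lambda>t. c * (z + t / c) ^ (i - a)) has_field_derivative
          c * (of_nat (i - a) * (z + 0 / c) ^ (i - a - 1) * (1 / c))) (at 0)"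
        by (auto intro!: derivative_eq_intros)
      then show ?thesis
        using \<open>c \<noteq> 0\<close> by (cases "i \<in> {a..d}") (auto simp: rnc_affine drnc_def)
    qed
  qed (auto simp: drnc_def)
  fix w assume w: "w \<in> T"
  have out: "w i = 0" if "i \<notin> {a..d}" for i
    using w that by (auto simp: T_def affine_tangent_space_def)
  \<comment> \<open>To first order at p, the quadric with indices a and j is the recursion of a
    geometric progression with the additional term e z^(j - a). Its solutions are spanned by the
    progression and its derivative in z.\<close>
  define e where "e = w (Suc a) - z * w a"
  have rec: "w (Suc j) = z * w j + e * z ^ (j - a)" if "j \<in> {a..<d}" for j
  proof -
    have "p a * w (Suc j) + w a * p (Suc j) = p (Suc a) * w j + w (Suc a) * p j"
      by (rule quadric_tangent[OF w[unfolded T_def] quadric_vanishing]) (use that assms in auto)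
    moreover have "p a = c" "p (Suc j) = c * z ^ Suc (j - a)" "p (Suc a) = c * z" "p j = c * z ^ (j - a)"
      using that assms(1) by (auto simp: p rnc_affine Suc_diff_le)
    ultimately have "c * w (Suc j) = c * (z * w j + e * z ^ (j - a))"
      by (simp add: e_def algebra_simps)
    then show ?thesis using assms(2) by simp
  qed
  have "w (a + k) = w a * z ^ k + e * (of_nat k * z ^ (k - 1))" if "a + k \<le> d" for k
    using that
  proof (induction k)
    case (Suc k)
    then have "w (a + Suc k) = z * w (a + k) + e * z ^ k" using rec[of "a + k"] by simp
    also have "\<dots> = w a * z ^ Suc k + e * (of_nat (Suc k) * z ^ (Suc k - 1))"
      using Suc by (cases k) (auto simp: algebra_simps)
    finally show ?case .
  qed simp
  then have "w i = w a * rnc a d z 1 i + e * drnc a d z i" for i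
    using out[of i] by (cases "i \<in> {a..d}") (auto simp: rnc_affine drnc_def dest!: le_Suc_ex)
  then show "\<exists>x y. w = (\<lambda>i. x * rnc a d z 1 i + y * drnc a d z i)" by blast
qed

text \<open>Here t = 1 / z is the local parameter, and the quadrics with first index d - 1
  annihilate all coordinates of a tangent vector but the last two.\<close>

lemma tangent_infinity:
  assumes "a < d" "c \<noteq> 0" and p: "p = (\<lambda>i. c * rnc a d 1 0 i)"
  defines "T \<equiv> affine_tangent_space {a..d} (rnc_cone a d) p"
  shows "rnc a d 1 0 \<in> T" "(\<lambda>i. of_bool (Suc i = d)) \<in> T"
    "\<And>w. w \<in> T \<Longrightarrow> \<exists>x y. w = (\<lambda>i. x * rnc a d 1 0 i + y * of_bool (Suc i = d))"
proof -
  show "rnc a d 1 0 \<in> T" unfolding T_def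
  proof (rule affine_tangent_spaceI[of "\<lambda>t i. (c + t) * rnc a d 1 0 i"])
    show "(\<lambda>i. (c + 0) * rnc a d 1 0 i) = p" by (simp add: p)
    have "\<forall>\<^sub>F t in nhds 0. c + t \<noteq> 0"
    proof (rule eventually_mono)
      show "\<forall>\<^sub>F t in nhds 0. t \<in> - {- c}" by (rule eventually_nhds_in_open) (use assms in auto)
    qed (auto simp: add_eq_0_iff)
    then show "\<forall>\<^sub>F t in nhds 0. (\<lambda>i. (c + t) * rnc a d 1 0 i) \<in> rnc_cone a d"
      by eventually_elim (use assms in \<open>auto intro: rnc_cone_mem\<close>)
  qed (auto intro!: derivative_eq_intros simp: rnc_outside)
  show "(\<lambda>i. of_bool (Suc i = d)) \<in> T" unfolding T_def
  proof (rule affine_tangent_spaceI[of "\<lambda>t i. c * rnc a d 1 (t / c) i"])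
    show "(\<lambda>i. c * rnc a d 1 (0 / c) i) = p" by (simp add: p)
    show "\<forall>\<^sub>F t in nhds 0. (\<lambda>i. c * rnc a d 1 (t / c) i) \<in> rnc_cone a d"
      using assms by (intro always_eventually allI rnc_cone_mem) auto
    show "((\<lambda>t. c * rnc a d 1 (t / c) i) has_field_derivative of_bool (Suc i = d)) (at 0)" for i
    proof (cases "i \<in> {a..d}")
      case True
      have "((\<lambda>t. c * (t / c) ^ (d - i)) has_field_derivative c * (of_nat (d - i) * (0 / c) ^ (d - i - 1) * (1 / c))) (at 0)"
        by (auto intro!: derivative_eq_intros)
      moreover have "c * (of_nat (d - i) * (0 / c) ^ (d - i - 1) * (1 / c)) = of_bool (Suc i = d)"
      proof (cases "Suc i < d")
        case True
        then show ?thesis by (simp add: zero_power)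
      next
        case False
        then have "Suc i = d \<or> i = d" using True by auto
        then show ?thesis using assms(2) by auto
      qed
      ultimately show ?thesis using True by (simp add: rnc_def)
    next
      case False
      then show ?thesis using assms(1) by (auto simp: rnc_def)
    qed
  qed (use assms(1) in auto)
  fix w assume w: "w \<in> T"
  have out: "w i = 0" if "i \<notin> {a..d}" for i
    using w that by (auto simp: T_def affine_tangent_space_def)
  have "w j = 0" if "j \<in> {a..<d - 1}" for j
  proof -
    have "p (d - 1) * w (Suc j) + w (d - 1) * p (Suc j) = p (Suc (d - 1)) * w j + w (Suc (d - 1)) * p j"
      by (rule quadric_tangent[OF w[unfolded T_def] quadric_vanishing]) (use that assms in auto)
    then show ?thesis using that assms(1,2) by (simp add: p rnc_infinity split: if_splits)
  qed
  then have "w i = w d * rnc a d 1 0 i + w (d - 1) * of_bool (Suc i = d)" for i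
  proof -
    have "i \<notin> {a..d} \<or> i \<in> {a..<d - 1} \<or> i = d \<or> Suc i = d" by auto
    then show ?thesis
      using out[of i] \<open>\<And>j. j \<in> {a..<d - 1} \<Longrightarrow> w j = 0\<close>[of i] assms(1)
      by (elim disjE) (auto simp: rnc_infinity)
  qed
  then show "\<exists>x y. w = (\<lambda>i. x * rnc a d 1 0 i + y * of_bool (Suc i = d))" by blast
qed

text \<open>A common zero of f and f', where f has the coefficients c_a, ..., c_d. As a form of
  degree d - a it has a multiple root at infinity exactly if both leading coefficients
  vanish.\<close>

definition multiple_root :: "nat \<Rightarrow> nat \<Rightarrow> (nat \<Rightarrow> complex) \<Rightarrow> bool" where
  "multiple_root a d c \<longleftrightarrow>
     (\<exists>z. (\<Sum>i\<in>{a..d}. c i * z ^ (i - a)) = 0 \<and> (\<Sum>i\<in>{a..d}. c i * (of_nat (i - a) * z ^ (i - a - 1))) = 0) \<or>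
     c d = 0 \<and> c (d - 1) = 0"

text \<open>Every point of the curve is smooth with the two explicit tangent vectors. The hyperplane
  c contains them at the parameter z if and only if f(z) = 0 and f'(z) = 0, and likewise at
  infinity.\<close>

lemma tangent_hyperplanes_rnc_cone:
  assumes "a < d"
  shows "{c \<in> hcoords {a..d}. \<exists>p. smooth_point {a..d} (rnc_cone a d) p \<and>
            (\<forall>v \<in> affine_tangent_space {a..d} (rnc_cone a d) p. (\<Sum>i\<in>{a..d}. c i * v i) = 0)} =
         {c \<in> hcoords {a..d}. multiple_root a d c}"
proof -
  let ?X = "rnc_cone a d" and ?T = "affine_tangent_space {a..d} (rnc_cone a d)"
  have dim: "proj_dim {a..d} ?X + 1 = 2" using proj_dim_rnc_cone[OF assms] by simp
  have aff: "smooth_point {a..d} ?X p \<and> ((\<forall>v\<in>?T p. (\<Sum>i\<in>{a..d}. c i * v i) = 0) \<longleftrightarrow>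
      (\<Sum>i\<in>{a..d}. c i * z ^ (i - a)) = 0 \<and> (\<Sum>i\<in>{a..d}. c i * (of_nat (i - a) * z ^ (i - a - 1))) = 0)"
    if p: "p = (\<lambda>i. e * rnc a d z 1 i)" "e \<noteq> 0" for p e z c
  proof -
    note T = tangent_affine[OF assms p(2,1)]
    have dim2: "vector_space.dim (\<lambda>(c :: complex) v i. c * v i) (?T p) = 2"
      by (rule dim_two[OF T, of a "Suc a"]) (use assms in \<open>auto simp: rnc_affine drnc_def\<close>)
    have pX: "p \<in> ?X" unfolding p(1) using assms p(2) by (intro rnc_cone_mem) auto
    have s1: "(\<Sum>i\<in>{a..d}. c i * z ^ (i - a)) = (\<Sum>i\<in>{a..d}. c i * rnc a d z 1 i)"
      by (intro sum.cong) (auto simp: rnc_affine)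
    have s2: "(\<Sum>i\<in>{a..d}. c i * (of_nat (i - a) * z ^ (i - a - 1))) = (\<Sum>i\<in>{a..d}. c i * drnc a d z i)"
      by (intro sum.cong) (auto simp: drnc_def)
    have comb: "(\<Sum>i\<in>{a..d}. c i * v i) = 0"
      if "v \<in> ?T p" "(\<Sum>i\<in>{a..d}. c i * rnc a d z 1 i) = 0" "(\<Sum>i\<in>{a..d}. c i * drnc a d z i) = 0" for v
    proof -
      obtain x y where v: "v = (\<lambda>i. x * rnc a d z 1 i + y * drnc a d z i)" using T(3) \<open>v \<in> ?T p\<close> by blast
      have "(\<Sum>i\<in>{a..d}. c i * v i) = x * (\<Sum>i\<in>{a..d}. c i * rnc a d z 1 i) + y * (\<Sum>i\<in>{a..d}. c i * drnc a d z i)"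
        by (simp add: v sum.distrib sum_distrib_left algebra_simps)
      then show ?thesis using that by simp
    qed
    have "smooth_point {a..d} ?X p" unfolding smooth_point_def dim using pX dim2 by blast
    moreover have "(\<forall>v\<in>?T p. (\<Sum>i\<in>{a..d}. c i * v i) = 0) \<longleftrightarrow>
        (\<Sum>i\<in>{a..d}. c i * rnc a d z 1 i) = 0 \<and> (\<Sum>i\<in>{a..d}. c i * drnc a d z i) = 0"
      using T(1,2) comb by blast
    ultimately show ?thesis unfolding s1 s2 by blast
  qed
  have inf: "smooth_point {a..d} ?X p \<and> ((\<forall>v\<in>?T p. (\<Sum>i\<in>{a..d}. c i * v i) = 0) \<longleftrightarrow> c d = 0 \<and> c (d - 1) = 0)"
    if p: "p = (\<lambda>i. e * rnc a d 1 0 i)" "e \<noteq> 0" for p e c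
  proof -
    note T = tangent_infinity[OF assms p(2,1)]
    have dim2: "vector_space.dim (\<lambda>(c :: complex) v i. c * v i) (?T p) = 2"
      by (rule dim_two[OF T, of d "d - 1"]) (use assms in \<open>auto simp: rnc_infinity\<close>)
    have pX: "p \<in> ?X" unfolding p(1) using assms p(2) by (intro rnc_cone_mem) auto
    have d: "(\<Sum>i\<in>{a..d}. c i * rnc a d 1 0 i) = c d"
    proof -
      have "(\<Sum>i\<in>{a..d}. c i * rnc a d 1 0 i) = (\<Sum>i\<in>{a..d}. if d = i then c i else 0)"
        using assms by (intro sum.cong) (auto simp: rnc_infinity)
      then show ?thesis using assms by simp
    qed
    have d1: "(\<Sum>i\<in>{a..d}. c i * of_bool (Suc i = d)) = c (d - 1)"
    proof -
      have "(\<Sum>i\<in>{a..d}. c i * of_bool (Suc i = d)) = (\<Sum>i\<in>{a..d}. if d - 1 = i then c i else 0)"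
        using assms by (intro sum.cong) auto
      then show ?thesis using assms by simp
    qed
    have comb: "(\<Sum>i\<in>{a..d}. c i * v i) = 0" if "v \<in> ?T p" "c d = 0" "c (d - 1) = 0" for v
    proof -
      obtain x y where v: "v = (\<lambda>i. x * rnc a d 1 0 i + y * of_bool (Suc i = d))" using T(3) \<open>v \<in> ?T p\<close> by blast
      have "(\<Sum>i\<in>{a..d}. c i * v i) = x * (\<Sum>i\<in>{a..d}. c i * rnc a d 1 0 i) + y * (\<Sum>i\<in>{a..d}. c i * of_bool (Suc i = d))"
        unfolding v sum_distrib_left sum.distrib[symmetric] by (intro sum.cong refl) (simp add: algebra_simps)
      then show ?thesis using that d d1 by simp
    qed
    have "smooth_point {a..d} ?X p" unfolding smooth_point_def dim using pX dim2 by blast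
    moreover have "(\<forall>v\<in>?T p. (\<Sum>i\<in>{a..d}. c i * v i) = 0) \<longleftrightarrow> c d = 0 \<and> c (d - 1) = 0"
      using bspec[OF _ T(1), of "\<lambda>v. (\<Sum>i\<in>{a..d}. c i * v i) = 0"]
        bspec[OF _ T(2), of "\<lambda>v. (\<Sum>i\<in>{a..d}. c i * v i) = 0"] comb unfolding d d1 by blast
    ultimately show ?thesis by blast
  qed
  show ?thesis
  proof (intro Collect_cong conj_cong refl iffI)
    fix c assume "\<exists>p. smooth_point {a..d} ?X p \<and> (\<forall>v\<in>?T p. (\<Sum>i\<in>{a..d}. c i * v i) = 0)"
    then obtain p where p: "p \<in> ?X" "\<forall>v\<in>?T p. (\<Sum>i\<in>{a..d}. c i * v i) = 0"
      by (auto simp: smooth_point_def)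
    show "multiple_root a d c" using p(1)
    proof (cases rule: rnc_cone_cases)
      case (1 e z)
      then show ?thesis using aff[OF 1(2,1), of c] p(2) unfolding multiple_root_def by blast
    next
      case (2 e)
      then show ?thesis using inf[OF 2(2,1), of c] p(2) unfolding multiple_root_def by blast
    qed
  next
    fix c assume "multiple_root a d c"
    then show "\<exists>p. smooth_point {a..d} ?X p \<and> (\<forall>v\<in>?T p. (\<Sum>i\<in>{a..d}. c i * v i) = 0)"
      unfolding multiple_root_def
    proof (elim disjE exE)
      fix z assume "(\<Sum>i\<in>{a..d}. c i * z ^ (i - a)) = 0 \<and> (\<Sum>i\<in>{a..d}. c i * (of_nat (i - a) * z ^ (i - a - 1))) = 0"
      then show ?thesis using aff[OF refl one_neq_zero, where c = c and z = z] by blast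
    next
      assume "c d = 0 \<and> c (d - 1) = 0"
      then show ?thesis using inf[OF refl one_neq_zero, where c = c] by blast
    qed
  qed
qed

lemma rnc_cone_full:
  assumes "a \<le> d" "d \<le> Suc a"
  shows "rnc_cone a d = hcoords {a..d}"
proof (intro equalityI subsetI)
  fix v assume v: "v \<in> hcoords {a..d}"
  have "v i * v (Suc j) = v (Suc i) * v j" if "i \<in> {a..<d}" "j \<in> {a..<d}" for i j
  proof -
    have "i = j" using that assms by auto
    then show ?thesis by (simp add: mult.commute)
  qed
  then show "v \<in> rnc_cone a d"
    using v by (auto simp: rnc_cone_eq proj_zeros_def ceval_quadric)
qed (auto simp: rnc_cone_def)

text \<open>The curve is then a whole projective space of dimension 0 or 1. Its tangent spaces are
  everything, no hyperplane is tangent, and the empty dual variety calls for the default value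
  1.\<close>

lemma discriminant_trivial:
  assumes "a \<le> d" "d \<le> Suc a" "is_X_discriminant {a..d} \<Delta>"
  shows "\<Delta> = 1"
proof -
  let ?X = "hcoords {a..d}" and ?T = "affine_tangent_space {a..d} (hcoords {a..d})"
  have T: "v \<in> ?T p" if p: "p \<in> ?X" and "\<And>i. i \<notin> {a..d} \<Longrightarrow> v i = 0" for p v
  proof (rule affine_tangent_spaceI)
    obtain k where k: "p k \<noteq> 0" using hcoords_nonzero[OF p] by blast
    have "((\<lambda>t. p k + t * v k) \<longlongrightarrow> p k + 0 * v k) (nhds 0)" by (intro tendsto_intros filterlim_ident)
    then have "((\<lambda>t. p k + t * v k) \<longlongrightarrow> p k) (nhds 0)" by simp
    then have "\<forall>\<^sub>F t in nhds 0. p k + t * v k \<noteq> 0" using k by (rule tendsto_imp_eventually_ne)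
    then show "\<forall>\<^sub>F t in nhds 0. (\<lambda>i. p i + t * v i) \<in> ?X"
    proof eventually_elim
      case (elim t)
      then have "(\<lambda>i. p i + t * v i) \<noteq> (\<lambda>_. 0)" by metis
      then show ?case using that by (auto simp: hcoords_def)
    qed
  qed (use that in \<open>auto intro!: derivative_eq_intros\<close>)
  have E: "{c \<in> ?X. \<exists>p. smooth_point {a..d} ?X p \<and> (\<forall>v \<in> ?T p. (\<Sum>i\<in>{a..d}. c i * v i) = 0)} = {}"
  proof -
    have False if c: "c \<in> ?X" "smooth_point {a..d} ?X p" "\<forall>v \<in> ?T p. (\<Sum>i\<in>{a..d}. c i * v i) = 0" for c p
    proof -
      obtain k where k: "k \<in> {a..d}" "c k \<noteq> 0" using hcoords_nonzero[OF c(1)] by blast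
      have "(\<lambda>i. of_bool (i = k)) \<in> ?T p"
        by (rule T) (use c(2) k in \<open>auto simp: smooth_point_def\<close>)
      from bspec[OF c(3) this] have "(\<Sum>i\<in>{a..d}. c i * of_bool (i = k)) = 0" .
      moreover have "(\<Sum>i\<in>{a..d}. c i * of_bool (i = k)) = (\<Sum>i\<in>{a..d}. if k = i then c i else 0)"
        by (intro sum.cong) auto
      ultimately show False using k by simp
    qed
    then show ?thesis by blast
  qed
  have "dual_variety {a..d} (monomial_curve {a..d}) = {}"
    unfolding dual_variety_def monomial_curve_eq[OF assms(1)] rnc_cone_full[OF assms(1,2)] E
    by (rule proj_closure_eq[OF proj_closed_empty])
  then show ?thesis using assms(3) by (simp add: is_X_discriminant_def proj_hypersurface_def)
qed

section \<open>The discriminant of binary forms\<close>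

text \<open>
  For the binary form with coefficients \<open>c\<^sub>a, \<dots>, c\<^sub>d\<close>, these are the dehomogenised partial derivatives
  \<open>f'\<close> and \<open>r f - x f'\<close>, where \<open>r = d - a\<close>, and their Sylvester matrix as forms of degree \<open>r - 1\<close>.
\<close>

definition dx_coeff :: "nat \<Rightarrow> nat \<Rightarrow> (nat \<Rightarrow> 'a::comm_ring_1) \<Rightarrow> nat \<Rightarrow> 'a" where
  "dx_coeff a d c k = (if k < d - a then of_nat (Suc k) * c (Suc (a + k)) else 0)"

definition dy_coeff :: "nat \<Rightarrow> nat \<Rightarrow> (nat \<Rightarrow> 'a::comm_ring_1) \<Rightarrow> nat \<Rightarrow> 'a" where
  "dy_coeff a d c k = (if k < d - a then of_nat (d - a - k) * c (a + k) else 0)"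

definition sylvester_entry :: "nat \<Rightarrow> nat \<Rightarrow> (nat \<Rightarrow> 'a::comm_ring_1) \<Rightarrow> nat \<Rightarrow> nat \<Rightarrow> 'a" where
  "sylvester_entry a d c i j =
     (if j < d - a - 1 then if i < j then 0 else dx_coeff a d c (i - j)
      else if i < j - (d - a - 1) then 0 else dy_coeff a d c (i - (j - (d - a - 1))))"

definition form_sylvester :: "nat \<Rightarrow> nat \<Rightarrow> (nat \<Rightarrow> 'a::comm_ring_1) \<Rightarrow> 'a Matrix.mat" where
  "form_sylvester a d c = Matrix.mat (2 * (d - a - 1)) (2 * (d - a - 1)) (\<lambda>(i, j). sylvester_entry a d c i j)"

definition form_discriminant :: "nat \<Rightarrow> nat \<Rightarrow> cmpoly" where
  "form_discriminant a d = Determinant.det (form_sylvester a d pvar)"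

text \<open>Cancellation for coprime g and h: a root of g is a root of B h but not of h, so its
  linear factor can be removed from both g and B.\<close>

lemma dvd_cancel_no_common_root:
  fixes g h A B :: "complex poly"
  assumes "g \<noteq> 0" "\<And>z. \<not> (poly g z = 0 \<and> poly h z = 0)" "A * g = B * h"
  shows "g dvd B"
  using assms
proof (induction "degree g" arbitrary: g B)
  case 0
  then have "is_unit g" by (simp add: is_unit_iff_degree)
  then show ?case by (rule unit_imp_dvd)
next
  case (Suc n)
  then have "\<not> constant (poly g)" by (simp add: constant_degree)
  then obtain z where z: "poly g z = 0" using fundamental_theorem_of_algebra by blast
  then obtain g' where g': "g = [:- z, 1:] * g'" by (auto simp: poly_eq_0_iff_dvd)
  have "poly (B * h) z = 0" unfolding Suc.prems(3)[symmetric] using z by simp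
  then have "poly B z = 0" using Suc.prems(2) z by auto
  then obtain B' where B': "B = [:- z, 1:] * B'" by (auto simp: poly_eq_0_iff_dvd)
  have "g' \<noteq> 0" using Suc.prems(1) g' by auto
  then have "degree g = Suc (degree g')" unfolding g' by (subst degree_mult_eq) auto
  then have n: "n = degree g'" using Suc.hyps(2) by simp
  have "[:- z, 1:] * (A * g') = [:- z, 1:] * (B' * h)"
    using Suc.prems(3) unfolding g' B' by (simp only: ac_simps)
  then have "A * g' = B' * h" by (subst (asm) mult_cancel_left) auto
  then have "g' dvd B'"
    using Suc.prems(2) by (intro Suc.hyps(1)[OF n \<open>g' \<noteq> 0\<close>]) (auto simp: g')
  then show ?case unfolding g' B' by (intro mult_dvd_mono dvd_refl)
qed

lemma coeff_sum_monom:
  "Polynomial.coeff (\<Sum>k<n. Polynomial.monom (f k) k) i = (if i < n then f i else (0::'a::comm_ring_1))"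
  by (simp add: coeff_sum)

text \<open>A kernel vector is a pair u, w of polynomials of degree below m = d - a - 1 with u g + w
  h = 0. Without a common zero, infinity included, g or h has degree exactly m and divides a
  polynomial of smaller degree, so that u = w = 0. With a common zero, h and -g divided by its
  linear factor give a kernel vector; if the zero is at infinity, they have degree below m
  already.\<close>

lemma det_form_sylvester:
  fixes c :: "nat \<Rightarrow> complex"
  assumes "a + 2 \<le> d" "c \<in> hcoords {a..d}"
  shows "Determinant.det (form_sylvester a d c) = 0 \<longleftrightarrow> multiple_root a d c"
proof -
  define m where "m = d - a - 1"
  have dm: "m \<ge> 1" "d = a + Suc m" using assms(1) by (auto simp: m_def)
  let ?N = "2 * m"
  define f where "f = (\<Sum>k<Suc (Suc m). Polynomial.monom (c (a + k)) k)"
  define g where "g = (\<Sum>k<Suc m. Polynomial.monom (dx_coeff a d c k) k)"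
  define h where "h = (\<Sum>k<Suc m. Polynomial.monom (dy_coeff a d c k) k)"
  have cf: "Polynomial.coeff f i = (if i \<le> Suc m then c (a + i) else 0)" for i
    by (auto simp: f_def coeff_sum_monom)
  have cg: "Polynomial.coeff g i = dx_coeff a d c i" for i
    by (auto simp: g_def coeff_sum_monom dx_coeff_def dm)
  have ch: "Polynomial.coeff h i = dy_coeff a d c i" for i
    by (auto simp: h_def coeff_sum_monom dy_coeff_def dm)
  have g_eq: "g = pderiv f"
    by (rule poly_eqI) (auto simp: cg cf coeff_pderiv dx_coeff_def dm)
  have h_eq: "h = Polynomial.smult (of_nat (Suc m)) f - [:0, 1:] * pderiv f"
  proof (rule poly_eqI)
    fix i
    show "Polynomial.coeff h i = Polynomial.coeff (Polynomial.smult (of_nat (Suc m)) f - [:0, 1:] * pderiv f) i"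
      by (cases i) (auto simp: ch cf coeff_pderiv dy_coeff_def dm coeff_pCons of_nat_diff algebra_simps)
  qed
  have f0: "f \<noteq> 0"
  proof
    assume "f = 0"
    obtain k where k: "k \<in> {a..d}" "c k \<noteq> 0" using hcoords_nonzero[OF assms(2)] by blast
    then have "c k = Polynomial.coeff f (k - a)" by (auto simp: cf dm)
    with k \<open>f = 0\<close> show False by simp
  qed
  \<comment> \<open>Euler's relation: h + x g = (m + 1) f, and f is nonzero.\<close>
  have "\<not> (g = 0 \<and> h = 0)"
    using f0 dm unfolding h_eq g_eq[symmetric] by (auto simp del: of_nat_Suc)
  have pf: "poly f z = (\<Sum>i\<in>{a..d}. c i * z ^ (i - a))" for z
  proof -
    have "(\<Sum>i\<in>{a..d}. c i * z ^ (i - a)) = (\<Sum>k<Suc (Suc m). c (a + k) * z ^ k)"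
      by (rule sum.reindex_bij_witness[of _ "\<lambda>k. a + k" "\<lambda>i. i - a"]) (auto simp: dm)
    then show ?thesis by (simp add: f_def poly_sum poly_monom)
  qed
  have pg: "poly g z = (\<Sum>i\<in>{a..d}. c i * (of_nat (i - a) * z ^ (i - a - 1)))" for z
  proof -
    have "(\<Sum>i\<in>{a..d}. c i * (of_nat (i - a) * z ^ (i - a - 1))) = (\<Sum>k<Suc (Suc m). c (a + k) * (of_nat k * z ^ (k - 1)))"
      by (rule sum.reindex_bij_witness[of _ "\<lambda>k. a + k" "\<lambda>i. i - a"]) (auto simp: dm)
    also have "\<dots> = poly (pderiv f) z"
      unfolding f_def higher_pderiv_sum[of 1, simplified] poly_sum pderiv_monom poly_monom by (intro sum.cong) auto
    finally show ?thesis by (simp add: g_eq)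
  qed
  have top: "Polynomial.coeff g m = 0 \<and> Polynomial.coeff h m = 0 \<longleftrightarrow> c d = 0 \<and> c (d - 1) = 0"
    using dm by (auto simp: cg ch dx_coeff_def dy_coeff_def simp del: of_nat_Suc)
  have root: "multiple_root a d c \<longleftrightarrow> (\<exists>z. poly g z = 0 \<and> poly h z = 0) \<or>
      Polynomial.coeff g m = 0 \<and> Polynomial.coeff h m = 0"
  proof -
    have "poly f z = 0 \<and> poly g z = 0 \<longleftrightarrow> poly g z = 0 \<and> poly h z = 0" for z
      using dm by (auto simp: h_eq g_eq simp del: of_nat_Suc)
    then show ?thesis unfolding multiple_root_def pf[symmetric] pg[symmetric] top by blast
  qed
  \<comment> \<open>Turns either half of a kernel vector into a polynomial of degree below
    m.\<close>
  define P where "P v = (\<Sum>j<m. Polynomial.monom (v j) j)" for v :: "nat \<Rightarrow> complex"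
  have cP: "Polynomial.coeff (P v) i = (if i < m then v i else 0)" for v i
    by (simp add: P_def coeff_sum_monom)
  have PQ: "Polynomial.coeff (P v * q) i = (\<Sum>j<m. if i < j then 0 else v j * Polynomial.coeff q (i - j))" for v q i
    by (simp add: P_def sum_distrib_right coeff_sum coeff_monom_mult)
  have degP: "P v = 0 \<or> degree (P v) < m" for v
  proof (cases "P v = 0")
    case False
    then have "Polynomial.coeff (P v) (degree (P v)) \<noteq> 0" by simp
    then show ?thesis by (simp add: cP split: if_splits)
  qed simp
  have P_surj: "P (Polynomial.coeff q) = q" if "\<And>i. i \<ge> m \<Longrightarrow> Polynomial.coeff q i = 0" for q
    by (rule poly_eqI) (use that in \<open>auto simp: cP\<close>)
  have degg: "degree g \<le> m" "degree h \<le> m"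
    by (auto intro!: degree_le simp: cg ch dx_coeff_def dy_coeff_def dm)
  have degPQ: "Polynomial.coeff (P v * q) i = 0" if "degree q \<le> m" "i \<ge> ?N" for v q i
  proof (cases "P v = 0")
    case False
    then have "degree (P v * q) < ?N"
      using degree_mult_le[of "P v" q] degP[of v] that(1) by linarith
    then show ?thesis using that(2) by (intro coeff_eq_0) auto
  qed simp
  let ?M = "form_sylvester a d c"
  have M: "?M \<in> carrier_mat ?N ?N" by (simp add: form_sylvester_def dm)
  have Mv: "Matrix.vec_index (mult_mat_vec ?M v) i =
      Polynomial.coeff (P (Matrix.vec_index v) * g + P (\<lambda>j. Matrix.vec_index v (m + j)) * h) i"
    if "v \<in> carrier_vec ?N" "i < ?N" for v i
  proof -
    have "Matrix.vec_index (mult_mat_vec ?M v) i = (\<Sum>j<?N. sylvester_entry a d c i j * Matrix.vec_index v j)"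
      using that by (simp add: form_sylvester_def scalar_prod_def dm atLeast0LessThan)
    also have "{..<?N} = {..<m} \<union> (\<lambda>j. m + j) ` {..<m}"
    proof (intro equalityI subsetI)
      fix j assume "j \<in> {..<?N}"
      then show "j \<in> {..<m} \<union> (\<lambda>j. m + j) ` {..<m}"
        by (cases "j < m") (auto intro!: image_eqI[of _ _ "j - m"])
    qed auto
    also have "(\<Sum>j\<in>{..<m} \<union> (\<lambda>j. m + j) ` {..<m}. sylvester_entry a d c i j * Matrix.vec_index v j) =
        (\<Sum>j<m. sylvester_entry a d c i j * Matrix.vec_index v j) +
        (\<Sum>j\<in>(\<lambda>j. m + j) ` {..<m}. sylvester_entry a d c i j * Matrix.vec_index v j)"
      by (intro sum.union_disjoint) auto
    also have "(\<Sum>j\<in>(\<lambda>j. m + j) ` {..<m}. sylvester_entry a d c i j * Matrix.vec_index v j) =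
        (\<Sum>j<m. sylvester_entry a d c i (m + j) * Matrix.vec_index v (m + j))"
      by (subst sum.reindex) (auto simp: inj_on_def)
    also have "\<dots> = (\<Sum>j<m. if i < j then 0 else Matrix.vec_index v (m + j) * Polynomial.coeff h (i - j))"
      by (intro sum.cong) (auto simp: sylvester_entry_def dm ch)
    also have "(\<Sum>j<m. sylvester_entry a d c i j * Matrix.vec_index v j) =
        (\<Sum>j<m. if i < j then 0 else Matrix.vec_index v j * Polynomial.coeff g (i - j))"
      by (intro sum.cong) (auto simp: sylvester_entry_def dm cg)
    finally show ?thesis unfolding PQ Polynomial.coeff_add .
  qed
  have "Determinant.det ?M = 0 \<longleftrightarrow> (\<exists>v. v \<in> carrier_vec ?N \<and> v \<noteq> 0\<^sub>v ?N \<and> mult_mat_vec ?M v = 0\<^sub>v ?N)"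
    by (rule det_0_iff_vec_prod_zero_field[OF M])
  also have "\<dots> \<longleftrightarrow> (\<exists>u w. (P u \<noteq> 0 \<or> P w \<noteq> 0) \<and> P u * g + P w * h = 0)"
  proof
    assume "\<exists>v. v \<in> carrier_vec ?N \<and> v \<noteq> 0\<^sub>v ?N \<and> mult_mat_vec ?M v = 0\<^sub>v ?N"
    then obtain v where v: "v \<in> carrier_vec ?N" "v \<noteq> 0\<^sub>v ?N" "mult_mat_vec ?M v = 0\<^sub>v ?N" by blast
    let ?u = "Matrix.vec_index v" and ?w = "\<lambda>j. Matrix.vec_index v (m + j)"
    have "P ?u * g + P ?w * h = 0"
    proof (rule poly_eqI)
      fix i
      show "Polynomial.coeff (P ?u * g + P ?w * h) i = Polynomial.coeff 0 i"
        using Mv[OF v(1), of i] degPQ[OF degg(1), of i ?u] degPQ[OF degg(2), of i ?w]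
        by (cases "i < ?N") (auto simp: v(3))
    qed
    moreover have "P ?u \<noteq> 0 \<or> P ?w \<noteq> 0"
    proof (rule ccontr)
      assume *: "\<not> ?thesis"
      have "Matrix.vec_index v j = 0" if "j < ?N" for j
      proof (cases "j < m")
        case True
        then show ?thesis using * cP[of ?u j] by simp
      next
        case False
        then show ?thesis using * that cP[of ?w "j - m"] by (auto split: if_splits)
      qed
      then have "v = 0\<^sub>v ?N" using v(1) by (intro eq_vecI) auto
      with v(2) show False by simp
    qed
    ultimately show "\<exists>u w. (P u \<noteq> 0 \<or> P w \<noteq> 0) \<and> P u * g + P w * h = 0" by blast
  next
    assume "\<exists>u w. (P u \<noteq> 0 \<or> P w \<noteq> 0) \<and> P u * g + P w * h = 0"
    then obtain u w where uw: "P u \<noteq> 0 \<or> P w \<noteq> 0" "P u * g + P w * h = 0" by blast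
    define v where "v = Matrix.vec ?N (\<lambda>j. if j < m then u j else w (j - m))"
    have v: "v \<in> carrier_vec ?N" by (simp add: v_def)
    have Pv: "P (Matrix.vec_index v) = P u" "P (\<lambda>j. Matrix.vec_index v (m + j)) = P w"
      unfolding P_def v_def by (auto intro!: sum.cong)
    have "mult_mat_vec ?M v = 0\<^sub>v ?N"
      using Mv[OF v] M uw(2) by (intro eq_vecI) (auto simp: Pv)
    moreover have "v \<noteq> 0\<^sub>v ?N"
    proof
      assume "v = 0\<^sub>v ?N"
      then have "P (Matrix.vec_index v) = 0" "P (\<lambda>j. Matrix.vec_index v (m + j)) = 0"
        unfolding P_def by auto
      with uw(1) Pv show False by simp
    qed
    ultimately show "\<exists>v. v \<in> carrier_vec ?N \<and> v \<noteq> 0\<^sub>v ?N \<and> mult_mat_vec ?M v = 0\<^sub>v ?N" using v by blast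
  qed
  also have "\<dots> \<longleftrightarrow> multiple_root a d c"
  proof
    assume "\<exists>u w. (P u \<noteq> 0 \<or> P w \<noteq> 0) \<and> P u * g + P w * h = 0"
    then obtain u w where uw: "P u \<noteq> 0 \<or> P w \<noteq> 0" "P u * g + P w * h = 0" by blast
    show "multiple_root a d c"
    proof (rule ccontr)
      assume "\<not> ?thesis"
      then have no: "\<And>z. \<not> (poly g z = 0 \<and> poly h z = 0)"
        and nt: "Polynomial.coeff g m \<noteq> 0 \<or> Polynomial.coeff h m \<noteq> 0"
        unfolding root by blast+
      have eq1: "P u * g = (- P w) * h" and eq2: "P w * h = (- P u) * g"
        using uw(2) by (auto simp: add_eq_0_iff)
      have small: "q = 0" if "p dvd q" "Polynomial.coeff p m \<noteq> 0" "q = 0 \<or> degree q < m" for p q :: "complex poly"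
        using that dvd_imp_degree_le[of p q] le_degree[of p "m"] by force
      have gh: "g \<noteq> 0 \<or> h \<noteq> 0" using nt by auto
      show False using nt
      proof
        assume ng: "Polynomial.coeff g m \<noteq> 0"
        then have g0: "g \<noteq> 0" by auto
        then have "g dvd - P w" using dvd_cancel_no_common_root[OF _ _ eq1] no by blast
        then have "P w = 0" using small[of g "P w"] ng degP[of w] by simp
        with uw g0 show False by simp
      next
        assume nh: "Polynomial.coeff h m \<noteq> 0"
        then have h0: "h \<noteq> 0" by auto
        then have "h dvd - P u" using dvd_cancel_no_common_root[OF _ _ eq2] no by blast
        then have "P u = 0" using small[of h "P u"] nh degP[of u] by simp
        with uw h0 show False by simp
      qed
    qed
  next
    assume "multiple_root a d c"
    then consider z where "poly g z = 0" "poly h z = 0"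
      | "Polynomial.coeff g m = 0" "Polynomial.coeff h m = 0"
      unfolding root by blast
    then show "\<exists>u w. (P u \<noteq> 0 \<or> P w \<noteq> 0) \<and> P u * g + P w * h = 0"
    proof cases
      case 1
      then have "[:- z, 1:] dvd g" "[:- z, 1:] dvd h" by (simp_all add: poly_eq_0_iff_dvd)
      then obtain g' h' where gh: "g = [:- z, 1:] * g'" "h = [:- z, 1:] * h'" unfolding dvd_def by blast
      have deg: "Polynomial.coeff q i = 0" if "degree ([:- z, 1:] * q) \<le> m" "i \<ge> m" for q i
      proof (cases "q = 0")
        case False
        then have "degree ([:- z, 1:] * q) = Suc (degree q)" by (subst degree_mult_eq) auto
        then show ?thesis using that by (intro coeff_eq_0) auto
      qed simp
      have "P (Polynomial.coeff h') = h'" "P (Polynomial.coeff (- g')) = - g'"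
        using deg degg unfolding gh by (intro P_surj; simp)+
      moreover have "h' * (l * g') + (- g') * (l * h') = 0" for l by (simp add: algebra_simps)
      then have "h' * g + (- g') * h = 0" unfolding gh .
      moreover have "h' \<noteq> 0 \<or> - g' \<noteq> 0" using \<open>\<not> (g = 0 \<and> h = 0)\<close> gh by auto
      ultimately show ?thesis
        by (intro exI[of _ "Polynomial.coeff h'"] exI[of _ "Polynomial.coeff (- g')"]) simp
    next
      case 2
      have small: "Polynomial.coeff q i = 0" if "degree q \<le> m" "Polynomial.coeff q m = 0" "i \<ge> m" for q :: "complex poly" and i
        using that by (cases "i = m") (auto intro: coeff_eq_0)
      have "P (Polynomial.coeff h) = h" by (rule P_surj, rule small) (use 2 degg in auto)
      moreover have "P (Polynomial.coeff (- g)) = - g" by (rule P_surj, rule small) (use 2 degg in auto)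
      moreover have "h * g + (- g) * h = 0" by simp
      moreover have "h \<noteq> 0 \<or> - g \<noteq> 0" using \<open>\<not> (g = 0 \<and> h = 0)\<close> by auto
      ultimately show ?thesis
        by (intro exI[of _ "Polynomial.coeff h"] exI[of _ "Polynomial.coeff (- g)"]) simp
    qed
  qed
  finally show ?thesis .
qed

lemma ceval_form_discriminant: "ceval (form_discriminant a d) c = Determinant.det (form_sylvester a d c)"
proof -
  interpret comm_ring_hom "\<lambda>f. ceval f c" by (rule comm_ring_hom_ceval)
  have "ceval (dx_coeff a d pvar k) c = dx_coeff a d c k" "ceval (dy_coeff a d pvar k) c = dy_coeff a d c k" for k
    by (simp_all add: dx_coeff_def dy_coeff_def ceval_mult del: of_nat_Suc of_nat_diff)
  then have "map_mat (\<lambda>f. ceval f c) (form_sylvester a d pvar) = form_sylvester a d c"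
    by (intro eq_matI) (auto simp: form_sylvester_def sylvester_entry_def)
  then show ?thesis unfolding form_discriminant_def by (simp flip: hom_det)
qed

lemma sylvester_entry_pvar:
  "sylvester_entry a d pvar i j \<in> cpolys {a..d}" "homogeneous 1 (sylvester_entry a d pvar i j)"
proof -
  have "dx_coeff a d pvar k \<in> cpolys {a..d}" "homogeneous 1 (dx_coeff a d pvar k)"
    "dy_coeff a d pvar k \<in> cpolys {a..d}" "homogeneous 1 (dy_coeff a d pvar k)" for k
    unfolding dx_coeff_def dy_coeff_def
    by (auto simp del: of_nat_Suc of_nat_diff One_nat_def intro!: cpolys_mult cpolys_of_nat cpolys_pvar
          homogeneous_of_nat_mult homogeneous_pvar)
  then show "sylvester_entry a d pvar i j \<in> cpolys {a..d}" "homogeneous 1 (sylvester_entry a d pvar i j)"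
    unfolding sylvester_entry_def by auto
qed

text \<open>In Leibniz' formula each product consists of 2 (d - a - 1) entries, all of them linear
  forms or 0.\<close>

lemma form_discriminant:
  "form_discriminant a d \<in> cpolys {a..d}" "homogeneous (2 * (d - a - 1)) (form_discriminant a d)"
proof -
  let ?N = "2 * (d - a - 1)"
  let ?e = "\<lambda>p. \<Prod>i = 0..<?N. sylvester_entry a d pvar i (p i)"
  have M: "form_sylvester a d pvar \<in> carrier_mat ?N ?N" by (simp add: form_sylvester_def)
  have "form_discriminant a d = (\<Sum>p\<in>{p. p permutes {0..<?N}}. signof p * (\<Prod>i = 0..<?N. (form_sylvester a d pvar) $$ (i, p i)))"
    unfolding form_discriminant_def by (rule det_def'[OF M])
  also have "\<dots> = (\<Sum>p\<in>{p. p permutes {0..<?N}}. signof p * ?e p)"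
  proof (intro sum.cong refl arg_cong2[where f = "(*)"] prod.cong)
    fix p i assume "p \<in> {p. p permutes {0..<?N}}" "i \<in> {0..<?N}"
    then have "p i < ?N" using permutes_in_image[of p "{0..<?N}" i] by auto
    then show "(form_sylvester a d pvar :: cmpoly Matrix.mat) $$ (i, p i) = sylvester_entry a d pvar i (p i)"
      using \<open>i \<in> _\<close> by (simp add: form_sylvester_def)
  qed
  finally have eq: "form_discriminant a d = (\<Sum>p\<in>{p. p permutes {0..<?N}}. signof p * ?e p)" .
  have s: "signof p * x = x \<or> signof p * x = - x" for p and x :: cmpoly
    by (simp add: sign_def)
  have e1: "?e p \<in> cpolys {a..d}" for p by (intro cpolys_prod sylvester_entry_pvar)
  have e2: "homogeneous ?N (?e p)" for p
    using homogeneous_prod[of "{0..<?N}" "\<lambda>i. sylvester_entry a d pvar i (p i)"] sylvester_entry_pvar(2) by simp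
  have "signof p * ?e p \<in> cpolys {a..d} \<and> homogeneous ?N (signof p * ?e p)" for p
    using s[of p "?e p"]
  proof (elim disjE)
    assume eq: "signof p * ?e p = ?e p"
    show ?thesis unfolding eq using e1 e2 by blast
  next
    assume eq: "signof p * ?e p = - ?e p"
    show ?thesis unfolding eq using cpolys_uminus[OF e1] homogeneous_uminus[OF e2] by blast
  qed
  then show "form_discriminant a d \<in> cpolys {a..d}" "homogeneous ?N (form_discriminant a d)"
    unfolding eq by (auto intro!: cpolys_sum homogeneous_sum)
qed

text \<open>The determinant vanishes on the dual variety and is therefore a multiple of \<Delta>, so
  zeros of \<Delta> are multiple-root forms. Conversely \<Delta> belongs to the ideal that it
  generates. The determinant also witnesses that the dual variety is a hypersurface.\<close>

lemma X_discriminant: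
  assumes "a + 2 \<le> d" "is_X_discriminant {a..d} \<Delta>"
  shows "\<Delta> \<in> cpolys {a..d}" "\<Delta> \<noteq> 0" "\<And>c. c \<in> hcoords {a..d} \<Longrightarrow> ceval \<Delta> c = 0 \<longleftrightarrow> multiple_root a d c"
proof -
  let ?W = "{c \<in> hcoords {a..d}. multiple_root a d c}"
  let ?D = "form_discriminant a d"
  have W: "?W = proj_zeros {a..d} {?D}"
    using det_form_sylvester[OF assms(1)] by (auto simp: proj_zeros_def ceval_form_discriminant)
  have "proj_closed {a..d} ?W"
    unfolding W by (rule proj_closed_proj_zeros) (use form_discriminant in blast)
  then have Z: "dual_variety {a..d} (monomial_curve {a..d}) = ?W"
    using assms(1) by (simp add: dual_variety_def monomial_curve_eq tangent_hyperplanes_rnc_cone proj_closure_eq)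
  \<comment> \<open>The form with f = 1 + z^(d - a), which has no multiple root; so the determinant
    is not the zero polynomial.\<close>
  define e where "e i = (if i = a \<or> i = d then 1 else 0 :: complex)" for i
  have e: "e \<in> hcoords {a..d}"
  proof -
    have "e a \<noteq> 0" by (simp add: e_def)
    then have "e \<noteq> (\<lambda>_. 0)" by metis
    then show ?thesis using assms(1) by (auto simp: hcoords_def e_def)
  qed
  have "\<not> multiple_root a d e"
  proof
    assume "multiple_root a d e"
    then obtain z where z: "(\<Sum>i\<in>{a..d}. e i * z ^ (i - a)) = 0"
        "(\<Sum>i\<in>{a..d}. e i * (of_nat (i - a) * z ^ (i - a - 1))) = 0"
      by (auto simp: multiple_root_def e_def)
    have split: "(\<Sum>i\<in>{a..d}. e i * t i) = t a + t d" for t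
    proof -
      have "(\<Sum>i\<in>{a..d}. e i * t i) = (\<Sum>i\<in>{a, d}. e i * t i)"
        by (rule sum.mono_neutral_right) (use assms(1) in \<open>auto simp: e_def\<close>)
      also have "\<dots> = t a + t d" using assms(1) by (simp add: e_def)
      finally show ?thesis .
    qed
    have "of_nat (d - a) * z ^ (d - a - 1) = 0" using z(2) unfolding split by simp
    then have "z = 0" using assms(1) by auto
    then show False using z(1) assms(1) unfolding split by (simp add: zero_power)
  qed
  then have "ceval ?D e \<noteq> 0" using det_form_sylvester[OF assms(1) e] by (simp add: ceval_form_discriminant)
  then have D0: "?D \<noteq> 0" by auto
  have "?W \<noteq> {}"
  proof -
    \<comment> \<open>A constant f: since d - a \<ge> 2, both leading coefficients vanish and
      infinity is a multiple root.\<close>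
    define u where "u i = (if i = a then 1 else 0 :: complex)" for i
    have "u a \<noteq> 0" by (simp add: u_def)
    then have "u \<noteq> (\<lambda>_. 0)" by metis
    then have "u \<in> ?W" using assms(1) by (auto simp: hcoords_def u_def multiple_root_def)
    then show ?thesis by blast
  qed
  then have "proj_hypersurface {a..d} ?W"
    unfolding proj_hypersurface_def
  proof (intro conjI bexI[of _ ?D] exI[of _ "2 * (d - a - 1)"])
    show "0 < 2 * (d - a - 1)" using assms(1) by simp
    show "?W = proj_zeros {a..d} {?D}" by (rule W)
  qed (assumption | rule D0 form_discriminant)+
  then have \<Delta>: "\<Delta> \<in> cpolys {a..d}" "vanishing_ideal {a..d} ?W = {f \<in> cpolys {a..d}. \<Delta> dvd f}"
    using assms(2) unfolding is_X_discriminant_def Z by (simp_all add: Let_def)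
  show "\<Delta> \<in> cpolys {a..d}" by (rule \<Delta>(1))
  have "?D \<in> vanishing_ideal {a..d} ?W"
    unfolding W using form_discriminant(1) by (auto simp: vanishing_ideal_def proj_zeros_def)
  then have dvd: "\<Delta> dvd ?D" unfolding \<Delta>(2) by blast
  then show "\<Delta> \<noteq> 0" using D0 by auto
  have "\<Delta> \<in> vanishing_ideal {a..d} ?W" unfolding \<Delta>(2) using \<Delta>(1) by simp
  then have 1: "ceval \<Delta> c = 0" if "c \<in> ?W" for c using that unfolding vanishing_ideal_def by blast
  have 2: "c \<in> ?W" if "c \<in> hcoords {a..d}" "ceval \<Delta> c = 0" for c
    unfolding W using dvd that by (auto simp: proj_zeros_def ceval_mult elim!: dvdE)
  show "ceval \<Delta> c = 0 \<longleftrightarrow> multiple_root a d c" if "c \<in> hcoords {a..d}" for c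
    using 1 2 that by blast
qed

section \<open>Minimal monomials of the discriminant\<close>

definition discrete_convex :: "nat \<Rightarrow> nat \<Rightarrow> (nat \<Rightarrow> real) \<Rightarrow> bool" where
  "discrete_convex a d q \<longleftrightarrow> (\<forall>i. a < i \<and> i < d \<longrightarrow> 2 * q i \<le> q (i - 1) + q (i + 1))"

definition strictly_discrete_convex :: "nat \<Rightarrow> nat \<Rightarrow> (nat \<Rightarrow> real) \<Rightarrow> bool" where
  "strictly_discrete_convex a d q \<longleftrightarrow> (\<forall>i. a < i \<and> i < d \<longrightarrow> 2 * q i < q (i - 1) + q (i + 1))"

text \<open>The differences of q increase, so their sums in either direction from k stay above the
  line through the points at k and k + 1.\<close>

lemma discrete_convex_supporting_line:
  assumes conv: "discrete_convex a d q" and k: "a \<le> k" "k < d" and i: "i \<in> {a..d}"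
  shows "q k + (real i - real k) * (q (Suc k) - q k) \<le> q i"
proof -
  define \<sigma> where "\<sigma> = q (Suc k) - q k"
  have step: "q j - q (j - 1) \<le> q (Suc j) - q j" if "a < j" "j < d" for j
    using conv that unfolding discrete_convex_def by fastforce
  have right: "k + n < d \<Longrightarrow> \<sigma> \<le> q (Suc (k + n)) - q (k + n)" for n
  proof (induction n)
    case (Suc n)
    then show ?case using step[of "k + Suc n"] k by simp
  qed (simp add: \<sigma>_def)
  have left: "n \<le> k \<Longrightarrow> a \<le> k - n \<Longrightarrow> q (Suc (k - n)) - q (k - n) \<le> \<sigma>" for n
  proof (induction n)
    case (Suc n)
    then have eq: "Suc (k - Suc n) = k - n" "k - n - 1 = k - Suc n" by auto
    have "q (k - n) - q (k - n - 1) \<le> q (Suc (k - n)) - q (k - n)"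
      using Suc.prems k by (intro step) auto
    moreover have "a \<le> k - n" using Suc.prems by simp
    ultimately show ?case using Suc.IH Suc.prems unfolding eq by simp
  qed (simp add: \<sigma>_def)
  have R: "k + n \<le> d \<Longrightarrow> q k + real n * \<sigma> \<le> q (k + n)" for n
  proof (induction n)
    case (Suc n)
    then show ?case using right[of n] by (simp add: algebra_simps)
  qed simp
  have L: "n \<le> k \<Longrightarrow> a \<le> k - n \<Longrightarrow> q k - real n * \<sigma> \<le> q (k - n)" for n
  proof (induction n)
    case (Suc n)
    then have "Suc (k - Suc n) = k - n" by auto
    then show ?case using left[of "Suc n"] Suc by (simp add: algebra_simps)
  qed simp
  show ?thesis
  proof (cases "k \<le> i")
    case True
    then show ?thesis using R[of "i - k"] i by (simp add: \<sigma>_def of_nat_diff)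
  next
    case False
    then show ?thesis using L[of "k - i"] i by (simp add: \<sigma>_def of_nat_diff algebra_simps)
  qed
qed

text \<open>
  Two of the three moduli \<open>b (k - 1)\<close>, \<open>b k\<close>, \<open>b (k + 1)\<close> at the maximum \<open>k\<close> may be comparable; all the
  others are negligible.
\<close>

lemma log_concave_dominant:
  fixes b :: "nat \<Rightarrow> real"
  assumes "a \<le> d" and pos: "\<And>i. i \<in> {a..d} \<Longrightarrow> 0 < b i" and e: "0 < e" "e \<le> 1"
    and conc: "\<And>i. a < i \<Longrightarrow> i < d \<Longrightarrow> b (i - 1) * b (i + 1) \<le> e\<^sup>2 * (b i)\<^sup>2"
  shows "\<exists>k\<in>{a..d}. \<exists>p. (p = k + 1 \<or> p + 1 = k) \<and> (\<forall>i\<in>{a..d}. i \<noteq> k \<longrightarrow> i \<noteq> p \<longrightarrow> b i \<le> e * b k)"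
proof -
  have "Max (b ` {a..d}) \<in> b ` {a..d}" using assms(1) by (intro Max_in) auto
  then obtain k where k: "k \<in> {a..d}" "b k = Max (b ` {a..d})" by auto
  have max: "b i \<le> b k" if "i \<in> {a..d}" for i unfolding k(2) using that by (intro Max_ge) auto
  have e2: "e\<^sup>2 \<le> e" "e\<^sup>2 \<le> 1" using e by (auto simp: power2_eq_square mult_le_one mult_left_le)
  have small: "b (i + 1) \<le> e\<^sup>2 * b i" if "a < i" "i < d" "b i \<le> b (i - 1)" for i
  proof -
    have "b (i - 1) * b (i + 1) \<le> e\<^sup>2 * (b i * b i)" using conc[OF that(1,2)] by (simp add: power2_eq_square)
    also have "\<dots> \<le> e\<^sup>2 * (b (i - 1) * b i)"
      using that pos[of i] by (intro mult_left_mono mult_right_mono) auto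
    finally have "b (i - 1) * b (i + 1) \<le> b (i - 1) * (e\<^sup>2 * b i)" by (simp add: ac_simps)
    moreover have "0 < b (i - 1)" using that by (intro pos) auto
    ultimately show ?thesis by (rule mult_left_le_imp_le)
  qed
  have small': "b (i - 1) \<le> e\<^sup>2 * b i" if "a < i" "i < d" "b i \<le> b (i + 1)" for i
  proof -
    have "b (i - 1) * b (i + 1) \<le> e\<^sup>2 * (b i * b i)" using conc[OF that(1,2)] by (simp add: power2_eq_square)
    also have "\<dots> \<le> e\<^sup>2 * (b i * b (i + 1))"
      using that pos[of i] by (intro mult_left_mono) auto
    finally have "b (i - 1) * b (i + 1) \<le> (e\<^sup>2 * b i) * b (i + 1)" by (simp add: ac_simps)
    moreover have "0 < b (i + 1)" using that by (intro pos) auto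
    ultimately show ?thesis by (rule mult_right_le_imp_le)
  qed
  have le1: "e\<^sup>2 * b i \<le> b i" if "i \<in> {a..d}" for i
    using pos[OF that] e2 by (simp add: mult_left_le_one_le)
  have right: "Suc (k + n) \<le> d \<Longrightarrow> b (Suc (k + n)) \<le> b (k + n)" for n
  proof (induction n)
    case 0
    then show ?case using max[of "Suc k"] k by simp
  next
    case (Suc n)
    have "b (k + Suc n + 1) \<le> e\<^sup>2 * b (k + Suc n)"
      using Suc k by (intro small) auto
    also have "\<dots> \<le> b (k + Suc n)" using Suc k by (intro le1) auto
    finally show ?case by simp
  qed
  have R2: "b (k + 2 + n) \<le> e * b k" if "k + 2 + n \<le> d" for n
  proof -
    have "b (k + 1 + 1) \<le> e\<^sup>2 * b (k + 1)" using that k max[of "k + 1"] by (intro small) auto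
    also have "\<dots> \<le> e\<^sup>2 * b k" using that k max[of "k + 1"] by (intro mult_left_mono) auto
    also have "\<dots> \<le> e * b k" using e2 pos[OF k(1)] by (intro mult_right_mono) auto
    finally have base: "b (k + 2) \<le> e * b k" by simp
    show ?thesis using that
    proof (induction n)
      case (Suc n)
      then show ?case using right[of "2 + n"] by (simp add: algebra_simps)
    qed (use base in simp)
  qed
  have left: "Suc n \<le> k \<Longrightarrow> a \<le> k - Suc n \<Longrightarrow> b (k - Suc n) \<le> b (k - n)" for n
  proof (induction n)
    case 0
    then have "k - Suc 0 \<in> {a..d}" using k by auto
    then show ?case using max[of "k - Suc 0"] by simp
  next
    case (Suc n)
    have "b (k - Suc n - 1) \<le> e\<^sup>2 * b (k - Suc n)"
      using Suc k by (intro small') (auto simp: Suc_diff_Suc)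
    also have "\<dots> \<le> b (k - Suc n)" using Suc k by (intro le1) auto
    finally show ?case by simp
  qed
  have L2: "b (k - 2 - n) \<le> e * b k" if "2 + n \<le> k" "a \<le> k - 2 - n" for n
  proof -
    have k1: "k - 1 \<in> {a..d}" using that k by auto
    have "b (k - 1 - 1) \<le> e\<^sup>2 * b (k - 1)" using that k max[OF k1] by (intro small') auto
    also have "\<dots> \<le> e\<^sup>2 * b k" using max[OF k1] by (intro mult_left_mono) auto
    also have "\<dots> \<le> e * b k" using e2 pos[OF k(1)] by (intro mult_right_mono) auto
    finally have base: "b (k - 2) \<le> e * b k" by (simp add: numeral_2_eq_2)
    show ?thesis using that
    proof (induction n)
      case (Suc n)
      have "a \<le> k - 2 - n" using Suc.prems by linarith
      then show ?case using left[of "2 + n"] Suc by (simp add: algebra_simps)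
    qed (use base in simp)
  qed
  have far: "b i \<le> e * b k" if "i \<in> {a..d}" "i \<noteq> k" "i \<noteq> k + 1" "i + 1 \<noteq> k" for i
  proof (cases "k < i")
    case True
    then have "i = k + 2 + (i - k - 2)" using that by arith
    then obtain n where n: "i = k + 2 + n" by blast
    show ?thesis using R2[of n] that(1) unfolding n by simp
  next
    case False
    then have "k = i + 2 + (k - i - 2)" using that by arith
    then obtain n where n: "k = i + 2 + n" by blast
    then have "i = k - 2 - n" "2 + n \<le> k" by simp_all
    then show ?thesis using L2[of n] that(1) by simp
  qed
  \<comment> \<open>If both neighbours exceeded e b_k, their product would exceed e^2 b_k^2. Hence
    at most one neighbour competes with the maximum, and this one becomes p.\<close>
  have "b (k + 1) \<le> e * b k \<or> b (k - 1) \<le> e * b k" if "a < k" "k < d"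
  proof (rule ccontr)
    assume "\<not> ?thesis"
    moreover have "0 < b (k - 1)" using that k by (intro pos) auto
    ultimately have "(e * b k) * (e * b k) < b (k - 1) * b (k + 1)"
      using e pos[OF k(1)] by (intro mult_strict_mono) auto
    then show False using conc[OF that] by (simp add: power2_eq_square algebra_simps)
  qed
  then have alt: "k = d \<or> b (k + 1) \<le> e * b k \<or> k = a \<or> b (k - 1) \<le> e * b k"
    using k by fastforce
  have up: ?thesis if "\<And>i. i \<in> {a..d} \<Longrightarrow> i + 1 = k \<Longrightarrow> b i \<le> e * b k"
    using k(1) far that by (intro bexI[of _ k] exI[of _ "k + 1"]) blast+
  have down: ?thesis if "\<And>i. i \<in> {a..d} \<Longrightarrow> i = k + 1 \<Longrightarrow> b i \<le> e * b k"
  proof (cases "k = 0")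
    case True
    then show ?thesis by (intro up) auto
  next
    case False
    then obtain p where "p + 1 = k" by (metis Suc_eq_plus1 not0_implies_Suc)
    then show ?thesis
      using k(1) far that by (intro bexI[of _ k] exI[of _ p]) (metis add_right_cancel)+
  qed
  show ?thesis using alt
  proof (elim disjE)
    assume "k = d" show ?thesis by (rule down) (use \<open>k = d\<close> in auto)
  next
    assume "b (k + 1) \<le> e * b k" then show ?thesis by (intro down) simp
  next
    assume "k = a" show ?thesis by (rule up) (use \<open>k = a\<close> in auto)
  next
    assume *: "b (k - 1) \<le> e * b k" show ?thesis by (rule up) (use * in auto)
  qed
qed

text \<open>At a multiple root z both f(z) and z f'(z) vanish. The moduli of the terms of f(z) are
  log-concave with a gap, so all but two adjacent terms k and p are negligible, and a suitable
  combination removes p. In the factor (d + 1)^2 one d + 1 bounds the number of terms, the other one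
  bounds |i - p|.\<close>

lemma lacunary_no_multiple_root:
  fixes c :: "nat \<Rightarrow> complex"
  assumes "a < d" and nz: "\<And>i. i \<in> {a..d} \<Longrightarrow> c i \<noteq> 0"
    and e: "0 < e" "e * (real d + 1) ^ 2 < 1"
    and conc: "\<And>i. a < i \<Longrightarrow> i < d \<Longrightarrow> cmod (c (i - 1)) * cmod (c (i + 1)) \<le> e\<^sup>2 * (cmod (c i))\<^sup>2"
  shows "\<not> multiple_root a d c"
proof
  assume "multiple_root a d c"
  \<comment> \<open>A multiple root at infinity is excluded because c_d is nonzero.\<close>
  then obtain z where z: "(\<Sum>i\<in>{a..d}. c i * z ^ (i - a)) = 0"
      "(\<Sum>i\<in>{a..d}. c i * (of_nat (i - a) * z ^ (i - a - 1))) = 0"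
    using nz[of d] assms(1) by (auto simp: multiple_root_def)
  have z0: "z \<noteq> 0"
  proof
    assume "z = 0"
    then have "(\<Sum>i\<in>{a..d}. c i * z ^ (i - a)) = (\<Sum>i\<in>{a..d}. if a = i then c i else 0)"
      by (intro sum.cong) auto
    then show False using z(1) nz[of a] assms(1) by simp
  qed
  define b where "b i = cmod (c i * z ^ (i - a))" for i
  have b: "b i = cmod (c i) * cmod z ^ (i - a)" for i by (simp add: b_def norm_mult norm_power)
  have "1 \<le> (real d + 1) ^ 2" by (simp add: one_le_power)
  then have "e * 1 \<le> e * (real d + 1) ^ 2" using e(1) by (intro mult_left_mono) auto
  then have e1: "e \<le> 1" using e(2) by simp
  have "\<exists>k\<in>{a..d}. \<exists>p. (p = k + 1 \<or> p + 1 = k) \<and> (\<forall>i\<in>{a..d}. i \<noteq> k \<longrightarrow> i \<noteq> p \<longrightarrow> b i \<le> e * b k)"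
  proof (rule log_concave_dominant)
    show "0 < b i" if "i \<in> {a..d}" for i using nz[OF that] z0 by (simp add: b)
    fix i assume i: "a < i" "i < d"
    have "cmod z ^ (i - 1 - a) * cmod z ^ (i + 1 - a) = (cmod z ^ (i - a))\<^sup>2"
    proof -
      have "(i - 1 - a) + (i + 1 - a) = (i - a) + (i - a)" using i by auto
      then show ?thesis by (simp only: power2_eq_square flip: power_add)
    qed
    then have "b (i - 1) * b (i + 1) = (cmod (c (i - 1)) * cmod (c (i + 1))) * (cmod z ^ (i - a))\<^sup>2"
      unfolding b by (simp add: algebra_simps)
    also have "\<dots> \<le> (e\<^sup>2 * (cmod (c i))\<^sup>2) * (cmod z ^ (i - a))\<^sup>2"
      using conc[OF i] by (intro mult_right_mono) auto
    finally show "b (i - 1) * b (i + 1) \<le> e\<^sup>2 * (b i)\<^sup>2" by (simp add: b power_mult_distrib mult.assoc)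
  qed (use assms(1) e e1 in auto)
  then obtain k p where k: "k \<in> {a..d}" "p = k + 1 \<or> p + 1 = k"
    and small: "\<And>i. i \<in> {a..d} \<Longrightarrow> i \<noteq> k \<Longrightarrow> i \<noteq> p \<Longrightarrow> b i \<le> e * b k" by blast
  have "(\<Sum>i\<in>{a..d}. of_nat (i - a) * (c i * z ^ (i - a))) = z * (\<Sum>i\<in>{a..d}. c i * (of_nat (i - a) * z ^ (i - a - 1)))"
    unfolding sum_distrib_left
  proof (intro sum.cong refl)
    fix i
    show "of_nat (i - a) * (c i * z ^ (i - a)) = z * (c i * (of_nat (i - a) * z ^ (i - a - 1)))"
      by (cases "i - a") auto
  qed
  then have s1: "(\<Sum>i\<in>{a..d}. of_nat (i - a) * (c i * z ^ (i - a))) = 0" using z(2) by simp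
  text \<open>The linear combination of the two equations in which the term of index \<open>p\<close> cancels.\<close>
  have "(\<Sum>i\<in>{a..d}. (of_int (int i - int p)) * (c i * z ^ (i - a))) =
      (\<Sum>i\<in>{a..d}. of_nat (i - a) * (c i * z ^ (i - a))) + of_int (int a - int p) * (\<Sum>i\<in>{a..d}. c i * z ^ (i - a))"
    unfolding sum_distrib_left sum.distrib[symmetric]
    by (intro sum.cong refl) (auto simp: of_nat_diff algebra_simps)
  then have "(\<Sum>i\<in>{a..d}. (of_int (int i - int p)) * (c i * z ^ (i - a))) = 0" using s1 z(1) by simp
  then have "(of_int (int k - int p)) * (c k * z ^ (k - a)) =
      - (\<Sum>i\<in>{a..d} - {k}. (of_int (int i - int p)) * (c i * z ^ (i - a)))"
    using k(1) by (simp add: sum.remove add_eq_0_iff)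
  then have "cmod ((of_int (int k - int p)) * (c k * z ^ (k - a))) =
      cmod (\<Sum>i\<in>{a..d} - {k}. (of_int (int i - int p)) * (c i * z ^ (i - a)))" by simp
  moreover have "cmod (of_int (int k - int p)) = 1"
  proof -
    have "int k - int p = 1 \<or> int k - int p = -1" using k(2) by auto
    then show ?thesis by (elim disjE) simp_all
  qed
  ultimately have "b k = cmod (\<Sum>i\<in>{a..d} - {k}. (of_int (int i - int p)) * (c i * z ^ (i - a)))"
    by (simp add: norm_mult b_def)
  also have "\<dots> \<le> (\<Sum>i\<in>{a..d} - {k}. cmod ((of_int (int i - int p)) * (c i * z ^ (i - a))))"
    by (rule norm_sum)
  also have "\<dots> \<le> (\<Sum>i\<in>{a..d} - {k}. (real d + 1) * (e * b k))"
  proof (rule sum_mono)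
    fix i assume i: "i \<in> {a..d} - {k}"
    show "cmod ((of_int (int i - int p)) * (c i * z ^ (i - a))) \<le> (real d + 1) * (e * b k)"
    proof (cases "i = p")
      case True
      then show ?thesis using e(1) by (simp add: b_def)
    next
      case False
      have "cmod (of_int (int i - int p)) \<le> real d + 1"
        unfolding norm_of_int using i k by auto
      then show ?thesis
        unfolding norm_mult[of "of_int _"] b_def[symmetric] using small[of i] i False
        by (intro mult_mono) (auto simp: b_def)
    qed
  qed
  also have "\<dots> = real (card ({a..d} - {k})) * ((real d + 1) * (e * b k))" by simp
  also have "\<dots> \<le> (real d + 1) * ((real d + 1) * (e * b k))"
  proof (rule mult_right_mono)
    have "card ({a..d} - {k}) \<le> card {a..d}" by (intro card_mono) auto
    then show "real (card ({a..d} - {k})) \<le> real d + 1" by simp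
  qed (use e(1) in \<open>auto simp: b_def\<close>)
  also have "\<dots> = (e * (real d + 1) ^ 2) * b k" by (simp add: power2_eq_square)
  also have "\<dots> < 1 * b k" using e(2) nz[OF k(1)] z0 by (intro mult_strict_right_mono) (auto simp: b)
  finally show False by simp
qed

text \<open>The exponent of t in the monomial \<alpha> when the i-th coefficient has size t^(q i).
  With q taken from the values of Q_i at a form, it is also the value of the corresponding summand
  of the polyhedralised discriminant.\<close>

definition weight :: "nat \<Rightarrow> nat \<Rightarrow> (nat \<Rightarrow> real) \<Rightarrow> (nat \<Rightarrow>\<^sub>0 nat) \<Rightarrow> real" where
  "weight a d q \<alpha> = (\<Sum>i\<in>{a..d}. real (Poly_Mapping.lookup \<alpha> i) * q i)"

definition minimisers :: "nat \<Rightarrow> nat \<Rightarrow> (nat \<Rightarrow> real) \<Rightarrow> cmpoly \<Rightarrow> (nat \<Rightarrow>\<^sub>0 nat) set" where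
  "minimisers a d q \<Delta> = {\<alpha> \<in> Poly_Mapping.keys \<Delta>. \<forall>\<beta>\<in>Poly_Mapping.keys \<Delta>. weight a d q \<alpha> \<le> weight a d q \<beta>}"

lemma minimisers_nonempty: "\<Delta> \<noteq> 0 \<Longrightarrow> minimisers a d q \<Delta> \<noteq> {}"
proof -
  assume "\<Delta> \<noteq> 0"
  then have ne: "Poly_Mapping.keys \<Delta> \<noteq> {}" by (auto simp: poly_mapping_eq_iff in_keys_iff fun_eq_iff)
  have "Min (weight a d q ` Poly_Mapping.keys \<Delta>) \<in> weight a d q ` Poly_Mapping.keys \<Delta>"
    using ne by (intro Min_in) auto
  then obtain \<alpha> where "\<alpha> \<in> Poly_Mapping.keys \<Delta>" "weight a d q \<alpha> = Min (weight a d q ` Poly_Mapping.keys \<Delta>)" by auto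
  then have "\<alpha> \<in> minimisers a d q \<Delta>" by (simp add: minimisers_def)
  then show ?thesis by blast
qed

lemma hcoordsI: "k \<in> I \<Longrightarrow> c k \<noteq> 0 \<Longrightarrow> (\<And>i. i \<notin> I \<Longrightarrow> c i = 0) \<Longrightarrow> c \<in> hcoords I"
  by (auto simp: hcoords_def)

text \<open>Positional notation: the weight \<open>D\<close> of the new variable exceeds all
  previous sums, which are thus recovered as remainders modulo \<open>D\<close>. Substituting s^(n
  i) for the variables then keeps distinct monomials distinct and reduces a polynomial to one
  variable.\<close>

lemma exists_separating_weights:
  assumes "finite K" "finite I"
  shows "\<exists>n :: nat \<Rightarrow> nat. \<forall>\<alpha>\<in>K. \<forall>\<beta>\<in>K. (\<Sum>i\<in>I. n i * Poly_Mapping.lookup \<alpha> i) = (\<Sum>i\<in>I. n i * Poly_Mapping.lookup \<beta> i) \<longrightarrow>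
     (\<forall>i\<in>I. Poly_Mapping.lookup \<alpha> i = Poly_Mapping.lookup (\<beta> :: nat \<Rightarrow>\<^sub>0 nat) i)"
  using assms(2)
proof (induction I rule: finite_induct)
  case (insert i I)
  then obtain n :: "nat \<Rightarrow> nat" where n: "\<And>\<alpha> \<beta>. \<alpha> \<in> K \<Longrightarrow> \<beta> \<in> K \<Longrightarrow>
      (\<Sum>i\<in>I. n i * Poly_Mapping.lookup \<alpha> i) = (\<Sum>i\<in>I. n i * Poly_Mapping.lookup \<beta> i) \<Longrightarrow>
      \<forall>i\<in>I. Poly_Mapping.lookup \<alpha> i = Poly_Mapping.lookup \<beta> i" by blast
  define v where "v \<alpha> = (\<Sum>i\<in>I. n i * Poly_Mapping.lookup \<alpha> i)" for \<alpha> :: "nat \<Rightarrow>\<^sub>0 nat"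
  define D where "D = Suc (\<Sum>\<alpha>\<in>K. v \<alpha>)"
  have D: "v \<alpha> < D" if "\<alpha> \<in> K" for \<alpha>
    unfolding D_def using member_le_sum[OF that, of v] assms(1) by (simp add: less_Suc_eq_le)
  have sum: "(\<Sum>j\<in>insert i I. (n(i := D)) j * Poly_Mapping.lookup \<alpha> j) = v \<alpha> + D * Poly_Mapping.lookup \<alpha> i" for \<alpha>
  proof -
    have "(\<Sum>j\<in>I. (n(i := D)) j * Poly_Mapping.lookup \<alpha> j) = v \<alpha>"
      unfolding v_def using insert.hyps by (intro sum.cong) auto
    then show ?thesis using insert.hyps by simp
  qed
  have "\<forall>j\<in>insert i I. Poly_Mapping.lookup \<alpha> j = Poly_Mapping.lookup \<beta> j"
    if "\<alpha> \<in> K" "\<beta> \<in> K" and eq: "v \<alpha> + D * Poly_Mapping.lookup \<alpha> i = v \<beta> + D * Poly_Mapping.lookup \<beta> i" for \<alpha> \<beta>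
  proof -
    have "v \<alpha> mod D = v \<beta> mod D" using arg_cong[OF eq, of "\<lambda>x. x mod D"] by simp
    then have v: "v \<alpha> = v \<beta>" using D[OF that(1)] D[OF that(2)] by simp
    moreover have "Poly_Mapping.lookup \<alpha> i = Poly_Mapping.lookup \<beta> i"
    proof -
      have "D * Poly_Mapping.lookup \<alpha> i = D * Poly_Mapping.lookup \<beta> i" using eq unfolding v by (rule add_left_imp_eq)
      moreover have "D \<noteq> 0" by (simp add: D_def)
      ultimately show ?thesis by (subst (asm) mult_cancel1) simp
    qed
    ultimately show ?thesis using n[OF that(1,2)] by (auto simp: v_def)
  qed
  then show ?case unfolding sum[symmetric] by (intro exI[of _ "n(i := D)"]) blast
qed simp

text \<open>If 0 were the only root, the cofactor of the power of the variable would have no zeros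
  and be constant, so p would be a monomial.\<close>

lemma poly_nonzero_root:
  fixes p :: "complex poly"
  assumes "Polynomial.coeff p i \<noteq> 0" "Polynomial.coeff p j \<noteq> 0" "i \<noteq> j"
  shows "\<exists>z. z \<noteq> 0 \<and> poly p z = 0"
proof (rule ccontr)
  assume no: "\<not> ?thesis"
  have "p \<noteq> 0" using assms(1) by auto
  then obtain k h where h: "p = [:0, 1:] ^ k * h" "\<not> [:0, 1:] dvd h"
    using order_decomp[of p 0] by auto
  have "poly h z \<noteq> 0" for z
  proof (cases "z = 0")
    case True
    then show ?thesis using h(2) by (simp add: poly_eq_0_iff_dvd)
  next
    case False
    then show ?thesis using no by (auto simp: h(1))
  qed
  then have "constant (poly h)" using fundamental_theorem_of_algebra by blast
  then have "degree h = 0" by (simp add: constant_degree)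
  then obtain e where "h = [:e:]" by (rule degree_eq_zeroE)
  then have "p = Polynomial.monom e k" unfolding h(1) by (simp add: monom_altdef)
  then show False using assms by (auto split: if_splits)
qed

lemma prod_powr_weight:
  assumes "t > 0"
  shows "(\<Prod>i\<in>{a..d}. (t powr q i) ^ Poly_Mapping.lookup \<alpha> i) = t powr weight a d q \<alpha>"
proof -
  have "t powr weight a d q \<alpha> = (\<Prod>i\<in>{a..d}. t powr (real (Poly_Mapping.lookup \<alpha> i) * q i))"
    unfolding weight_def using assms by (intro powr_sum) auto
  also have "\<dots> = (\<Prod>i\<in>{a..d}. (t powr q i) ^ Poly_Mapping.lookup \<alpha> i)"
    using assms by (intro prod.cong refl) (simp add: powr_def exp_of_nat_mult[symmetric] algebra_simps)
  finally show ?thesis ..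
qed

lemma cpolys_keys_eqI:
  assumes "\<Delta> \<in> cpolys I" "\<alpha> \<in> Poly_Mapping.keys \<Delta>" "\<beta> \<in> Poly_Mapping.keys \<Delta>"
    "\<And>i. i \<in> I \<Longrightarrow> Poly_Mapping.lookup \<alpha> i = Poly_Mapping.lookup \<beta> i"
  shows "\<alpha> = \<beta>"
proof (rule poly_mapping_eqI)
  fix i
  have "Poly_Mapping.keys \<alpha> \<subseteq> I" "Poly_Mapping.keys \<beta> \<subseteq> I" using assms(1-3) by (auto simp: cpolys_def)
  then show "Poly_Mapping.lookup \<alpha> i = Poly_Mapping.lookup \<beta> i"
  proof (cases "i \<in> I")
    case False
    then have "i \<notin> Poly_Mapping.keys \<alpha>" "i \<notin> Poly_Mapping.keys \<beta>" using \<open>Poly_Mapping.keys \<alpha> \<subseteq> I\<close> \<open>Poly_Mapping.keys \<beta> \<subseteq> I\<close> by blast+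
    then show ?thesis by (simp add: in_keys_iff)
  qed (rule assms(4))
qed

text \<open>The coefficients c_i = s^(n i) t^(q i) are used, with n separating the monomials. As t
  tends to 0, the rescaled \<Delta>(c) tends to a polynomial p(s) that collects the monomials of
  minimal weight. Two of them give p a nonzero root, hence \<Delta> a zero of this shape for small
  t, which contradicts lacunarity.\<close>

lemma strictly_convex_unique_minimiser:
  assumes ad: "a + 2 \<le> d" and \<Delta>: "\<Delta> \<in> cpolys {a..d}"
    and root: "\<And>c. c \<in> hcoords {a..d} \<Longrightarrow> ceval \<Delta> c = 0 \<Longrightarrow> multiple_root a d c"
    and q: "strictly_discrete_convex a d q"
    and \<alpha>: "\<alpha> \<in> minimisers a d q \<Delta>" and \<beta>: "\<beta> \<in> minimisers a d q \<Delta>"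
  shows "\<alpha> = \<beta>"
proof (rule ccontr)
  assume ne: "\<alpha> \<noteq> \<beta>"
  let ?K = "Poly_Mapping.keys \<Delta>"
  let ?M = "minimisers a d q \<Delta>"
  define w where "w = weight a d q"
  define m where "m = w \<alpha>"
  have wm: "m \<le> w \<gamma>" if "\<gamma> \<in> ?K" for \<gamma> using \<alpha> that by (simp add: minimisers_def m_def w_def)
  have \<alpha>K: "\<alpha> \<in> ?K" using \<alpha> by (simp add: minimisers_def)
  have M: "?M = {\<gamma> \<in> ?K. w \<gamma> = m}"
  proof (intro equalityI subsetI)
    fix \<gamma> assume "\<gamma> \<in> ?M"
    then have "\<gamma> \<in> ?K" "w \<gamma> \<le> m" using \<alpha>K by (auto simp: minimisers_def m_def w_def)
    with wm[of \<gamma>] show "\<gamma> \<in> {\<gamma> \<in> ?K. w \<gamma> = m}" by simp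
  next
    fix \<gamma> assume "\<gamma> \<in> {\<gamma> \<in> ?K. w \<gamma> = m}"
    then show "\<gamma> \<in> ?M" using wm by (simp add: minimisers_def w_def)
  qed
  obtain n :: "nat \<Rightarrow> nat" where n: "\<And>\<gamma> \<gamma>'. \<gamma> \<in> ?K \<Longrightarrow> \<gamma>' \<in> ?K \<Longrightarrow>
      (\<Sum>i\<in>{a..d}. n i * Poly_Mapping.lookup \<gamma> i) = (\<Sum>i\<in>{a..d}. n i * Poly_Mapping.lookup \<gamma>' i) \<Longrightarrow>
      \<forall>i\<in>{a..d}. Poly_Mapping.lookup \<gamma> i = Poly_Mapping.lookup \<gamma>' i"
    using exists_separating_weights[of ?K "{a..d}"] by auto
  define N where "N \<gamma> = (\<Sum>i\<in>{a..d}. n i * Poly_Mapping.lookup \<gamma> i)" for \<gamma>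
  have N_inj: "\<gamma> = \<gamma>'" if "\<gamma> \<in> ?K" "\<gamma>' \<in> ?K" "N \<gamma> = N \<gamma>'" for \<gamma> \<gamma>'
    using cpolys_keys_eqI[OF \<Delta> that(1,2)] n[OF that(1,2)] that(3) by (simp add: N_def)
  \<comment> \<open>The initial form of \<Delta>, restricted to the curve with coordinates s^(n i).
    No terms are merged because \<open>N\<close> is injective on the monomials.\<close>
  define p where "p = (\<Sum>\<gamma>\<in>?M. Polynomial.monom (Poly_Mapping.lookup \<Delta> \<gamma>) (N \<gamma>))"
  have MK: "?M \<subseteq> ?K" "finite ?M" by (auto simp: M)
  have coeff_p: "Polynomial.coeff p (N \<gamma>) = Poly_Mapping.lookup \<Delta> \<gamma>" if "\<gamma> \<in> ?M" for \<gamma>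
  proof -
    have "Polynomial.coeff p (N \<gamma>) = (\<Sum>\<gamma>'\<in>?M. if \<gamma>' = \<gamma> then Poly_Mapping.lookup \<Delta> \<gamma>' else 0)"
      unfolding p_def coeff_sum using N_inj MK(1) that by (intro sum.cong refl) (auto simp: subset_iff)
    then show ?thesis using that MK(2) by simp
  qed
  have "\<exists>z. z \<noteq> 0 \<and> poly p z = 0"
  proof (rule poly_nonzero_root)
    show "Polynomial.coeff p (N \<alpha>) \<noteq> 0" "Polynomial.coeff p (N \<beta>) \<noteq> 0"
      using \<alpha> \<beta> MK(1) by (auto simp: coeff_p in_keys_iff)
    show "N \<alpha> \<noteq> N \<beta>" using N_inj \<alpha> \<beta> MK(1) ne by blast
  qed
  then obtain s0 where s0: "s0 \<noteq> 0" "poly p s0 = 0" by blast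
  have p0: "p \<noteq> 0" using coeff_p[OF \<alpha>] \<alpha> MK(1) by (auto simp: in_keys_iff)
  \<comment> \<open>On the ball of this radius around s0, |s| lies between r and 3 r; so s is
    nonzero and its powers are bounded on both sides.\<close>
  define r where "r = cmod s0 / 2"
  have r: "r > 0" using s0 by (simp add: r_def)
  let ?S = "ball s0 r"
  have S: "r \<le> cmod s" "cmod s \<le> 3 * r" "s \<noteq> 0" if "s \<in> ?S" for s
  proof -
    have "cmod (s0 - s) < r" using that by (simp add: dist_norm)
    moreover have "cmod s0 = 2 * r" by (simp add: r_def)
    ultimately show "r \<le> cmod s" "cmod s \<le> 3 * r"
      using norm_triangle_ineq2[of s0 "s0 - s"] norm_triangle_ineq4[of s0 "s0 - s"] by auto
    then show "s \<noteq> 0" using r by auto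
  qed
  define \<tau> where "\<tau> k = inverse (real (Suc k))" for k
  have \<tau>0: "\<tau> k > 0" for k by (simp add: \<tau>_def)
  have \<tau>_lim: "(\<lambda>k. \<tau> k powr x) \<longlonglongrightarrow> 0" if "x > 0" for x
  proof -
    have "\<tau> \<longlonglongrightarrow> 0" unfolding \<tau>_def by (rule LIMSEQ_inverse_real_of_nat)
    then have "(\<lambda>k. \<tau> k powr x) \<longlonglongrightarrow> 0 powr x"
      using that \<tau>0 by (intro tendsto_powr') (auto intro: always_eventually less_imp_le)
    then show ?thesis using that by simp
  qed
  \<comment> \<open>This is \<Delta>(c) for t = \<open>\<tau> k\<close>, divided by t^m; its terms
    of weight m add up to \<open>poly p s\<close>.\<close>
  define F where "F k s = (\<Sum>\<gamma>\<in>?K. Poly_Mapping.lookup \<Delta> \<gamma> * of_real (\<tau> k powr (w \<gamma> - m)) * s ^ N \<gamma>)" for k s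
  define e where "e = 1 / ((real d + 1) ^ 2 + 1)"
  have pos1: "(real d + 1) ^ 2 + 1 > 0" by (rule add_nonneg_pos) auto
  then have e: "0 < e" "e * (real d + 1) ^ 2 < 1" by (simp_all add: e_def)
  \<comment> \<open>\<open>B i\<close> bounds what the powers of s contribute to |c_(i-1) c_(i+1)| /
    |c_i|^2. The powers of t contribute \<open>\<tau> k powr \<delta> i\<close> with the positive
    second difference \<open>\<delta> i\<close>, so for large k the quotient is below e^2, as
    lacunarity demands.\<close>
  define B where "B i = (3 * r) ^ n (i - 1) * (3 * r) ^ n (i + 1) / (r ^ n i)\<^sup>2" for i
  define \<delta> where "\<delta> i = q (i - 1) + q (i + 1) - 2 * q i" for i
  have "\<forall>\<^sub>F k in sequentially. \<forall>i\<in>{a<..<d}. B i * \<tau> k powr \<delta> i < e\<^sup>2"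
  proof (intro eventually_ball_finite ballI)
    fix i assume "i \<in> {a<..<d}"
    then have "\<delta> i > 0" using q by (auto simp: strictly_discrete_convex_def \<delta>_def)
    then have "(\<lambda>k. B i * \<tau> k powr \<delta> i) \<longlonglongrightarrow> B i * 0" by (intro tendsto_intros \<tau>_lim)
    then show "\<forall>\<^sub>F k in sequentially. B i * \<tau> k powr \<delta> i < e\<^sup>2"
      by (rule order_tendstoD(2)) (use e in auto)
  qed simp
  then obtain k0 where k0: "\<And>k i. k \<ge> k0 \<Longrightarrow> i \<in> {a<..<d} \<Longrightarrow> B i * \<tau> k powr \<delta> i < e\<^sup>2"
    unfolding eventually_sequentially by blast
  have "\<exists>k\<ge>k0. \<exists>s\<in>?S. F k s = 0"
  proof (rule ccontr)
    assume no: "\<not> ?thesis"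
    have "poly p s0 \<noteq> 0"
    proof (rule Hurwitz_no_zeros[of ?S "\<lambda>k. F (k + k0)" "poly p"])
      show "(F (k + k0)) holomorphic_on ?S" for k unfolding F_def by (intro holomorphic_intros)
      show "poly p holomorphic_on ?S" by (intro holomorphic_intros)
      show "\<not> poly p constant_on ?S"
      proof
        assume "poly p constant_on ?S"
        then obtain y where y: "\<And>s. s \<in> ?S \<Longrightarrow> poly p s = y" unfolding constant_on_def by blast
        then have "y = 0" using y[of s0] s0 r by simp
        then have "?S \<subseteq> {s. poly p s = 0}" using y by blast
        then have "finite ?S" using poly_roots_finite[OF p0] finite_subset by blast
        then show False using finite_imp_not_open[of ?S] r by auto
      qed
      show "uniform_limit K (\<lambda>k. F (k + k0)) (poly p) sequentially" if "compact K" "K \<subseteq> ?S" for K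
      proof (rule uniform_limitI)
        fix \<epsilon> :: real assume "\<epsilon> > 0"
        define h where "h k = (\<Sum>\<gamma>\<in>?K - ?M. cmod (Poly_Mapping.lookup \<Delta> \<gamma>) * \<tau> k powr (w \<gamma> - m) * (3 * r) ^ N \<gamma>)" for k
        have "h \<longlonglongrightarrow> (\<Sum>\<gamma>\<in>?K - ?M. cmod (Poly_Mapping.lookup \<Delta> \<gamma>) * 0 * (3 * r) ^ N \<gamma>)"
          unfolding h_def
        proof (intro tendsto_intros \<tau>_lim)
          fix \<gamma> assume "\<gamma> \<in> ?K - ?M"
          then show "0 < w \<gamma> - m" using wm[of \<gamma>] by (auto simp: M)
        qed
        then have "h \<longlonglongrightarrow> 0" by simp
        then have "(\<lambda>k. h (k + k0)) \<longlonglongrightarrow> 0" by (rule LIMSEQ_ignore_initial_segment)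
        then have "\<forall>\<^sub>F k in sequentially. h (k + k0) < \<epsilon>" using \<open>\<epsilon> > 0\<close> by (rule order_tendstoD(2))
        moreover have "dist (F k s) (poly p s) \<le> h k" if "s \<in> K" for k s
        proof -
          have s: "cmod s \<le> 3 * r" using S \<open>K \<subseteq> ?S\<close> that by blast
          have "F k s = (\<Sum>\<gamma>\<in>?M. Poly_Mapping.lookup \<Delta> \<gamma> * of_real (\<tau> k powr (w \<gamma> - m)) * s ^ N \<gamma>) +
              (\<Sum>\<gamma>\<in>?K - ?M. Poly_Mapping.lookup \<Delta> \<gamma> * of_real (\<tau> k powr (w \<gamma> - m)) * s ^ N \<gamma>)"
            unfolding F_def using MK by (subst sum.subset_diff[of ?M]) (auto simp: add.commute)
          also have "(\<Sum>\<gamma>\<in>?M. Poly_Mapping.lookup \<Delta> \<gamma> * of_real (\<tau> k powr (w \<gamma> - m)) * s ^ N \<gamma>) = poly p s"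
            unfolding p_def poly_sum poly_monom using \<tau>0[of k] by (intro sum.cong) (auto simp: M)
          finally have "dist (F k s) (poly p s) =
              cmod (\<Sum>\<gamma>\<in>?K - ?M. Poly_Mapping.lookup \<Delta> \<gamma> * of_real (\<tau> k powr (w \<gamma> - m)) * s ^ N \<gamma>)"
            by (simp add: dist_norm)
          also have "\<dots> \<le> (\<Sum>\<gamma>\<in>?K - ?M. cmod (Poly_Mapping.lookup \<Delta> \<gamma> * of_real (\<tau> k powr (w \<gamma> - m)) * s ^ N \<gamma>))"
            by (rule norm_sum)
          also have "\<dots> \<le> h k"
            unfolding h_def norm_mult norm_power norm_of_real abs_of_nonneg[OF powr_ge_zero]
            using s by (intro sum_mono mult_left_mono power_mono) auto
          finally show ?thesis .
        qed
        ultimately show "\<forall>\<^sub>F k in sequentially. \<forall>s\<in>K. dist (F (k + k0) s) (poly p s) < \<epsilon>"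
          by (elim eventually_mono) (meson le_less_trans)
      qed
      show "F (k + k0) s \<noteq> 0" if "s \<in> ?S" for k s using no that by auto
    qed (use r in auto)
    with s0 show False by simp
  qed
  then obtain k s where k: "k \<ge> k0" and s: "s \<in> ?S" and F0: "F k s = 0" by blast
  define t where "t = \<tau> k"
  have t: "t > 0" by (simp add: t_def \<tau>0)
  define c where "c i = (if i \<in> {a..d} then s ^ n i * of_real (t powr q i) else 0)" for i
  have cnz: "c i \<noteq> 0" if "i \<in> {a..d}" for i using that S(3)[OF s] t by (auto simp: c_def)
  have c: "c \<in> hcoords {a..d}" by (rule hcoordsI[of a]) (use cnz[of a] ad in \<open>auto simp: c_def\<close>)
  have "ceval \<Delta> c = (\<Sum>\<gamma>\<in>?K. Poly_Mapping.lookup \<Delta> \<gamma> * (\<Prod>i\<in>{a..d}. c i ^ Poly_Mapping.lookup \<gamma> i))"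
    using \<Delta> by (rule ceval_cpolys) simp
  also have "\<dots> = (\<Sum>\<gamma>\<in>?K. of_real (t powr m) * (Poly_Mapping.lookup \<Delta> \<gamma> * of_real (t powr (w \<gamma> - m)) * s ^ N \<gamma>))"
  proof (intro sum.cong refl)
    fix \<gamma>
    have "(\<Prod>i\<in>{a..d}. c i ^ Poly_Mapping.lookup \<gamma> i) =
        (\<Prod>i\<in>{a..d}. s ^ (n i * Poly_Mapping.lookup \<gamma> i)) * (\<Prod>i\<in>{a..d}. of_real ((t powr q i) ^ Poly_Mapping.lookup \<gamma> i))"
      unfolding prod.distrib[symmetric] by (intro prod.cong) (auto simp: c_def power_mult_distrib power_mult)
    also have "(\<Prod>i\<in>{a..d}. s ^ (n i * Poly_Mapping.lookup \<gamma> i)) = s ^ N \<gamma>"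
      by (simp add: N_def power_sum)
    also have "(\<Prod>i\<in>{a..d}. of_real ((t powr q i) ^ Poly_Mapping.lookup \<gamma> i)) = (of_real (t powr w \<gamma>) :: complex)"
      unfolding w_def prod_powr_weight[OF t, symmetric] by simp
    also have "t powr w \<gamma> = t powr m * t powr (w \<gamma> - m)" by (simp flip: powr_add)
    finally show "Poly_Mapping.lookup \<Delta> \<gamma> * (\<Prod>i\<in>{a..d}. c i ^ Poly_Mapping.lookup \<gamma> i) =
        of_real (t powr m) * (Poly_Mapping.lookup \<Delta> \<gamma> * of_real (t powr (w \<gamma> - m)) * s ^ N \<gamma>)"
      by (simp add: ac_simps)
  qed
  also have "\<dots> = of_real (t powr m) * F k s" by (simp add: F_def t_def sum_distrib_left)
  finally have "multiple_root a d c" using F0 by (intro root[OF c]) simp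
  moreover have "\<not> multiple_root a d c"
  proof (rule lacunary_no_multiple_root[OF _ cnz e])
    fix i assume i: "a < i" "i < d"
    have cm: "cmod (c j) = cmod s ^ n j * t powr q j" if "j \<in> {a..d}" for j
      using that by (simp add: c_def norm_mult norm_power)
    have "cmod s ^ n (i - 1) * cmod s ^ n (i + 1) \<le> (3 * r) ^ n (i - 1) * (3 * r) ^ n (i + 1)"
      using S(2)[OF s] r by (intro mult_mono power_mono) auto
    also have "\<dots> = B i * (r ^ n i)\<^sup>2" using r by (simp add: B_def)
    also have "\<dots> \<le> B i * (cmod s ^ n i)\<^sup>2"
      using S(1)[OF s] r by (intro mult_left_mono power_mono) (auto simp: B_def)
    finally have 1: "cmod s ^ n (i - 1) * cmod s ^ n (i + 1) \<le> B i * (cmod s ^ n i)\<^sup>2" .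
    have 2: "t powr q (i - 1) * t powr q (i + 1) = t powr \<delta> i * (t powr q i)\<^sup>2"
      by (simp add: \<delta>_def power2_eq_square flip: powr_add)
    have "cmod (c (i - 1)) * cmod (c (i + 1)) =
        (cmod s ^ n (i - 1) * cmod s ^ n (i + 1)) * (t powr q (i - 1) * t powr q (i + 1))"
    proof -
      have "i - 1 \<in> {a..d}" "i + 1 \<in> {a..d}" using i by auto
      then show ?thesis by (simp only: cm) (simp only: ac_simps)
    qed
    also have "\<dots> \<le> (B i * (cmod s ^ n i)\<^sup>2) * (t powr \<delta> i * (t powr q i)\<^sup>2)"
      unfolding 2 using 1 by (rule mult_right_mono) simp
    also have "\<dots> = (B i * t powr \<delta> i) * (cmod (c i))\<^sup>2"
      using i by (simp add: cm power_mult_distrib)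
    also have "\<dots> \<le> e\<^sup>2 * (cmod (c i))\<^sup>2"
      using k0[OF k, of i] i by (intro mult_right_mono) (auto simp: t_def)
    finally show "cmod (c (i - 1)) * cmod (c (i + 1)) \<le> e\<^sup>2 * (cmod (c i))\<^sup>2" .
  qed (use ad in auto)
  ultimately show False by simp
qed

text \<open>All coefficients except those of indices k - 1 and k are prescribed with the required
  size, and these two are solved for so that a chosen z is a double root. The difficulty is to keep
  the two solutions from becoming too small; an enlarged coefficient at k + 1 prevents this.\<close>

lemma double_root_family:
  assumes ad: "a + 2 \<le> d" and q: "discrete_convex a d q" and k: "a < k" "k < d" "2 * q k = q (k - 1) + q (k + 1)"
  shows "\<exists>C. \<forall>t. 0 < t \<longrightarrow> t < 1 \<longrightarrow> (\<exists>c\<in>hcoords {a..d}. multiple_root a d c \<and>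
            (\<forall>i\<in>{a..d}. t powr q i \<le> cmod (c i) \<and> cmod (c i) \<le> C * t powr q i))"
proof (intro exI allI impI)
  fix t :: real assume t: "0 < t" "t < 1"
  define n where "n = real d + 1"
  have n: "n \<ge> 1" "n \<le> n\<^sup>2" by (auto simp: n_def power2_eq_square)
  let ?I = "{a..d}"
  define J where "J = ?I - {k - 1, k, k + 1}"
  have I: "?I = insert (k - 1) (insert k (insert (k + 1) J))" using k by (auto simp: J_def)
  have nJ: "k - 1 \<notin> insert k (insert (k + 1) J)" "k \<notin> insert (k + 1) J" "k + 1 \<notin> J" "finite J"
    using k by (auto simp: J_def)
  \<comment> \<open>The common slope of q at k is -s. With |z| = t^s the terms of indices k - 1, k,
    k + 1 all have exponent m, and the supporting line shows that no other exponent is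
    smaller.\<close>
  define s where "s = q (k - 1) - q k"
  define e where "e i = q i + s * real (i - a)" for i
  define m where "m = e k"
  have em: "m \<le> e i" if "i \<in> ?I" for i
  proof -
    have "q k + (real i - real k) * (q (Suc k) - q k) \<le> q i"
      by (rule discrete_convex_supporting_line[OF q _ _ that]) (use k in auto)
    moreover have "q (Suc k) - q k = - s" using k(3) by (simp add: s_def)
    ultimately show ?thesis using that k by (simp add: m_def e_def of_nat_diff algebra_simps)
  qed
  have e1: "e (k - 1) = m" "e (k + 1) = m"
    using k by (auto simp: m_def e_def s_def of_nat_diff algebra_simps)
  define z :: complex where "z = - of_real (t powr s)"
  have z: "z \<noteq> 0" "cmod z = t powr s" using t by (auto simp: z_def)
  have zp: "cmod (z ^ j) = t powr (s * real j)" for j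
    using t by (simp add: norm_power z(2) powr_powr flip: powr_realpow)
  \<comment> \<open>The terms in J contribute at most U = n^2 T to each of the two equations. The
    factor 2 n^2 gives the term of index k + 1 the modulus 2 U, which outweighs them.\<close>
  define c0 where "c0 i = (of_real ((if i = k + 1 then 2 * n\<^sup>2 else 1) * t powr q i) :: complex)" for i
  define b0 where "b0 i = c0 i * z ^ (i - a)" for i
  define T where "T = t powr m"
  have T: "T > 0" using t by (simp add: T_def)
  define U where "U = n\<^sup>2 * T"
  have U: "U \<ge> 0" using T by (simp add: U_def)
  have b0: "cmod (b0 i) = (if i = k + 1 then 2 * n\<^sup>2 else 1) * t powr e i" for i
    by (simp add: b0_def c0_def norm_mult zp e_def powr_add abs_mult)
  have b0J: "cmod (b0 i) \<le> T" if "i \<in> J" for i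
    using that em[of i] t by (auto simp: b0 T_def J_def intro!: powr_mono')
  have b01: "cmod (b0 (k + 1)) = 2 * U" unfolding b0 e1(2) T_def U_def by simp
  define R1 where "R1 = (\<Sum>i\<in>J. of_int (int i - int k) * b0 i)"
  define R2 where "R2 = (\<Sum>i\<in>J. b0 i)"
  have cardJ: "real (card J) \<le> n"
  proof -
    have "card J \<le> card ?I" by (intro card_mono) (auto simp: J_def)
    then show ?thesis by (simp add: n_def)
  qed
  have R2: "cmod R2 \<le> U"
  proof -
    have "cmod R2 \<le> real (card J) * T" unfolding R2_def by (rule sum_norm_bound) (rule b0J)
    also have "\<dots> \<le> U" unfolding U_def using cardJ n T by (intro mult_right_mono) auto
    finally show ?thesis .
  qed
  have R1: "cmod R1 \<le> U"
  proof -
    have "cmod R1 \<le> real (card J) * (n * T)" unfolding R1_def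
    proof (rule sum_norm_bound)
      fix i assume i: "i \<in> J"
      have "cmod (of_int (int i - int k)) \<le> n" unfolding norm_of_int using i k by (auto simp: J_def n_def)
      then show "cmod (of_int (int i - int k) * b0 i) \<le> n * T"
        unfolding norm_mult using b0J[OF i] n by (intro mult_mono) auto
    qed
    also have "\<dots> \<le> n * (n * T)" using cardJ n T by (intro mult_right_mono) auto
    finally show ?thesis by (simp add: U_def power2_eq_square)
  qed
  \<comment> \<open>The terms of indices k - 1 and k. They solve the equations "sum of (i - k) b_i
    is 0", which does not involve y, and "sum of b_i is 0"; together these mean f(z) = f'(z) =
    0.\<close>
  define x where "x = b0 (k + 1) + R1"
  define y where "y = - (x + b0 (k + 1) + R2)"
  have x: "U \<le> cmod x" "cmod x \<le> 3 * U"
    using norm_diff_ineq[of "b0 (k + 1)" R1] norm_triangle_ineq[of "b0 (k + 1)" R1] R1 b01 by (auto simp: x_def)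
  have y_eq: "y = - (2 * b0 (k + 1) + (R1 + R2))" by (simp add: y_def x_def)
  have "cmod (R1 + R2) \<le> 2 * U" using norm_triangle_ineq[of R1 R2] R1 R2 by linarith
  moreover have "cmod (2 * b0 (k + 1)) = 4 * U" unfolding norm_mult b01 by simp
  ultimately have y: "U \<le> cmod y" "cmod y \<le> 6 * U"
    using norm_diff_ineq[of "2 * b0 (k + 1)" "R1 + R2"] norm_triangle_ineq[of "2 * b0 (k + 1)" "R1 + R2"] U
    unfolding y_eq norm_minus_cancel by auto
  define c where "c i = (if i \<notin> ?I then 0 else if i = k - 1 then x / z ^ (i - a) else if i = k then y / z ^ (i - a) else c0 i)" for i
  have cb: "c (k - 1) * z ^ (k - 1 - a) = x" "c k * z ^ (k - a) = y"
    using k z(1) by (auto simp: c_def)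
  have cb': "c i * z ^ (i - a) = b0 i" if "i \<in> insert (k + 1) J" for i
    using that k by (auto simp: c_def b0_def J_def)
  have sum: "(\<Sum>i\<in>?I. g i) = g (k - 1) + g k + g (k + 1) + (\<Sum>i\<in>J. g i)" for g :: "nat \<Rightarrow> complex"
    unfolding I using nJ by (simp add: add.assoc)
  have s0: "(\<Sum>i\<in>?I. c i * z ^ (i - a)) = 0"
    unfolding sum cb by (simp add: cb' R2_def[symmetric] y_def)
  have s1: "(\<Sum>i\<in>?I. of_int (int i - int k) * (c i * z ^ (i - a))) = 0"
  proof -
    have "(\<Sum>i\<in>J. of_int (int i - int k) * (c i * z ^ (i - a))) = R1"
      unfolding R1_def by (intro sum.cong) (auto simp: cb')
    moreover have "int (k - 1) - int k = -1" using k by simp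
    ultimately show ?thesis unfolding sum cb by (simp add: cb' x_def)
  qed
  have "z * (\<Sum>i\<in>?I. c i * (of_nat (i - a) * z ^ (i - a - 1))) = (\<Sum>i\<in>?I. of_nat (i - a) * (c i * z ^ (i - a)))"
    unfolding sum_distrib_left
  proof (intro sum.cong refl)
    fix i
    show "z * (c i * (of_nat (i - a) * z ^ (i - a - 1))) = of_nat (i - a) * (c i * z ^ (i - a))"
      by (cases "i - a") auto
  qed
  also have "\<dots> = (\<Sum>i\<in>?I. of_int (int i - int k) * (c i * z ^ (i - a))) + of_int (int k - int a) * (\<Sum>i\<in>?I. c i * z ^ (i - a))"
    unfolding sum_distrib_left sum.distrib[symmetric]
    by (intro sum.cong refl) (auto simp: of_nat_diff algebra_simps)
  finally have "(\<Sum>i\<in>?I. c i * (of_nat (i - a) * z ^ (i - a - 1))) = 0" using s0 s1 z(1) by simp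
  with s0 have "multiple_root a d c" unfolding multiple_root_def by blast
  moreover have "t powr q i \<le> cmod (c i) \<and> cmod (c i) \<le> 6 * n\<^sup>2 * t powr q i" if i: "i \<in> ?I" for i
  proof -
    have n6: "1 \<le> 6 * n\<^sup>2" "1 \<le> n\<^sup>2" using n by auto
    have quot: "cmod (w / z ^ (i - a)) = cmod w / T * t powr q i" if "e i = m" for w
    proof -
      have "t powr (s * real (i - a)) * t powr q i = T" using that by (simp add: T_def e_def add.commute flip: powr_add)
      then show ?thesis using T t by (simp add: norm_divide zp field_simps)
    qed
    have bound: "t powr q i \<le> cmod w / T * t powr q i \<and> cmod w / T * t powr q i \<le> 6 * n\<^sup>2 * t powr q i"
      if "U \<le> cmod w" "cmod w \<le> 6 * U" for w :: complex
    proof -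
      have "n\<^sup>2 \<le> cmod w / T" "cmod w / T \<le> 6 * n\<^sup>2" using that T by (simp_all add: U_def field_simps)
      then have "1 * t powr q i \<le> cmod w / T * t powr q i" "cmod w / T * t powr q i \<le> 6 * n\<^sup>2 * t powr q i"
        using n6 by (intro mult_right_mono; simp)+
      then show ?thesis by simp
    qed
    show ?thesis
    proof (cases "i = k - 1 \<or> i = k")
      case True
      then show ?thesis
      proof
        assume ik: "i = k - 1"
        then have "c i = x / z ^ (i - a)" using i by (simp add: c_def)
        moreover have "cmod x \<le> 6 * U" using x(2) U by simp
        ultimately show ?thesis using quot[of x] e1(1) bound[of x] x(1) ik by simp
      next
        assume ik: "i = k"
        moreover from this have "i \<noteq> k - 1" using k by arith
        ultimately have "c i = y / z ^ (i - a)" using i by (simp add: c_def)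
        then show ?thesis using quot[of y] m_def bound[of y] y ik by simp
      qed
    next
      case False
      then have "cmod (c i) = (if i = k + 1 then 2 * n\<^sup>2 else 1) * t powr q i"
        using i by (simp add: c_def c0_def abs_mult norm_mult)
      moreover have "1 * t powr q i \<le> (2 * n\<^sup>2) * t powr q i" "(2 * n\<^sup>2) * t powr q i \<le> 6 * n\<^sup>2 * t powr q i"
        "1 * t powr q i \<le> 6 * n\<^sup>2 * t powr q i"
        using n6 by (intro mult_right_mono; simp)+
      ultimately show ?thesis by (cases "i = k + 1") auto
    qed
  qed
  moreover have "c \<in> hcoords ?I"
  proof (rule hcoordsI[of "k + 1"])
    show "k + 1 \<in> ?I" using k by simp
    show "c (k + 1) \<noteq> 0" using k n t by (auto simp: c_def c0_def)
  qed (simp add: c_def)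
  ultimately show "\<exists>c\<in>hcoords ?I. multiple_root a d c \<and>
            (\<forall>i\<in>?I. t powr q i \<le> cmod (c i) \<and> cmod (c i) \<le> (6 * (real d + 1)\<^sup>2) * t powr q i)"
    unfolding n_def by blast
qed

text \<open>In \<Delta>(c) = 0, the lower bounds on |c_i| control the monomial of least weight and
  the upper bounds control the others, both with constants independent of t.\<close>

lemma nonstrict_convex_two_minimisers:
  assumes ad: "a + 2 \<le> d" and \<Delta>: "\<Delta> \<in> cpolys {a..d}" "\<Delta> \<noteq> 0"
    and root: "\<And>c. c \<in> hcoords {a..d} \<Longrightarrow> multiple_root a d c \<Longrightarrow> ceval \<Delta> c = 0"
    and q: "discrete_convex a d q" "\<not> strictly_discrete_convex a d q"
  shows "\<exists>\<alpha>\<in>minimisers a d q \<Delta>. \<exists>\<beta>\<in>minimisers a d q \<Delta>. \<alpha> \<noteq> \<beta>"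
proof (rule ccontr)
  assume no: "\<not> ?thesis"
  let ?K = "Poly_Mapping.keys \<Delta>"
  define w where "w = weight a d q"
  obtain \<alpha> where \<alpha>: "\<alpha> \<in> minimisers a d q \<Delta>" using minimisers_nonempty[OF \<Delta>(2)] by blast
  then have \<alpha>K: "\<alpha> \<in> ?K" by (simp add: minimisers_def)
  have less: "w \<alpha> < w \<gamma>" if \<gamma>: "\<gamma> \<in> ?K - {\<alpha>}" for \<gamma>
  proof (rule ccontr)
    assume "\<not> w \<alpha> < w \<gamma>"
    then have "w \<gamma> \<le> w \<beta>" if "\<beta> \<in> ?K" for \<beta>
      using \<alpha> that by (fastforce simp: minimisers_def w_def)
    then have "\<gamma> \<in> minimisers a d q \<Delta>" using \<gamma> by (simp add: minimisers_def w_def)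
    then show False using no \<alpha> \<gamma> by blast
  qed
  obtain k where k: "a < k" "k < d" "2 * q k = q (k - 1) + q (k + 1)"
    using q by (fastforce simp: discrete_convex_def strictly_discrete_convex_def)
  obtain C where C: "\<And>t. 0 < t \<Longrightarrow> t < 1 \<Longrightarrow> \<exists>c\<in>hcoords {a..d}. multiple_root a d c \<and>
            (\<forall>i\<in>{a..d}. t powr q i \<le> cmod (c i) \<and> cmod (c i) \<le> C * t powr q i)"
    using double_root_family[OF ad q(1) k] by blast
  define D where "D \<gamma> = cmod (Poly_Mapping.lookup \<Delta> \<gamma>) * (\<Prod>i\<in>{a..d}. C ^ Poly_Mapping.lookup \<gamma> i)" for \<gamma>
  \<comment> \<open>Bounds all other terms relative to t^(w \<alpha>). The exponents are positive if
    the minimiser is unique, so \<open>h\<close> tends to 0 while it has to stay above the modulus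
    of the coefficient of \<alpha>.\<close>
  define h where "h t = (\<Sum>\<gamma>\<in>?K - {\<alpha>}. D \<gamma> * t powr (w \<gamma> - w \<alpha>))" for t
  have bound: "cmod (Poly_Mapping.lookup \<Delta> \<alpha>) \<le> h t" if t: "0 < t" "t < 1" for t
  proof -
    obtain c where c: "c \<in> hcoords {a..d}" "multiple_root a d c"
      "\<And>i. i \<in> {a..d} \<Longrightarrow> t powr q i \<le> cmod (c i)" "\<And>i. i \<in> {a..d} \<Longrightarrow> cmod (c i) \<le> C * t powr q i"
      using C[OF t] by blast
    define trm where "trm \<gamma> = Poly_Mapping.lookup \<Delta> \<gamma> * (\<Prod>i\<in>{a..d}. c i ^ Poly_Mapping.lookup \<gamma> i)" for \<gamma>
    have "0 = (\<Sum>\<gamma>\<in>?K. trm \<gamma>)"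
      using root[OF c(1,2)] unfolding trm_def by (subst (asm) ceval_cpolys[OF \<Delta>(1)]) auto
    also have "\<dots> = trm \<alpha> + (\<Sum>\<gamma>\<in>?K - {\<alpha>}. trm \<gamma>)" using \<alpha>K by (intro sum.remove) auto
    finally have "trm \<alpha> = - (\<Sum>\<gamma>\<in>?K - {\<alpha>}. trm \<gamma>)" by (simp add: add_eq_0_iff)
    then have "cmod (trm \<alpha>) = cmod (\<Sum>\<gamma>\<in>?K - {\<alpha>}. trm \<gamma>)" by simp
    also have "\<dots> \<le> (\<Sum>\<gamma>\<in>?K - {\<alpha>}. cmod (trm \<gamma>))" by (rule norm_sum)
    also have "\<dots> \<le> (\<Sum>\<gamma>\<in>?K - {\<alpha>}. D \<gamma> * t powr w \<gamma>)"
    proof (rule sum_mono)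
      fix \<gamma>
      have "(\<Prod>i\<in>{a..d}. cmod (c i) ^ Poly_Mapping.lookup \<gamma> i) \<le> (\<Prod>i\<in>{a..d}. (C * t powr q i) ^ Poly_Mapping.lookup \<gamma> i)"
        using c(4) by (intro prod_mono conjI power_mono) auto
      also have "\<dots> = (\<Prod>i\<in>{a..d}. C ^ Poly_Mapping.lookup \<gamma> i) * t powr w \<gamma>"
        unfolding power_mult_distrib prod.distrib prod_powr_weight[OF t(1)] w_def by simp
      finally show "cmod (trm \<gamma>) \<le> D \<gamma> * t powr w \<gamma>"
        unfolding trm_def D_def norm_mult prod_norm[symmetric] norm_power mult.assoc by (rule mult_left_mono) simp
    qed
    also have "\<dots> = h t * t powr w \<alpha>"
      unfolding h_def sum_distrib_right by (intro sum.cong refl) (simp add: mult.assoc flip: powr_add)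
    finally have 1: "cmod (trm \<alpha>) \<le> h t * t powr w \<alpha>" .
    have "t powr w \<alpha> \<le> (\<Prod>i\<in>{a..d}. cmod (c i) ^ Poly_Mapping.lookup \<alpha> i)"
      unfolding w_def prod_powr_weight[OF t(1), symmetric] using c(3) by (intro prod_mono conjI power_mono) auto
    then have "cmod (Poly_Mapping.lookup \<Delta> \<alpha>) * t powr w \<alpha> \<le> cmod (trm \<alpha>)"
      unfolding trm_def norm_mult prod_norm[symmetric] norm_power by (rule mult_left_mono) simp
    with 1 have "cmod (Poly_Mapping.lookup \<Delta> \<alpha>) * t powr w \<alpha> \<le> h t * t powr w \<alpha>" by simp
    then show ?thesis using t by (simp add: mult_le_cancel_right)
  qed
  have "(h \<longlongrightarrow> (\<Sum>\<gamma>\<in>?K - {\<alpha>}. D \<gamma> * 0)) (at_right 0)"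
    unfolding h_def
  proof (intro tendsto_sum tendsto_mult tendsto_const)
    fix \<gamma> assume "\<gamma> \<in> ?K - {\<alpha>}"
    then have "w \<gamma> - w \<alpha> > 0" using less by simp
    have "((\<lambda>t. t) \<longlongrightarrow> (0::real)) (at_right 0)" by (rule tendsto_ident_at)
    moreover have "\<forall>\<^sub>F t in at_right 0. (0::real) \<le> t" by (auto simp: eventually_at_filter)
    ultimately have "((\<lambda>t. t powr (w \<gamma> - w \<alpha>)) \<longlongrightarrow> 0 powr (w \<gamma> - w \<alpha>)) (at_right 0)"
      using \<open>w \<gamma> - w \<alpha> > 0\<close> by (intro tendsto_powr') auto
    then show "((\<lambda>t. t powr (w \<gamma> - w \<alpha>)) \<longlongrightarrow> 0) (at_right 0)" using \<open>w \<gamma> - w \<alpha> > 0\<close> by simp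
  qed
  then have "(h \<longlongrightarrow> 0) (at_right 0)" by simp
  moreover have "0 < cmod (Poly_Mapping.lookup \<Delta> \<alpha>)" using \<alpha>K by (simp add: in_keys_iff)
  ultimately have "\<forall>\<^sub>F t in at_right 0. h t < cmod (Poly_Mapping.lookup \<Delta> \<alpha>)" by (rule order_tendstoD(2))
  moreover have "\<forall>\<^sub>F t in at_right 0. t \<in> {0<..<(1::real)}" by (intro eventually_at_right_real) simp
  ultimately have "\<forall>\<^sub>F t in at_right (0::real). False"
    by eventually_elim (use bound in force)
  then show False by simp
qed

lemma weight_cong_unused:
  assumes "\<And>j. j \<noteq> i \<Longrightarrow> q j = q' j" "Poly_Mapping.lookup \<alpha> i = 0"
  shows "weight a d q \<alpha> = weight a d q' \<alpha>"
  unfolding weight_def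
proof (intro sum.cong refl)
  fix j show "real (Poly_Mapping.lookup \<alpha> j) * q j = real (Poly_Mapping.lookup \<alpha> j) * q' j"
    using assms by (cases "j = i") auto
qed

text \<open>
  A change of the parabola \<open>j\<^sup>2\<close> at \<open>i\<close> alone makes three consecutive points collinear, and hence
  changes the set of minimal monomials.
\<close>

lemma variable_occurs:
  assumes ad: "a + 2 \<le> d" and \<Delta>: "\<Delta> \<in> cpolys {a..d}" "\<Delta> \<noteq> 0"
    and root: "\<And>c. c \<in> hcoords {a..d} \<Longrightarrow> ceval \<Delta> c = 0 \<longleftrightarrow> multiple_root a d c"
    and i: "i \<in> {a..d}"
  shows "\<exists>\<alpha>\<in>Poly_Mapping.keys \<Delta>. Poly_Mapping.lookup \<alpha> i \<noteq> 0"
proof (rule ccontr)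
  assume no: "\<not> ?thesis"
  define q where "q j = (real j)\<^sup>2" for j
  \<comment> \<open>All second differences of the parabola are 2. Lowering an end point by 2 makes
    the one at its neighbour 0; raising an inner point by 1 makes its own 0 and increases the
    adjacent ones.\<close>
  define q' where "q' j = (if j = i then (if i = a \<or> i = d then (real i)\<^sup>2 - 2 else (real i)\<^sup>2 + 1) else q j)" for j
  have "weight a d q \<alpha> = weight a d q' \<alpha>" if "\<alpha> \<in> Poly_Mapping.keys \<Delta>" for \<alpha>
    by (rule weight_cong_unused[of i]) (use no that in \<open>auto simp: q'_def\<close>)
  then have M: "minimisers a d q \<Delta> = minimisers a d q' \<Delta>"
    by (simp add: minimisers_def cong: conj_cong)
  have sq: "q (j - 1) + q (j + 1) = 2 * q j + 2" if "0 < j" for j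
    using that by (simp add: q_def of_nat_diff power2_eq_square algebra_simps)
  have strict: "strictly_discrete_convex a d q"
    unfolding strictly_discrete_convex_def using sq by fastforce
  have "discrete_convex a d q'"
    unfolding discrete_convex_def
  proof (intro allI impI)
    fix j assume j: "a < j \<and> j < d"
    have "q' j \<le> q j + of_bool (i = j)" using j by (auto simp: q'_def q_def)
    moreover have "q' (j - 1) + q' (j + 1) \<ge> q (j - 1) + q (j + 1) - 2 * of_bool (i \<noteq> j)"
      using j by (auto simp: q'_def q_def)
    ultimately show "2 * q' j \<le> q' (j - 1) + q' (j + 1)"
      using sq[of j] j by (cases "i = j") auto
  qed
  moreover have "\<not> strictly_discrete_convex a d q'"
  proof -
    define j where "j = (if i = a then a + 1 else if i = d then d - 1 else i)"
    have j: "a < j" "j < d" using i ad by (auto simp: j_def)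
    have "2 * q' j = q' (j - 1) + q' (j + 1)"
    proof (cases "i = a \<or> i = d")
      case True
      then have "q' j = q j" "q' (j - 1) + q' (j + 1) = q (j - 1) + q (j + 1) - 2"
        using ad by (auto simp: j_def q'_def q_def)
      then show ?thesis using sq[of j] j by simp
    next
      case False
      then have "q' j = q j + 1" "q' (j - 1) = q (j - 1)" "q' (j + 1) = q (j + 1)"
        using i by (auto simp: j_def q'_def q_def)
      then show ?thesis using sq[of j] j by simp
    qed
    then show ?thesis using j unfolding strictly_discrete_convex_def by force
  qed
  ultimately have "\<exists>\<alpha>\<in>minimisers a d q' \<Delta>. \<exists>\<beta>\<in>minimisers a d q' \<Delta>. \<alpha> \<noteq> \<beta>"
    using nonstrict_convex_two_minimisers[OF ad \<Delta> iffD2[OF root]] by simp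
  then obtain \<alpha> \<beta> where \<alpha>\<beta>: "\<alpha> \<in> minimisers a d q \<Delta>" "\<beta> \<in> minimisers a d q \<Delta>" "\<alpha> \<noteq> \<beta>"
    unfolding M by blast
  have "\<alpha> = \<beta>"
    by (rule strictly_convex_unique_minimiser[OF ad \<Delta>(1) iffD1[OF root] strict \<alpha>\<beta>(1,2)])
  with \<alpha>\<beta>(3) show False by simp
qed

section \<open>Degenerate polynomials in product form\<close>

text \<open>A linear term does not affect strict convexity, and from j1 + 1 on the shifted sequence
  increases strictly. So the minimum cannot be attained at two indices of distance 2 or
  more.\<close>

lemma convex_shift_minimum:
  assumes conv: "strictly_discrete_convex a d q" and j: "a \<le> j1" "j2 \<le> d" "j1 + 2 \<le> j2"
    and min: "\<And>j. j \<in> {a..d} \<Longrightarrow> q j1 + real j1 * y \<le> q j + real j * y"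
  shows "q j1 + real j1 * y < q j2 + real j2 * y"
proof -
  define p where "p j = q j + real j * y" for j
  have conv: "2 * p k < p (k - 1) + p (k + 1)" if "a < k" "k < d" for k
  proof -
    have "real (k - 1) + real (k + 1) = 2 * real k" using that by simp
    then have "real (k - 1) * y + real (k + 1) * y = 2 * real k * y" by (simp flip: distrib_right)
    moreover have "2 * q k < q (k - 1) + q (k + 1)" using conv that by (simp add: strictly_discrete_convex_def)
    ultimately show ?thesis by (simp add: p_def)
  qed
  have "j1 + n + 2 \<le> d \<Longrightarrow> p j1 \<le> p (j1 + n + 1) \<and> p (j1 + n + 1) < p (j1 + n + 2)" for n
  proof (induction n)
    case 0
    have "p j1 \<le> p (j1 + 1)" using min[of "j1 + 1"] 0 j by (simp add: p_def)
    then show ?case using conv[of "j1 + 1"] 0 j by simp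
  next
    case (Suc n)
    then show ?case using conv[of "j1 + n + 2"] j by simp
  qed
  moreover obtain n where n: "j2 = j1 + n + 2" using j(3) by (metis add.assoc add.commute le_Suc_ex)
  ultimately show ?thesis using j(2) unfolding p_def n by fastforce
qed

section \<open>Vertices, supports and evaluation\<close>

context polyhedra
begin

lemma finsum_A_carrier: "(\<And>i. i \<in> S \<Longrightarrow> T i \<in> carrier A) \<Longrightarrow> (\<Oplus>\<^bsub>A\<^esub>i\<in>S. T i) \<in> carrier A"
  by (intro A.finsum_closed) auto

lemma summand_subset_finsum:
  assumes "finite S" "\<And>i. i \<in> S \<Longrightarrow> T i \<in> carrier A" "i \<in> S"
  shows "T i \<subseteq> (\<Oplus>\<^bsub>A\<^esub>i\<in>S. T i)"
proof (rule subset_if_min_value_le)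
  show "closed (\<Oplus>\<^bsub>A\<^esub>i\<in>S. T i)" "convex (\<Oplus>\<^bsub>A\<^esub>i\<in>S. T i)"
    using finsum_A_carrier[of S T] assms(2) by (auto intro: carrier_closed carrier_convex)
  show "min_value (\<Oplus>\<^bsub>A\<^esub>i\<in>S. T i) l \<le> min_value (T i) l" for l
    using assms by (subst min_value_finsum) (auto intro: INF_lower)
qed

text \<open>A form that is bounded below attains its minimum at a vertex by
  \<open>carrier_vertex\<close>. So supports can be compared through finiteness of values.\<close>

lemma support_eq:
  assumes "P \<in> carrier A" "P \<noteq> {}"
  shows "polyhedron_support P = {l. min_value P l \<noteq> -\<infinity>}"
proof (intro equalityI subsetI)
  fix l assume "l \<in> polyhedron_support P"
  then obtain v where "v extreme_point_of P" "\<forall>x\<in>P. l \<bullet> v \<le> l \<bullet> x"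
    by (auto simp: polyhedron_support_def)
  then have "min_value P l = ereal (l \<bullet> v)" by (intro min_value_eqI) (auto simp: extreme_point_of_def)
  then show "l \<in> {l. min_value P l \<noteq> -\<infinity>}" by simp
next
  fix l assume "l \<in> {l. min_value P l \<noteq> -\<infinity>}"
  then obtain v where v: "v extreme_point_of P" "min_value P l = ereal (l \<bullet> v)"
    using carrier_vertex[OF assms] by auto
  have "l \<bullet> v \<le> l \<bullet> x" if "x \<in> P" for x using min_value_le[OF that, of l] v(2) by simp
  then show "l \<in> polyhedron_support P" using v(1) by (auto simp: polyhedron_support_def)
qed

text \<open>Vertices of polyhedra are exposed. A nonzero form is required because rational test
  points only have dense values for such a form; the form 0 occurs for a single point only, and
  there any other form serves as well.\<close>

lemma vertex_exposed:
  assumes "P \<in> carrier A" "v extreme_point_of P"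
  shows "\<exists>l. l \<noteq> 0 \<and> (\<forall>x\<in>P. x \<noteq> v \<longrightarrow> l \<bullet> v < l \<bullet> x)"
proof -
  have "P \<noteq> {}" using assms(2) by (auto simp: extreme_point_of_def)
  then have "polyhedron P" using assms(1) by (auto simp: carrier_A rational_polyhedron_polyhedron)
  then have "{v} exposed_face_of P"
    using assms(2) by (simp add: exposed_face_of_polyhedron face_of_singleton)
  then obtain l b where lb: "P \<subseteq> {x. l \<bullet> x \<le> b}" "{v} = P \<inter> {x. l \<bullet> x = b}"
    unfolding exposed_face_of_def by blast
  show ?thesis
  proof (cases "l = 0")
    case True
    then have "P = {v}" using lb by auto
    moreover obtain g :: "real ^ 'n" where "g \<noteq> 0" using axis_eq_0_iff by (metis zero_neq_one)
    ultimately show ?thesis by blast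
  next
    case False
    have "(- l) \<bullet> v < (- l) \<bullet> x" if x: "x \<in> P" "x \<noteq> v" for x
    proof -
      have "l \<bullet> v = b" using lb(2) by blast
      moreover have "l \<bullet> x \<noteq> b" "l \<bullet> x \<le> b" using lb x by blast+
      ultimately show ?thesis by simp
    qed
    then show ?thesis using False by (intro exI[of _ "- l"]) simp
  qed
qed

lemma usummand_carrier:
  assumes "\<psi> \<in> carrier (UP A)" "P \<in> carrier A"
  shows "usummand A \<psi> P i \<in> carrier A"
proof -
  have "P [^]\<^bsub>A\<^esub> i \<in> carrier A" using assms(2) by (rule A.nat_pow_closed)
  then show ?thesis unfolding usummand_def UP_coeff[OF assms(1)] A_simps
    using assms(1) by (intro plus_carrier) (auto simp: carrier_UP)
qed

lemma min_value_usummand: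
  assumes "\<psi> \<in> carrier (UP A)"
  shows "min_value (usummand A \<psi> P i) l = min_value (\<psi> i) l + ereal (real i) * min_value P l"
  unfolding usummand_def UP_coeff[OF assms] A_simps min_value_plus min_value_pow ..

lemma usupp_eq: "\<psi> \<in> carrier (UP A) \<Longrightarrow> usupp A \<psi> = {i. \<psi> i \<noteq> {}}"
  by (simp add: usupp_def UP_coeff)

lemma finite_usupp: "\<psi> \<in> carrier (UP A) \<Longrightarrow> finite (usupp A \<psi>)"
proof -
  assume \<psi>: "\<psi> \<in> carrier (UP A)"
  then obtain n where "\<And>m. m > n \<Longrightarrow> \<psi> m = {}" by (auto simp: carrier_UP)
  then have "usupp A \<psi> \<subseteq> {..n}" using usupp_eq[OF \<psi>] by (auto intro: leI)
  then show ?thesis using finite_subset by blast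
qed

lemma ueval_carrier: "\<psi> \<in> carrier (UP A) \<Longrightarrow> P \<in> carrier A \<Longrightarrow> ueval A \<psi> P \<in> carrier A"
  unfolding ueval_def by (intro finsum_A_carrier usummand_carrier)

lemma min_value_ueval:
  assumes "\<psi> \<in> carrier (UP A)" "P \<in> carrier A"
  shows "min_value (ueval A \<psi> P) l = (INF i\<in>usupp A \<psi>. min_value (\<psi> i) l + ereal (real i) * min_value P l)"
  unfolding ueval_def
  by (subst min_value_finsum) (use assms in \<open>auto intro: usummand_carrier finite_usupp simp: min_value_usummand\<close>)

text \<open>One-point polyhedra in the semiring are rational. A multiple of one coordinate vector
  suffices to approximate any prescribed value.\<close>

lemma rational_vector_dense:
  assumes "l \<noteq> 0" "y < y'"
  shows "\<exists>x :: real ^ 'n. rational_vector x \<and> y < l \<bullet> x \<and> l \<bullet> x < y'"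
proof -
  obtain j where j: "l $ j \<noteq> 0" using assms(1) by (auto simp: Finite_Cartesian_Product.vec_eq_iff)
  have "min (y / l $ j) (y' / l $ j) < max (y / l $ j) (y' / l $ j)"
    using assms(2) j by (auto simp: min_def max_def divide_simps split: if_splits)
  then obtain r where r: "r \<in> \<rat>" "min (y / l $ j) (y' / l $ j) < r" "r < max (y / l $ j) (y' / l $ j)"
    using Rats_dense_in_real by blast
  have "rational_vector (axis j r :: real ^ 'n)" using r(1) by (auto simp: rational_vector_cart axis_def)
  moreover have "l \<bullet> axis j r = l $ j * r" by (simp add: inner_axis)
  moreover have "y < l $ j * r \<and> l $ j * r < y'"
    using r(2,3) assms(2) j by (cases "l $ j > 0") (auto simp: min_def max_def field_simps split: if_splits)
  ultimately show ?thesis by metis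
qed

end

section \<open>Values of the coefficients and slopes at a form\<close>

locale product_polynomial = polyhedra \<omega> for \<omega> :: "real ^ 'n" +
  fixes \<Xi> :: "nat set" and Q \<phi> :: "nat \<Rightarrow> (real ^ 'n) set"
  assumes \<Xi>: "finite \<Xi>" "\<Xi> \<noteq> {}"
    and Q: "\<And>i. i \<in> \<Xi> \<Longrightarrow> Q i \<in> carrier A - {\<zero>\<^bsub>A\<^esub>}"
    and \<phi>: "\<phi> = (\<Oplus>\<^bsub>UP A\<^esub>i\<in>\<Xi>. monom (UP A) (Q i) i)"
    and product_form: "product_form A \<phi>"
begin

lemma Q_carrier: "i \<in> \<Xi> \<Longrightarrow> Q i \<in> carrier A" and Q_nonempty: "i \<in> \<Xi> \<Longrightarrow> Q i \<noteq> {}"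
  using Q by auto

lemma \<phi>_eq: "\<phi> = (\<lambda>n. if n \<in> \<Xi> then Q n else {})"
  unfolding \<phi> by (rule UP_finsum_monom) (use \<Xi> Q_carrier in auto)

lemma \<phi>_carrier: "\<phi> \<in> carrier (UP A)"
proof -
  have "\<phi> m = {}" if "m > Max \<Xi>" for m using that \<Xi> by (auto simp: \<phi>_eq)
  moreover have "\<phi> n \<in> carrier A" for n using Q_carrier by (simp add: \<phi>_eq)
  ultimately show ?thesis unfolding carrier_UP by blast
qed

lemma usupp_\<phi>: "usupp A \<phi> = \<Xi>"
  unfolding usupp_eq[OF \<phi>_carrier] using Q_nonempty by (auto simp: \<phi>_eq)

definition "lo = Min \<Xi>"
definition "hi = Max \<Xi>"

text \<open>A polynomial in product form has no gaps: the exchange inequality for i and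
  \<open>hi\<close> prevents the value at i + 1 from being infinite.\<close>

lemma \<Xi>_interval: "\<Xi> = {lo..hi}"
proof
  show "\<Xi> \<subseteq> {lo..hi}" using \<Xi> by (auto simp: lo_def hi_def)
  have hi: "hi \<in> \<Xi>" and lo: "lo \<in> \<Xi>" using \<Xi> by (auto simp: lo_def hi_def)
  have step: "Suc i \<in> \<Xi>" if "i \<in> \<Xi>" "i < hi" for i
  proof -
    have "min_value (\<phi> (i + 1)) \<omega> + min_value (\<phi> (hi - 1)) \<omega> \<le> min_value (\<phi> i) \<omega> + min_value (\<phi> hi) \<omega>"
      using exchange_convex_product_form[OF product_form, of \<omega>] that by (auto simp: exchange_convex_def)
    moreover have "min_value (\<phi> i) \<omega> + min_value (\<phi> hi) \<omega> \<noteq> \<infinity>"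
      using that hi Q_nonempty by (auto simp: \<phi>_eq min_value_eq_PInf_iff)
    ultimately have "min_value (\<phi> (i + 1)) \<omega> \<noteq> \<infinity>" by auto
    then show ?thesis by (auto simp: \<phi>_eq split: if_splits)
  qed
  have "lo + n \<le> hi \<Longrightarrow> lo + n \<in> \<Xi>" for n
    by (induction n) (use lo step in auto)
  then show "{lo..hi} \<subseteq> \<Xi>" by (auto dest!: le_Suc_ex)
qed

lemma mem_\<Xi>: "i \<in> \<Xi> \<longleftrightarrow> lo \<le> i \<and> i \<le> hi"
  using arg_cong[OF \<Xi>_interval, of "\<lambda>S. i \<in> S"] by simp

lemma lo_le_hi: "lo \<le> hi"
  using \<Xi>(2) mem_\<Xi> by (meson ex_in_conv order_trans)

text \<open>\<open>real_of_ereal\<close> sends infinite values to 0, so this is meaningful only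
  where l is bounded below on Q_i.\<close>

definition q :: "real ^ 'n \<Rightarrow> nat \<Rightarrow> real" where
  "q l i = real_of_ereal (min_value (Q i) l)"

lemma min_value_Q:
  assumes "i \<in> \<Xi>" "min_value (Q i) l \<noteq> -\<infinity>"
  shows "min_value (Q i) l = ereal (q l i)"
  using assms Q_nonempty[OF assms(1)] min_value_eq_PInf_iff[of "Q i" l] unfolding q_def
  by (cases "min_value (Q i) l") auto

lemma discrete_convex_q:
  assumes "\<And>i. i \<in> \<Xi> \<Longrightarrow> min_value (Q i) l \<noteq> -\<infinity>"
  shows "discrete_convex lo hi (q l)"
  unfolding discrete_convex_def
proof (intro allI impI)
  fix i assume i: "lo < i \<and> i < hi"
  then have mem: "i \<in> \<Xi>" "i - 1 \<in> \<Xi>" "i + 1 \<in> \<Xi>" unfolding mem_\<Xi> by auto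
  have "min_value (\<phi> (i - 1 + 1)) l + min_value (\<phi> (i + 1 - 1)) l \<le> min_value (\<phi> (i - 1)) l + min_value (\<phi> (i + 1)) l"
    by (rule exchange_convex_product_form[OF product_form, unfolded exchange_convex_def, rule_format]) simp
  moreover have "i - 1 + 1 = i" using i by simp
  ultimately have "ereal (q l i) + ereal (q l i) \<le> ereal (q l (i - 1)) + ereal (q l (i + 1))"
    using mem min_value_Q assms by (simp add: \<phi>_eq)
  then show "2 * q l i \<le> q l (i - 1) + q l (i + 1)" by simp
qed

text \<open>
  A representative \<open>\<psi>\<close> can have additional summands, but at \<open>l\<close> their indices lie between the left
  and the right slope of the concave function \<open>y \<mapsto> min (q l j + j y)\<close> at \<open>y\<close>. The function is
  tested on the values of \<open>l\<close> at rational points.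
\<close>

lemma shared_index_between:
  assumes fin: "\<And>i. i \<in> \<Xi> \<Longrightarrow> min_value (Q i) l \<noteq> -\<infinity>" and l: "l \<noteq> 0"
    and \<psi>: "\<psi> \<in> carrier (UP A)" "same_function A \<psi> \<phi>"
    and F: "\<And>j. j \<in> \<Xi> \<Longrightarrow> F \<le> q l j + real j * y"
    and i: "min_value (\<psi> i) l = ereal (F - real i * y)" and \<sigma>: "\<sigma> = 1 \<or> \<sigma> = -1"
  shows "\<exists>j\<in>\<Xi>. \<sigma> * real j \<le> \<sigma> * real i \<and> q l j + real j * y = F"
proof -
  have "\<psi> i \<noteq> {}" using i by auto
  then have isupp: "i \<in> usupp A \<psi>" by (simp add: usupp_eq[OF \<psi>(1)])
  \<comment> \<open>Both polynomials agree at the point x, and there the summand i of \<psi> is an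
    upper bound for the minimum over \<Xi>.\<close>
  have test: "\<exists>j\<in>\<Xi>. q l j + real j * (l \<bullet> x) \<le> F + real i * (l \<bullet> x - y)" if "rational_vector x" for x
  proof -
    have x: "{x} \<in> carrier A" using that by (rule carrier_singleton)
    have ne: "\<Xi> \<noteq> {}" "finite \<Xi>" by (fact \<Xi>)+
    have "(INF j\<in>\<Xi>. ereal (q l j + real j * (l \<bullet> x))) = min_value (ueval A \<phi> {x}) l"
      unfolding min_value_ueval[OF \<phi>_carrier x] usupp_\<phi>
      by (intro INF_cong refl) (simp add: \<phi>_eq min_value_Q fin)
    also have "ueval A \<phi> {x} = ueval A \<psi> {x}" using \<psi>(2) x by (simp add: same_function_def)
    also have "min_value (ueval A \<psi> {x}) l \<le> min_value (\<psi> i) l + ereal (real i) * min_value {x} l"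
      unfolding min_value_ueval[OF \<psi>(1) x] by (rule INF_lower[OF isupp])
    also have "\<dots> = ereal (F + real i * (l \<bullet> x - y))" by (simp add: i algebra_simps)
    finally have "(INF j\<in>\<Xi>. ereal (q l j + real j * (l \<bullet> x))) \<le> ereal (F + real i * (l \<bullet> x - y))" .
    moreover have "(INF j\<in>\<Xi>. ereal (q l j + real j * (l \<bullet> x))) \<in> (\<lambda>j. ereal (q l j + real j * (l \<bullet> x))) ` \<Xi>"
      using ne by (subst cInf_eq_Min) auto
    ultimately show ?thesis by force
  qed
  show ?thesis
  proof (rule ccontr)
    assume no: "\<not> ?thesis"
    \<comment> \<open>If all minimal indices of \<phi> lay strictly on one side of i, then moving y
      a little in the direction \<sigma> would put the summand i of \<psi> below every summand of
      \<phi>.\<close>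
    have "\<forall>\<^sub>F e in at_right 0. F + real i * (\<sigma> * e) < q l j + real j * (y + \<sigma> * e)" if j: "j \<in> \<Xi>" for j
    proof (cases "q l j + real j * y = F")
      case True
      then have less: "\<sigma> * real i < \<sigma> * real j" using no j by force
      have "F + real i * (\<sigma> * e) < q l j + real j * (y + \<sigma> * e)" if "0 < e" for e
        using mult_strict_right_mono[OF less that] True by (simp add: algebra_simps)
      then show ?thesis by (auto simp: eventually_at_filter)
    next
      case False
      then have less: "F < q l j + real j * y" using F[OF j] by simp
      have "((\<lambda>e. q l j + real j * (y + \<sigma> * e) - (F + real i * (\<sigma> * e))) \<longlongrightarrow>
          q l j + real j * (y + \<sigma> * 0) - (F + real i * (\<sigma> * 0))) (at_right 0)"
        by (intro tendsto_intros)
      from order_tendstoD(1)[OF this, of 0] less show ?thesis by simp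
    qed
    then have "\<forall>\<^sub>F e in at_right 0. \<forall>j\<in>\<Xi>. F + real i * (\<sigma> * e) < q l j + real j * (y + \<sigma> * e)"
      using \<Xi>(1) by (intro eventually_ball_finite) auto
    then obtain b where b: "0 < b"
      "\<And>e. 0 < e \<Longrightarrow> e < b \<Longrightarrow> \<forall>j\<in>\<Xi>. F + real i * (\<sigma> * e) < q l j + real j * (y + \<sigma> * e)"
      unfolding eventually_at_right_field by blast
    have "\<sigma> *\<^sub>R l \<noteq> 0" using l \<sigma> by auto
    then obtain x where x: "rational_vector x" "\<sigma> * y < (\<sigma> *\<^sub>R l) \<bullet> x" "(\<sigma> *\<^sub>R l) \<bullet> x < \<sigma> * y + b"
      using rational_vector_dense[of "\<sigma> *\<^sub>R l" "\<sigma> * y" "\<sigma> * y + b"] b(1) by auto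
    define e where "e = \<sigma> * (l \<bullet> x - y)"
    have e: "0 < e" "e < b" using x(2,3) by (simp_all add: e_def algebra_simps)
    have "l \<bullet> x = y + \<sigma> * e" using \<sigma> by (auto simp: e_def)
    then show False using test[OF x(1)] b(2)[OF e] by force
  qed
qed

text \<open>At a vertex where l is minimal, every summand of \<psi> that shares it is minimal for l.
  The least and the greatest index of these summands are enclosed by indices j1 and j2 that are
  minimal for \<phi>, so j1, ..., j2 are at least m indices.\<close>

lemma shared_by_representative_slopes:
  assumes fin: "\<And>i. i \<in> \<Xi> \<Longrightarrow> min_value (Q i) l \<noteq> -\<infinity>" and l: "l \<noteq> 0"
    and P: "P \<in> carrier A" "min_value P l = ereal y"
    and shared: "shared_by_representative A \<phi> P m" and m: "m \<ge> 1"
  obtains j1 j2 where "j1 \<in> \<Xi>" "j2 \<in> \<Xi>" "m \<le> Suc j2 - j1" "q l j1 + real j1 * y = q l j2 + real j2 * y"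
    "\<And>j. j \<in> \<Xi> \<Longrightarrow> q l j1 + real j1 * y \<le> q l j + real j * y"
proof -
  obtain \<psi> where \<psi>: "\<psi> \<in> carrier (UP A)" "same_function A \<psi> \<phi>"
    and vs: "vertices_shared A m (usupp A \<psi>) (usummand A \<psi> P)"
    using shared by (auto simp: shared_by_representative_def)
  define F where "F = Min ((\<lambda>j. q l j + real j * y) ` \<Xi>)"
  have F: "F \<le> q l j + real j * y" if "j \<in> \<Xi>" for j unfolding F_def using that \<Xi> by (intro Min_le) auto
  have "F \<in> (\<lambda>j. q l j + real j * y) ` \<Xi>" unfolding F_def using \<Xi> by (intro Min_in) auto
  have eq: "ueval A \<psi> P = ueval A \<phi> P" using \<psi>(2) P(1) by (simp add: same_function_def)
  have "min_value (ueval A \<phi> P) l = (INF j\<in>\<Xi>. ereal (q l j + real j * y))"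
    unfolding min_value_ueval[OF \<phi>_carrier P(1)] usupp_\<phi>
    by (intro INF_cong refl) (simp add: \<phi>_eq min_value_Q fin P(2))
  also have "\<dots> = ereal F"
    using F \<open>F \<in> _\<close> by (intro antisym INF_greatest) (auto intro: INF_lower2)
  finally have mvF: "min_value (ueval A \<psi> P) l = ereal F" unfolding eq .
  have U: "ueval A \<psi> P \<in> carrier A" "ueval A \<psi> P \<noteq> {}"
    using ueval_carrier[OF \<psi>(1) P(1)] mvF by auto
  obtain v where v: "v extreme_point_of ueval A \<psi> P" "l \<bullet> v = F"
    using carrier_vertex[OF U, of l] mvF by auto
  define S where "S = {i \<in> usupp A \<psi>. v extreme_point_of usummand A \<psi> P i}"
  have S: "m \<le> card S" using vs v(1) unfolding vertices_shared_def S_def ueval_def by blast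
  have Sval: "min_value (\<psi> i) l = ereal (F - real i * y)" if "i \<in> S" for i
  proof -
    have i: "i \<in> usupp A \<psi>" "v \<in> usummand A \<psi> P i" using that by (auto simp: S_def extreme_point_of_def)
    have mv: "min_value (usummand A \<psi> P i) l = min_value (\<psi> i) l + ereal (real i * y)"
      unfolding min_value_usummand[OF \<psi>(1)] P(2) by simp
    have "min_value (usummand A \<psi> P i) l \<le> ereal F" using min_value_le[OF i(2), of l] v(2) by simp
    moreover have "ereal F \<le> min_value (usummand A \<psi> P i) l"
      unfolding mvF[symmetric] min_value_ueval[OF \<psi>(1) P(1)] min_value_usummand[OF \<psi>(1)] by (rule INF_lower[OF i(1)])
    ultimately have "min_value (\<psi> i) l + ereal (real i * y) = ereal F" unfolding mv by simp
    then show ?thesis by (cases "min_value (\<psi> i) l") auto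
  qed
  have finS: "finite S" using finite_usupp[OF \<psi>(1)] by (simp add: S_def)
  have neS: "S \<noteq> {}" using S m by auto
  obtain j1 where j1: "j1 \<in> \<Xi>" "j1 \<le> Min S" "q l j1 + real j1 * y = F"
    using shared_index_between[OF fin l \<psi> F Sval[OF Min_in[OF finS neS]], of 1] by auto
  obtain j2 where j2: "j2 \<in> \<Xi>" "Max S \<le> j2" "q l j2 + real j2 * y = F"
    using shared_index_between[OF fin l \<psi> F Sval[OF Max_in[OF finS neS]], of "-1"] by auto
  have "S \<subseteq> {j1..j2}" using j1(2) j2(2) finS neS by (auto intro: order_trans[OF _ Min_le] order_trans[OF Max_ge])
  then have "card S \<le> Suc j2 - j1" using card_mono[of "{j1..j2}" S] by simp
  then show ?thesis using that[of j1 j2] j1 j2 S F by simp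
qed

lemma min_value_msummand:
  assumes "\<Phi> \<alpha> = {0}"
  shows "min_value (msummand A \<Xi> \<Phi> Q \<alpha>) l = (\<Sum>i\<in>\<Xi>. ereal (real (Poly_Mapping.lookup \<alpha> i)) * min_value (Q i) l)"
  unfolding msummand_def assms A_simps min_value_plus
  by (subst min_value_finprod) (auto simp: min_value_pow \<Xi> intro: A.nat_pow_closed Q_carrier)

lemma msummand_carrier:
  assumes "\<Phi> \<alpha> = {0}"
  shows "msummand A \<Xi> \<Phi> Q \<alpha> \<in> carrier A"
  unfolding msummand_def assms A_simps
  by (intro plus_carrier A.finprod_closed) (auto intro: A.nat_pow_closed Q_carrier)

lemma min_value_msummand_weight:
  assumes "\<Phi> \<alpha> = {0}" "\<And>i. i \<in> \<Xi> \<Longrightarrow> min_value (Q i) l \<noteq> -\<infinity>"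
  shows "min_value (msummand A \<Xi> \<Phi> Q \<alpha>) l = ereal (weight lo hi (q l) \<alpha>)"
  unfolding min_value_msummand[of \<Phi>, OF assms(1)] weight_def \<Xi>_interval[symmetric] sum_ereal[symmetric]
  by (intro sum.cong refl) (simp add: min_value_Q assms(2))

end

lemma vertices_shared_mono:
  assumes "vertices_shared R m S T" "m' \<le> m"
  shows "vertices_shared R m' S T"
  unfolding vertices_shared_def
proof (intro allI impI)
  fix v assume "v extreme_point_of (\<Oplus>\<^bsub>R\<^esub>i\<in>S. T i)"
  then have "m \<le> card {i \<in> S. v extreme_point_of T i}" using assms(1) by (simp add: vertices_shared_def)
  with assms(2) show "m' \<le> card {i \<in> S. v extreme_point_of T i}" by (rule order_trans)
qed

section \<open>The two implications\<close>

context product_polynomial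
begin

lemma omega_nonzero: "\<omega> \<noteq> 0"
proof
  assume "\<omega> = 0"
  then have "(0 :: real ^ 'n) = axis undefined 1"
    by (intro rationally_independent_inj[OF independent]) (auto simp: rational_vector_cart axis_def)
  then show False by (metis axis_eq_0_iff zero_neq_one)
qed

lemma min_value_Q_omega: "i \<in> \<Xi> \<Longrightarrow> min_value (Q i) \<omega> \<noteq> -\<infinity>"
  using min_value_omega Q_carrier by blast

text \<open>Three shared summands enforce j2 \<ge> j1 + 2, and a strictly convex sequence cannot be
  minimal at both.\<close>

lemma slopes_not_strict:
  assumes fin: "\<And>i. i \<in> \<Xi> \<Longrightarrow> min_value (Q i) l \<noteq> -\<infinity>" and l: "l \<noteq> 0"
    and P: "P \<in> carrier A" "P \<noteq> {}" "min_value P l \<noteq> -\<infinity>"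
    and shared: "shared_by_representative A \<phi> P m" and m: "m \<ge> 3"
  shows "lo + 2 \<le> hi \<and> \<not> strictly_discrete_convex lo hi (q l)"
proof -
  obtain y where y: "min_value P l = ereal y"
    using P by (cases "min_value P l") (auto simp: min_value_eq_PInf_iff)
  obtain j1 j2 where j: "j1 \<in> \<Xi>" "j2 \<in> \<Xi>" "m \<le> Suc j2 - j1" "q l j1 + real j1 * y = q l j2 + real j2 * y"
    "\<And>j. j \<in> \<Xi> \<Longrightarrow> q l j1 + real j1 * y \<le> q l j + real j * y"
    by (rule shared_by_representative_slopes[OF fin l P(1) y shared]) (use m in auto)
  have b: "lo \<le> j1" "j2 \<le> hi" "j1 + 2 \<le> j2" using j(1-3) m unfolding mem_\<Xi> by auto
  have "\<not> strictly_discrete_convex lo hi (q l)"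
  proof
    assume "strictly_discrete_convex lo hi (q l)"
    from convex_shift_minimum[OF this b] show False using j(4,5) mem_\<Xi> by fastforce
  qed
  with b show ?thesis by simp
qed

text \<open>Guarantees that the maximum in \<open>root_multiplicity\<close> exists. At \<omega> all
  values are finite, so the bound applies to every nonzero P.\<close>

lemma multiplicity_bound:
  assumes "P \<in> carrier A" "P \<noteq> {}" "shared_by_representative A \<phi> P m"
  shows "m \<le> Suc hi"
proof (cases "m = 0")
  case False
  obtain y where y: "min_value P \<omega> = ereal y"
    using assms min_value_omega[of P] by (cases "min_value P \<omega>") (auto simp: min_value_eq_PInf_iff)
  obtain j1 j2 where "j1 \<in> \<Xi>" "j2 \<in> \<Xi>" "m \<le> Suc j2 - j1"
    by (rule shared_by_representative_slopes[OF min_value_Q_omega omega_nonzero assms(1) y assms(3)]) (use False in auto)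
  then show ?thesis unfolding mem_\<Xi> by linarith
qed simp

lemma polyhedralise_eq: "polyhedralise A \<Delta> \<alpha> = (if \<alpha> \<in> Poly_Mapping.keys \<Delta> then {0} else {})"
  by (simp add: polyhedralise_def in_keys_iff)

lemma msupp_polyhedralise: "msupp A (polyhedralise A \<Delta>) = Poly_Mapping.keys \<Delta>"
  by (auto simp: msupp_def polyhedralise_eq)

text \<open>Each vertex v of the evaluated discriminant is exposed by some form l. Once l is known
  to be bounded below on all Q_i and on P, the multiplicity of P makes q at l not strictly convex.
  Two monomials then have minimal weight, and v is a vertex of both summands.\<close>

lemma degenerate_imp_mroot:
  assumes \<Delta>: "is_X_discriminant \<Xi> \<Delta>" and deg: "degenerate A \<phi>"
  shows "mroot A \<Xi> (polyhedralise A \<Delta>) Q"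
proof -
  obtain P k where P: "root_multiplicity A \<phi> P k" "2 \<le> k"
    and supp: "polyhedron_support P = polyhedron_support (\<Otimes>\<^bsub>A\<^esub>i\<in>usupp A \<phi>. coeff (UP A) \<phi> i)"
    using deg unfolding degenerate_def by blast
  obtain m where m: "k = m - 1" "shared_by_representative A \<phi> P m"
    using P(1) unfolding root_multiplicity_def by blast
  have m3: "m \<ge> 3" using m(1) P(2) by simp
  have Pc: "P \<in> carrier A" "P \<noteq> {}" using P(1) by (auto simp: root_multiplicity_def uroot_def)
  \<comment> \<open>Shown at \<omega>, where finiteness is automatic, because nothing is known about
    \<Delta> beyond \<Delta> = 1 for shorter intervals.\<close>
  have ad: "lo + 2 \<le> hi"
    using slopes_not_strict[OF min_value_Q_omega omega_nonzero Pc min_value_omega[OF Pc(1)] m(2) m3] by simp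
  have D: "is_X_discriminant {lo..hi} \<Delta>" using \<Delta> \<Xi>_interval by simp
  note X = X_discriminant[OF ad D]
  let ?K = "Poly_Mapping.keys \<Delta>"
  let ?T = "msummand A \<Xi> (polyhedralise A \<Delta>) Q"
  have one: "polyhedralise A \<Delta> \<alpha> = {0}" if "\<alpha> \<in> ?K" for \<alpha> using that by (simp add: polyhedralise_eq)
  have T: "?T \<alpha> \<in> carrier A" if "\<alpha> \<in> ?K" for \<alpha> using msummand_carrier[of "polyhedralise A \<Delta>", OF one[OF that]] .
  define E where "E = (\<Oplus>\<^bsub>A\<^esub>\<alpha>\<in>?K. ?T \<alpha>)"
  have E: "E \<in> carrier A" unfolding E_def using T by (rule finsum_A_carrier)
  have sub: "?T \<alpha> \<subseteq> E" if "\<alpha> \<in> ?K" for \<alpha>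
    unfolding E_def by (rule summand_subset_finsum) (use T that in auto)
  have "2 \<le> card {\<alpha> \<in> ?K. v extreme_point_of ?T \<alpha>}" if v: "v extreme_point_of E" for v
  proof -
    obtain l where l: "l \<noteq> 0" "\<And>x. x \<in> E \<Longrightarrow> x \<noteq> v \<Longrightarrow> l \<bullet> v < l \<bullet> x"
      using vertex_exposed[OF E v] by blast
    have mvE: "min_value E l = ereal (l \<bullet> v)"
      by (rule min_value_eqI) (use v l(2) in \<open>auto simp: extreme_point_of_def intro: less_imp_le\<close>)
    have mvT: "ereal (l \<bullet> v) \<le> min_value (?T \<alpha>) l" if "\<alpha> \<in> ?K" for \<alpha>
      unfolding mvE[symmetric] le_min_value_iff using sub[OF that] by (auto intro: min_value_le)
    \<comment> \<open>Some monomial contains the i-th variable, so l would be unbounded below on its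
      summand if it were on Q_i. But it is bounded below on the whole evaluation.\<close>
    have fin: "min_value (Q i) l \<noteq> -\<infinity>" if i: "i \<in> \<Xi>" for i
    proof
      assume neg: "min_value (Q i) l = -\<infinity>"
      obtain \<alpha> where \<alpha>: "\<alpha> \<in> ?K" "Poly_Mapping.lookup \<alpha> i \<noteq> 0"
        using variable_occurs[OF ad X(1,2), of i] X(3) i \<Xi>_interval by auto
      have "(\<Sum>j\<in>\<Xi>. ereal (real (Poly_Mapping.lookup \<alpha> j)) * min_value (Q j) l) =
          ereal (real (Poly_Mapping.lookup \<alpha> i)) * min_value (Q i) l +
          (\<Sum>j\<in>\<Xi> - {i}. ereal (real (Poly_Mapping.lookup \<alpha> j)) * min_value (Q j) l)"
        using \<Xi>(1) i by (rule sum.remove)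
      moreover have "(\<Sum>j\<in>\<Xi> - {i}. ereal (real (Poly_Mapping.lookup \<alpha> j)) * min_value (Q j) l) \<noteq> \<infinity>"
      proof -
        have "ereal (real (Poly_Mapping.lookup \<alpha> j)) * min_value (Q j) l \<noteq> \<infinity>" if "j \<in> \<Xi>" for j
          using Q_nonempty[OF that] min_value_eq_PInf_iff[of "Q j" l] by (cases "min_value (Q j) l") auto
        then show ?thesis by (simp add: sum_Pinfty)
      qed
      moreover have "ereal (real (Poly_Mapping.lookup \<alpha> i)) * min_value (Q i) l = -\<infinity>"
        using \<alpha>(2) neg by simp
      ultimately have "min_value (?T \<alpha>) l = -\<infinity>"
        unfolding min_value_msummand[of "polyhedralise A \<Delta>", OF one[OF \<alpha>(1)]] by simp
      then show False using mvT[OF \<alpha>(1)] by simp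
    qed
    have Qprod: "(\<Otimes>\<^bsub>A\<^esub>i\<in>usupp A \<phi>. coeff (UP A) \<phi> i) = (\<Otimes>\<^bsub>A\<^esub>i\<in>\<Xi>. Q i)"
    proof -
      have "coeff (UP A) \<phi> i = Q i" if "i \<in> \<Xi>" for i
        using that by (subst UP_coeff[OF \<phi>_carrier]) (simp add: \<phi>_eq)
      then show ?thesis unfolding usupp_\<phi> using Q_carrier by (intro A.finprod_cong') auto
    qed
    have mvprod: "min_value (\<Otimes>\<^bsub>A\<^esub>i\<in>\<Xi>. Q i) g = (\<Sum>i\<in>\<Xi>. min_value (Q i) g)" for g
      by (rule min_value_finprod) (use \<Xi> Q_carrier in auto)
    have prod: "(\<Otimes>\<^bsub>A\<^esub>i\<in>\<Xi>. Q i) \<in> carrier A" "(\<Otimes>\<^bsub>A\<^esub>i\<in>\<Xi>. Q i) \<noteq> {}"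
    proof -
      show "(\<Otimes>\<^bsub>A\<^esub>i\<in>\<Xi>. Q i) \<in> carrier A" by (intro A.finprod_closed) (auto intro: Q_carrier)
      have "min_value (\<Otimes>\<^bsub>A\<^esub>i\<in>\<Xi>. Q i) \<omega> \<noteq> \<infinity>"
        unfolding mvprod using Q_nonempty by (auto simp: sum_Pinfty min_value_eq_PInf_iff)
      then show "(\<Otimes>\<^bsub>A\<^esub>i\<in>\<Xi>. Q i) \<noteq> {}" by auto
    qed
    have "min_value (\<Otimes>\<^bsub>A\<^esub>i\<in>\<Xi>. Q i) l = ereal (\<Sum>i\<in>\<Xi>. q l i)"
      unfolding mvprod sum_ereal[symmetric] by (intro sum.cong refl) (simp add: min_value_Q fin)
    then have "l \<in> polyhedron_support (\<Otimes>\<^bsub>A\<^esub>i\<in>\<Xi>. Q i)" unfolding support_eq[OF prod] by simp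
    \<comment> \<open>The equality of supports carries boundedness of l over from the product of the
      Q_i to P.\<close>
    then have Pl: "min_value P l \<noteq> -\<infinity>" using supp unfolding Qprod support_eq[OF Pc] by blast
    have ns: "\<not> strictly_discrete_convex lo hi (q l)"
      using slopes_not_strict[OF fin l(1) Pc Pl m(2) m3] by simp
    obtain \<alpha> \<beta> where \<alpha>\<beta>: "\<alpha> \<in> minimisers lo hi (q l) \<Delta>" "\<beta> \<in> minimisers lo hi (q l) \<Delta>" "\<alpha> \<noteq> \<beta>"
      using nonstrict_convex_two_minimisers[OF ad X(1,2) iffD2[OF X(3)] discrete_convex_q[OF fin] ns] by blast
    have mvw: "min_value (?T \<gamma>) l = ereal (weight lo hi (q l) \<gamma>)" if "\<gamma> \<in> ?K" for \<gamma>
      by (rule min_value_msummand_weight[of "polyhedralise A \<Delta>", OF one[OF that] fin])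
    \<comment> \<open>A vertex of this summand with minimal l-value lies in \<open>E\<close>, where
      v is the only point with this value.\<close>
    have ext: "v extreme_point_of ?T \<gamma>" if \<gamma>: "\<gamma> \<in> minimisers lo hi (q l) \<Delta>" for \<gamma>
    proof -
      have \<gamma>K: "\<gamma> \<in> ?K" using \<gamma> by (simp add: minimisers_def)
      have "min_value (?T \<gamma>) l \<le> min_value E l"
        unfolding E_def by (subst min_value_finsum) (use T \<gamma> in \<open>auto simp: mvw minimisers_def intro!: INF_greatest\<close>)
      then have mv: "min_value (?T \<gamma>) l = ereal (l \<bullet> v)" using mvT[OF \<gamma>K] mvE by simp
      then have "?T \<gamma> \<noteq> {}" by auto
      then obtain x where x: "x extreme_point_of ?T \<gamma>" "min_value (?T \<gamma>) l = ereal (l \<bullet> x)"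
        using carrier_vertex[OF T[OF \<gamma>K], of l] mv by auto
      have "x \<in> E" using x(1) sub[OF \<gamma>K] by (auto simp: extreme_point_of_def)
      then have "x = v" using l(2)[of x] x(2) mv by auto
      with x(1) show ?thesis by simp
    qed
    have "{\<alpha>, \<beta>} \<subseteq> {\<alpha> \<in> ?K. v extreme_point_of ?T \<alpha>}" using \<alpha>\<beta> ext by (auto simp: minimisers_def)
    then have "card {\<alpha>, \<beta>} \<le> card {\<alpha> \<in> ?K. v extreme_point_of ?T \<alpha>}" by (intro card_mono) auto
    then show ?thesis using \<alpha>\<beta>(3) by simp
  qed
  then show ?thesis
    unfolding mroot_def vertices_shared_def msupp_polyhedralise E_def[symmetric] using Q by blast
qed

text \<open>The vertex of the evaluated discriminant that is minimal for \<omega> lies in two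
  summands, whose monomials thus have equal minimal weight; so two consecutive slopes agree at
  \<omega>, say around k. For the constructed P, the polynomial \<phi> represents itself and its
  summands k - 1, k and k + 1 share the vertex.\<close>

lemma mroot_imp_weakly_degenerate:
  assumes \<Delta>: "is_X_discriminant \<Xi> \<Delta>" and root: "mroot A \<Xi> (polyhedralise A \<Delta>) Q"
  shows "weakly_degenerate A \<phi>"
proof -
  have D: "is_X_discriminant {lo..hi} \<Delta>" using \<Delta> \<Xi>_interval by simp
  let ?K = "Poly_Mapping.keys \<Delta>"
  let ?T = "msummand A \<Xi> (polyhedralise A \<Delta>) Q"
  have one: "polyhedralise A \<Delta> \<alpha> = {0}" if "\<alpha> \<in> ?K" for \<alpha> using that by (simp add: polyhedralise_eq)
  have T: "?T \<alpha> \<in> carrier A" if "\<alpha> \<in> ?K" for \<alpha> using msummand_carrier[of "polyhedralise A \<Delta>", OF one[OF that]] .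
  define E where "E = (\<Oplus>\<^bsub>A\<^esub>\<alpha>\<in>?K. ?T \<alpha>)"
  have E: "E \<in> carrier A" unfolding E_def using T by (rule finsum_A_carrier)
  have sub: "?T \<alpha> \<subseteq> E" if "\<alpha> \<in> ?K" for \<alpha>
    unfolding E_def by (rule summand_subset_finsum) (use T that in auto)
  have shared: "2 \<le> card {\<alpha> \<in> ?K. v extreme_point_of ?T \<alpha>}" if "v extreme_point_of E" for v
    using root that unfolding mroot_def vertices_shared_def msupp_polyhedralise E_def by blast
  have mvw: "min_value (?T \<gamma>) \<omega> = ereal (weight lo hi (q \<omega>) \<gamma>)" if "\<gamma> \<in> ?K" for \<gamma>
    by (rule min_value_msummand_weight[of "polyhedralise A \<Delta>", OF one[OF that] min_value_Q_omega])
  have "\<Delta> \<noteq> 0"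
  proof (cases "lo + 2 \<le> hi")
    case True
    then show ?thesis using X_discriminant(2)[OF _ D] by blast
  next
    case False
    then have "\<Delta> = 1" using discriminant_trivial[OF lo_le_hi _ D] by simp
    then show ?thesis by simp
  qed
  then obtain \<alpha>0 where "\<alpha>0 \<in> ?K" using minimisers_nonempty by (fastforce simp: minimisers_def)
  moreover from this have "?T \<alpha>0 \<noteq> {}" using mvw[of \<alpha>0] by auto
  ultimately have "E \<noteq> {}" using sub by blast
  then obtain v where v: "v extreme_point_of E" "min_value E \<omega> = ereal (\<omega> \<bullet> v)"
    using carrier_vertex[OF E _ min_value_omega[OF E]] by metis
  have card2: "2 \<le> card {\<alpha> \<in> ?K. v extreme_point_of ?T \<alpha>}" by (rule shared[OF v(1)])
  obtain \<alpha> \<beta> where \<alpha>\<beta>: "\<alpha> \<in> ?K" "\<beta> \<in> ?K" "v extreme_point_of ?T \<alpha>" "v extreme_point_of ?T \<beta>" "\<alpha> \<noteq> \<beta>"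
  proof -
    obtain x where x: "x \<in> {\<alpha> \<in> ?K. v extreme_point_of ?T \<alpha>}"
      using card2 by (metis (no_types, lifting) card.empty ex_in_conv not_numeral_le_zero)
    have "{\<alpha> \<in> ?K. v extreme_point_of ?T \<alpha>} \<noteq> {x}"
    proof
      assume "{\<alpha> \<in> ?K. v extreme_point_of ?T \<alpha>} = {x}"
      then show False using card2 by simp
    qed
    then obtain y where "y \<in> {\<alpha> \<in> ?K. v extreme_point_of ?T \<alpha>}" "y \<noteq> x" using x by blast
    with x show ?thesis using that[of x y] by blast
  qed
  \<comment> \<open>For shorter intervals \<Delta> = 1 has a single monomial, so no vertex could be
    shared.\<close>
  have ad: "lo + 2 \<le> hi"
  proof (rule ccontr)
    assume "\<not> ?thesis"
    then have "\<Delta> = 1" using discriminant_trivial[OF lo_le_hi _ D] by simp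
    then show False using \<alpha>\<beta>(1,2,5) by simp
  qed
  note X = X_discriminant[OF ad D]
  have minim: "\<gamma> \<in> minimisers lo hi (q \<omega>) \<Delta>" if \<gamma>: "\<gamma> \<in> ?K" "v extreme_point_of ?T \<gamma>" for \<gamma>
  proof -
    have "v \<in> ?T \<gamma>" using \<gamma>(2) by (simp add: extreme_point_of_def)
    then have "min_value (?T \<gamma>) \<omega> \<le> min_value E \<omega>" using min_value_le[of v "?T \<gamma>" \<omega>] v(2) by simp
    moreover have "min_value E \<omega> \<le> min_value (?T \<delta>) \<omega>" if "\<delta> \<in> ?K" for \<delta>
      unfolding le_min_value_iff using sub[OF that] by (auto intro: min_value_le)
    ultimately have "min_value (?T \<gamma>) \<omega> \<le> min_value (?T \<delta>) \<omega>" if "\<delta> \<in> ?K" for \<delta> using that by (meson order_trans)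
    then show ?thesis using \<gamma>(1) by (auto simp: minimisers_def mvw)
  qed
  have "\<not> strictly_discrete_convex lo hi (q \<omega>)"
    using strictly_convex_unique_minimiser[OF ad X(1) iffD1[OF X(3)] _ minim[OF \<alpha>\<beta>(1,3)] minim[OF \<alpha>\<beta>(2,4)]] \<alpha>\<beta>(5) by blast
  moreover have conv: "discrete_convex lo hi (q \<omega>)" using min_value_Q_omega by (rule discrete_convex_q)
  ultimately obtain k where k: "lo < k" "k < hi" "2 * q \<omega> k = q \<omega> (k - 1) + q \<omega> (k + 1)"
    unfolding strictly_discrete_convex_def discrete_convex_def by (metis linorder_not_le nle_le)
  have k\<Xi>: "k - 1 \<in> \<Xi>" "k \<in> \<Xi>" "k + 1 \<in> \<Xi>" using k unfolding mem_\<Xi> by auto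

  have "\<forall>i\<in>\<Xi>. \<exists>V C. finite V \<and> finite C \<and> (\<forall>v\<in>V. rational_vector v) \<and> (\<forall>c\<in>C. rational_vector c) \<and>
      V \<noteq> {} \<and> (\<forall>c\<in>C. 0 < \<omega> \<bullet> c) \<and> Q i = convex hull V + gen_cone C"
    using carrier_generated[OF Q_carrier Q_nonempty] by metis
  then obtain V where "\<forall>i\<in>\<Xi>. \<exists>C. finite (V i) \<and> finite C \<and> (\<forall>v\<in>V i. rational_vector v) \<and>
      (\<forall>c\<in>C. rational_vector c) \<and> V i \<noteq> {} \<and> (\<forall>c\<in>C. 0 < \<omega> \<bullet> c) \<and> Q i = convex hull (V i) + gen_cone C"
    by (rule bchoice[THEN exE])
  then obtain C where C: "\<forall>i\<in>\<Xi>. finite (V i) \<and> finite (C i) \<and> (\<forall>v\<in>V i. rational_vector v) \<and>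
      (\<forall>c\<in>C i. rational_vector c) \<and> V i \<noteq> {} \<and> (\<forall>c\<in>C i. 0 < \<omega> \<bullet> c) \<and> Q i = convex hull (V i) + gen_cone (C i)"
    by (rule bchoice[THEN exE])
  have VC: "\<And>i. i \<in> \<Xi> \<Longrightarrow> finite (V i)" "\<And>i. i \<in> \<Xi> \<Longrightarrow> finite (C i)"
    "\<And>i v. i \<in> \<Xi> \<Longrightarrow> v \<in> V i \<Longrightarrow> rational_vector v" "\<And>i c. i \<in> \<Xi> \<Longrightarrow> c \<in> C i \<Longrightarrow> rational_vector c"
    "\<And>i. i \<in> \<Xi> \<Longrightarrow> V i \<noteq> {}" "\<And>i c. i \<in> \<Xi> \<Longrightarrow> c \<in> C i \<Longrightarrow> 0 < \<omega> \<bullet> c"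
    "\<And>i. i \<in> \<Xi> \<Longrightarrow> Q i = convex hull (V i) + gen_cone (C i)"
    using C by blast+
  have VQ: "v \<in> Q i" if "i \<in> \<Xi>" "v \<in> V i" for i v
    using set_plus_intro[OF hull_inc[OF that(2)] gen_cone_0[of "C i"], of convex] VC(7)[OF that(1)] by simp
  have "\<exists>u\<in>V i. \<forall>x\<in>V i. \<omega> \<bullet> u \<le> \<omega> \<bullet> x" if "i \<in> \<Xi>" for i
    using VC(1,5)[OF that] ex_min_if_finite[of "(\<lambda>x. \<omega> \<bullet> x) ` V i"] by (auto simp: not_less)
  then obtain u where u: "\<And>i. i \<in> \<Xi> \<Longrightarrow> u i \<in> V i" "\<And>i x. i \<in> \<Xi> \<Longrightarrow> x \<in> V i \<Longrightarrow> \<omega> \<bullet> u i \<le> \<omega> \<bullet> x"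
    by metis
  have qu: "q \<omega> i = \<omega> \<bullet> u i" if i: "i \<in> \<Xi>" for i
  proof -
    have "ereal (\<omega> \<bullet> u i) \<le> min_value (Q i) \<omega>"
      unfolding VC(7)[OF i] by (rule le_min_value_generated) (use u(2) VC(6) i in \<open>auto intro: less_imp_le\<close>)
    then have "min_value (Q i) \<omega> = ereal (\<omega> \<bullet> u i)"
      using min_value_le[OF VQ[OF i u(1)[OF i]], of \<omega>] by (rule antisym[rotated])
    then show ?thesis by (simp add: q_def)
  qed
  \<comment> \<open>\<omega> \<bullet> p is minus the common slope. Hence the points u_i + i p for i
    = k - 1, k, k + 1 have the same minimal \<omega>-value.\<close>
  define p where "p = u k - u (k + 1)"
  have p_rat: "rational_vector p"
    unfolding p_def using k\<Xi> u(1) VC(3) by (intro rational_vector_diff) auto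
  \<comment> \<open>Up to recession directions, these points generate the polyhedra Q_i + i
    p.\<close>
  define X where "X = (\<Union>i\<in>\<Xi>. (\<lambda>x. x + real i *\<^sub>R p) ` V i)"
  have X_fin: "finite X" unfolding X_def using \<Xi>(1) VC(1) by auto
  have X_rat: "rational_vector x" if "x \<in> X" for x
    using that VC(3) p_rat unfolding X_def by (auto intro!: rational_vector_add rational_vector_scaleR)
  define w where "w = u k + real k *\<^sub>R p"
  have wX: "w \<in> X" unfolding w_def X_def using k\<Xi> u(1) by blast
  have w_min: "\<omega> \<bullet> w \<le> \<omega> \<bullet> x" if "x \<in> X" for x
  proof -
    obtain i y where iy: "i \<in> \<Xi>" "y \<in> V i" "x = y + real i *\<^sub>R p" using \<open>x \<in> X\<close> unfolding X_def by blast
    have i: "i \<in> {lo..hi}" using iy(1) unfolding mem_\<Xi> by simp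
    have "q \<omega> k + (real i - real k) * (q \<omega> (Suc k) - q \<omega> k) \<le> q \<omega> i"
      by (rule discrete_convex_supporting_line[OF conv _ _ i]) (use k in auto)
    moreover have pw: "\<omega> \<bullet> p = q \<omega> k - q \<omega> (Suc k)" using k\<Xi> by (simp add: p_def qu inner_diff_right)
    moreover have "q \<omega> i \<le> \<omega> \<bullet> y" using u(2)[OF iy(1,2)] qu[OF iy(1)] by simp
    ultimately show ?thesis
      unfolding iy(3) w_def inner_add_right inner_scaleR_right pw qu[OF k\<Xi>(2), symmetric] by (simp add: algebra_simps)
  qed
  \<comment> \<open>Rational points with the same \<omega>-value coincide; an equality of three
    numbers thus becomes an equality of three vertices.\<close>
  have w_eq: "w = u i + real i *\<^sub>R p" if i: "i = k - 1 \<or> i = k \<or> i = k + 1" for i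
  proof (rule rationally_independent_inj[OF independent X_rat[OF wX]])
    have i\<Xi>: "i \<in> \<Xi>" using i k\<Xi> by blast
    then have "u i + real i *\<^sub>R p \<in> X" unfolding X_def using u(1) by blast
    then show "rational_vector (u i + real i *\<^sub>R p)" by (rule X_rat)
    have pw: "\<omega> \<bullet> p = q \<omega> k - q \<omega> (k + 1)" using k\<Xi> by (simp add: p_def qu inner_diff_right)
    have "real (k - 1) = real k - 1" using k(1) by simp
    then show "\<omega> \<bullet> w = \<omega> \<bullet> (u i + real i *\<^sub>R p)"
      unfolding w_def inner_add_right inner_scaleR_right pw qu[OF k\<Xi>(2), symmetric] qu[OF i\<Xi>, symmetric]
      using i k(3) by (auto simp: algebra_simps)
  qed

  text \<open>
    The cone \<open>G\<close> contains all recession directions and all edge directions at the \<open>\<omega>\<close>-minimal vertex,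
    so that adding it leaves a single vertex.
  \<close>
  define G where "G = (\<Union>i\<in>\<Xi>. C i) \<union> (\<lambda>x. x - w) ` (X - {w})"
  have G_fin: "finite G" unfolding G_def using \<Xi>(1) VC(2) X_fin by auto
  have G_rat: "rational_vector g" if "g \<in> G" for g
    using that VC(4) X_rat wX unfolding G_def by (auto intro: rational_vector_diff)
  \<comment> \<open>\<open>w\<close> is the only \<omega>-minimal point of \<open>X\<close>.
    Positivity on \<open>G\<close> keeps P inside the semiring and makes \<open>w\<close> a vertex
    of w + cone(G).\<close>
  have G_pos: "0 < \<omega> \<bullet> g" if "g \<in> G" for g
    using that unfolding G_def
  proof
    assume "g \<in> (\<Union>i\<in>\<Xi>. C i)"
    then show ?thesis using VC(6) by blast
  next
    assume "g \<in> (\<lambda>x. x - w) ` (X - {w})"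
    then obtain x where x: "x \<in> X" "x \<noteq> w" "g = x - w" by blast
    have "\<omega> \<bullet> x \<noteq> \<omega> \<bullet> w" using rationally_independent_inj[OF independent X_rat[OF x(1)] X_rat[OF wX]] x(2) by blast
    then show ?thesis using w_min[OF x(1)] x(3) by (simp add: inner_diff_right)
  qed
  define P where "P = convex hull {p} + gen_cone G"
  define W where "W = convex hull {w} + gen_cone G"
  have P: "P \<in> carrier A - {{}}" and W: "W \<in> carrier A - {{}}"
    unfolding P_def W_def
    by (rule generated_carrier; use G_fin G_rat G_pos p_rat X_rat wX in \<open>auto intro: less_imp_le\<close>)+
  have Pc: "P \<in> carrier A" using P by blast
  have pP: "p \<in> P" using set_plus_intro[OF hull_inc gen_cone_0[of G], of p "{p}" convex] by (simp add: P_def)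
  have wW: "w \<in> W" using set_plus_intro[OF hull_inc gen_cone_0[of G], of w "{w}" convex] by (simp add: W_def)
  have mvP: "min_value P l = ereal (l \<bullet> p)" if "\<forall>g\<in>G. 0 \<le> l \<bullet> g" for l
  proof (rule antisym)
    show "ereal (l \<bullet> p) \<le> min_value P l"
      unfolding P_def by (rule le_min_value_generated) (use that in auto)
  qed (rule min_value_le[OF pP])
  have mvP': "min_value P l = -\<infinity>" if "\<not> (\<forall>g\<in>G. 0 \<le> l \<bullet> g)" for l
    unfolding P_def using that min_value_generated_MInf[OF G_fin, of p "{p}"] by (auto simp: not_le)
  let ?S = "usummand A \<phi> P"
  have S: "?S i \<in> carrier A" for i by (rule usummand_carrier[OF \<phi>_carrier Pc])
  have mvS: "min_value (?S i) l = min_value (Q i) l + ereal (real i) * min_value P l" if "i \<in> \<Xi>" for i l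
    using min_value_usummand[OF \<phi>_carrier, of P i l] that by (simp add: \<phi>_eq)
  have SW: "?S i \<subseteq> W" if i: "i \<in> \<Xi>" for i
  proof (rule subset_if_min_value_le)
    show "closed W" "convex W" using W carrier_closed carrier_convex by blast+
    fix l
    show "min_value W l \<le> min_value (?S i) l"
    proof (cases "\<forall>g\<in>G. 0 \<le> l \<bullet> g")
      case True
      have "ereal (l \<bullet> w - real i * (l \<bullet> p)) \<le> min_value (Q i) l"
        unfolding VC(7)[OF i]
      proof (rule le_min_value_generated)
        fix y assume y: "y \<in> V i"
        have "0 \<le> l \<bullet> (y + real i *\<^sub>R p - w)"
        proof (cases "y + real i *\<^sub>R p = w")
          case False
          then have "y + real i *\<^sub>R p - w \<in> G" unfolding G_def X_def using i y by blast
          then show ?thesis using True by blast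
        qed simp
        then show "l \<bullet> w - real i * (l \<bullet> p) \<le> l \<bullet> y" by (simp add: inner_diff_right inner_add_right)
      next
        fix c assume "c \<in> C i"
        then have "c \<in> G" unfolding G_def using i by blast
        then show "0 \<le> l \<bullet> c" using True by blast
      qed
      then have "ereal (l \<bullet> w - real i * (l \<bullet> p)) + ereal (real i * (l \<bullet> p)) \<le> min_value (?S i) l"
        unfolding mvS[OF i] mvP[OF True] by (intro add_mono) auto
      then have "ereal (l \<bullet> w) \<le> min_value (?S i) l" by simp
      then show ?thesis using min_value_le[OF wW, of l] by simp
    next
      case False
      then have "min_value W l = -\<infinity>"
        unfolding W_def using min_value_generated_MInf[OF G_fin, of w "{w}"] by (auto simp: not_le)
      then show ?thesis by simp
    qed
  qed
  have pow: "real i *\<^sub>R p \<in> P [^]\<^bsub>A\<^esub> i" for i :: nat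
  proof (induction i)
    case (Suc i)
    have "real i *\<^sub>R p + p \<in> P [^]\<^bsub>A\<^esub> i + P" by (rule set_plus_intro[OF Suc pP])
    then show ?case by (simp add: algebra_simps)
  qed simp
  have wS: "w \<in> ?S i" if i: "i = k - 1 \<or> i = k \<or> i = k + 1" for i
  proof -
    have i\<Xi>: "i \<in> \<Xi>" using i k\<Xi> by blast
    have "u i + real i *\<^sub>R p \<in> Q i + P [^]\<^bsub>A\<^esub> i" by (intro set_plus_intro VQ[OF i\<Xi>] u(1)[OF i\<Xi>] pow)
    then show ?thesis using i\<Xi> unfolding w_eq[OF i] usummand_def UP_coeff[OF \<phi>_carrier] by (simp add: \<phi>_eq)
  qed
  \<comment> \<open>Here k > 0 matters: at least one copy of P is needed for the summand to contain
    the cone over \<open>G\<close>, and the index k - 1 may be 0.\<close>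
  have WS: "W \<subseteq> ?S k"
  proof (rule subset_if_min_value_le)
    show "closed (?S k)" "convex (?S k)" using S carrier_closed carrier_convex by blast+
    fix l
    show "min_value (?S k) l \<le> min_value W l"
    proof (cases "\<forall>g\<in>G. 0 \<le> l \<bullet> g")
      case True
      have "ereal (l \<bullet> w) \<le> min_value W l"
        unfolding W_def by (rule le_min_value_generated) (use True in auto)
      then show ?thesis using min_value_le[OF wS[of k], of l] by simp
    next
      case False
      have "min_value (Q k) l \<noteq> \<infinity>" using Q_nonempty[OF k\<Xi>(2)] by (simp add: min_value_eq_PInf_iff)
      then have "min_value (?S k) l = -\<infinity>" unfolding mvS[OF k\<Xi>(2)] mvP'[OF False] using k(1) by simp
      then show ?thesis by simp
    qed
  qed
  define E' where "E' = (\<Oplus>\<^bsub>A\<^esub>i\<in>usupp A \<phi>. ?S i)"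
  have "E' = W"
  proof (rule subset_antisym)
    show "W \<subseteq> E'"
      using WS summand_subset_finsum[OF \<Xi>(1), of ?S k] S k\<Xi>(2) unfolding E'_def usupp_\<phi> by blast
    show "E' \<subseteq> W"
    proof (rule subset_if_min_value_le)
      show "closed W" "convex W" using W carrier_closed carrier_convex by blast+
      fix l
      have "min_value W l \<le> min_value (?S i) l" if "i \<in> \<Xi>" for i
        unfolding le_min_value_iff[of _ "?S i"] using SW[OF that] by (blast intro: min_value_le)
      then show "min_value W l \<le> min_value E' l"
        unfolding E'_def usupp_\<phi> using S \<Xi>(1) by (subst min_value_finsum) (auto intro!: INF_greatest)
    qed
  qed
  have w_ext: "w extreme_point_of W"
  proof (rule strict_min_extreme_point[OF wW, of \<omega>])
    show "\<omega> \<bullet> w < \<omega> \<bullet> x" if "x \<in> W" "x \<noteq> w" for x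
      by (rule strict_min_generated[of "{w}" w \<omega> G]) (use that G_pos in \<open>auto simp: W_def\<close>)
  qed
  \<comment> \<open>Any other point w + g is the midpoint of w and w + 2 g.\<close>
  have only: "e = w" if e: "e extreme_point_of W" for e
  proof (rule ccontr)
    assume ne: "e \<noteq> w"
    have "e \<in> W" using e by (simp add: extreme_point_of_def)
    then obtain g where g: "g \<in> gen_cone G" "e = w + g" by (auto simp: W_def elim: set_plus_elim)
    have "w + 2 *\<^sub>R g \<in> W"
      unfolding W_def by (intro set_plus_intro hull_inc gen_cone_scaleR g) auto
    moreover have "e \<in> open_segment w (w + 2 *\<^sub>R g)"
    proof -
      have "(1 - 1/2) *\<^sub>R w + (1/2) *\<^sub>R (w + 2 *\<^sub>R g) = ((1 - 1/2) + 1/2) *\<^sub>R w + g"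
        unfolding scaleR_add_left scaleR_add_right scaleR_scaleR by simp
      then have "e = (1 - 1/2) *\<^sub>R w + (1/2) *\<^sub>R (w + 2 *\<^sub>R g)" using g(2) by simp
      moreover have "w \<noteq> w + 2 *\<^sub>R g" using g ne by auto
      ultimately show ?thesis unfolding in_segment by (intro conjI exI[of _ "1/2"]) auto
    qed
    ultimately show False using e wW by (auto simp: extreme_point_of_def)
  qed
  have vs: "vertices_shared A 3 (usupp A \<phi>) ?S"
    unfolding vertices_shared_def E'_def[symmetric] \<open>E' = W\<close>
  proof (intro allI impI)
    fix e assume "e extreme_point_of W"
    then have e: "e = w" by (rule only)
    \<comment> \<open>The summands k - 1 and k + 1 need not equal \<open>W\<close>. It suffices that
      they contain \<open>w\<close> and lie inside \<open>W\<close>.\<close>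
    have "w extreme_point_of ?S i" if "i = k - 1 \<or> i = k \<or> i = k + 1" for i
      using extreme_point_of_subset[OF w_ext SW wS[OF that]] that k\<Xi> by blast
    then have "{k - 1, k, k + 1} \<subseteq> {i \<in> usupp A \<phi>. e extreme_point_of ?S i}"
      unfolding e usupp_\<phi> using k\<Xi> by blast
    then have "card {k - 1, k, k + 1} \<le> card {i \<in> usupp A \<phi>. e extreme_point_of ?S i}"
      using \<Xi>(1) unfolding usupp_\<phi> by (intro card_mono) auto
    moreover have "card {k - 1, k, k + 1} = 3" using k(1) by (cases k) auto
    ultimately show "3 \<le> card {i \<in> usupp A \<phi>. e extreme_point_of ?S i}" by simp
  qed
  then have "vertices_shared A 2 (usupp A \<phi>) ?S" by (rule vertices_shared_mono) simp
  then have "uroot A \<phi> P" using P by (simp add: uroot_def)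
  have sh3: "shared_by_representative A \<phi> P 3"
    unfolding shared_by_representative_def using \<phi>_carrier vs by (auto simp: same_function_def)
  \<comment> \<open>The multiplicity may exceed 2; it is the largest element of this finite set
    minus 1.\<close>
  let ?M = "{m. shared_by_representative A \<phi> P m}"
  have "?M \<subseteq> {..Suc hi}" using multiplicity_bound[OF Pc] P by blast
  then have M: "finite ?M" by (rule finite_subset) simp
  have "Max ?M \<in> ?M" using M sh3 by (intro Max_in) auto
  moreover have le: "m \<le> Max ?M" if "shared_by_representative A \<phi> P m" for m using M that by (intro Max_ge) auto
  ultimately have "root_multiplicity A \<phi> P (Max ?M - 1)"
    unfolding root_multiplicity_def using \<open>uroot A \<phi> P\<close> by blast
  moreover have "2 \<le> Max ?M - 1" using le[OF sh3] by simp
  ultimately show ?thesis unfolding weakly_degenerate_def by blast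
qed

end

theorem theorem1p3:
  fixes \<omega> :: "real ^ 'n"
    and \<Xi> :: "nat set"
    and Q :: "nat \<Rightarrow> (real ^ 'n) set"
    and \<phi> :: "nat \<Rightarrow> (real ^ 'n) set"
    and \<Delta> :: cmpoly
  assumes "rationally_independent \<omega>"
    and "finite \<Xi>" and "\<Xi> \<noteq> {}"
    and "\<And>i. i \<in> \<Xi> \<Longrightarrow> Q i \<in> carrier (polyhedra_semiring \<omega>) - {\<zero>\<^bsub>polyhedra_semiring \<omega>\<^esub>}"
    and "\<phi> = (\<Oplus>\<^bsub>UP (polyhedra_semiring \<omega>)\<^esub>i\<in>\<Xi>. monom (UP (polyhedra_semiring \<omega>)) (Q i) i)"
    and "product_form (polyhedra_semiring \<omega>) \<phi>"
    and "is_X_discriminant \<Xi> \<Delta>"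
  shows "(degenerate (polyhedra_semiring \<omega>) \<phi> \<longrightarrow>
            mroot (polyhedra_semiring \<omega>) \<Xi> (polyhedralise (polyhedra_semiring \<omega>) \<Delta>) Q) \<and>
         (mroot (polyhedra_semiring \<omega>) \<Xi> (polyhedralise (polyhedra_semiring \<omega>) \<Delta>) Q \<longrightarrow>
            weakly_degenerate (polyhedra_semiring \<omega>) \<phi>)"
proof -
  interpret product_polynomial \<omega> \<Xi> Q \<phi>
    by unfold_locales (use assms in auto)
  show ?thesis using degenerate_imp_mroot mroot_imp_weakly_degenerate assms(7) by blast
qed

end
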